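(* Let $c$ satisfy assumption (A) (see context), let $T>0$, and let $\mathcal D\subset\mathcal U$ be an open dense set of generic initial data, as described in the context. Let $(u_0,u_1)\in\mathcal D$ with $u_0,u_1\in C^\infty(\mathbb R)$. Let $(u,w,z,p,q,x,t)(X,Y)$ be the corresponding solution of the semilinear system with the boundary data on $\{X+Y=0\}$ given in the context, and let $u=u(x,t)$ be the corresponding (conservative) solution of $u_{tt}-c(u)\big(c(u)u_x\big)_x=0$, $u(x,0)=u_0(x)$, $u_t(x,0)=u_1(x)$. Consider a singular point $P=(X_0,Y_0)$ where $w=\pi$, set $(x_0,t_0)=(x(X_0,Y_0),t(X_0,Y_0))$, and assume $t_0\in[0,T]$. Below, $c(u_0)$ denotes the value of $c$ at the number $u(x_0,t_0)=u(X_0,Y_0)$, and the expansions hold for $(x,t)$ in a neighborhood of $(x_0,t_0)$. (i) If $P$ is a point of Type 1, along a curve where $w=\pi$ (that is, $w=\pi$, $w_X\neq0$, $z\neq\pi$ at $P$), then there exist constants $a\neq0$ and $b_1,b_2$ such that $$u(x,t)=u(x_0,t_0)-a\cdot\big[c(u_0)(t-t_0)+(x-x_0)\big]^{2/3}+b_1\cdot(x-x_0)+b_2\cdot(t-t_0)+\mathcal O(1)\cdot\big(|t-t_0|+|x-x_0|\big)^{4/3}.$$ (ii) If $P$ is a point of Type 2, where $w=\pi$, $w_X=0$, and $w_{XX}>0$, then in the $x$-$t$ plane this corresponds to a point $(x_0,t_0)$ where two new singular curves $\gamma^-,\gamma^+$ originate. In this case, there exists a constant $a\neq0$ such that $$u(x,t)=u(x_0,t_0)+a\cdot\big[c(u_0)(t-t_0)+(x-x_0)\big]^{3/5}+\mathcal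 O(1)\cdot\big(|t-t_0|+|x-x_0|\big)^{4/5}.$$ (iii) If $P$ is a point of Type 3, where $w=z=\pi$, then in the $x$-$t$ plane this corresponds to a point $(x_0,t_0)$ where two singular curves $\gamma,\tilde\gamma$ cross each other. In this case, there exist constants $a_1\neq0$ and $a_2\neq0$ such that $$u(x,t)=u(x_0,t_0)+a_1\cdot\big[c(u_0)(t-t_0)+(x-x_0)\big]^{2/3}+a_2\cdot\big[c(u_0)(t-t_0)-(x-x_0)\big]^{2/3}+\mathcal O(1)\cdot\big(|t-t_0|+|x-x_0|\big).$$
   Context: **Assumption (A).** $c:\mathbb R\to\mathbb R_+$ is smooth and uniformly positive, $c'(u)/c(u)$ is uniformly bounded, and $c'(u)=0$ implies $c''(u)\neq0$. **Semilinear system.** With unknowns $(u,w,z,p,q,x,t)$ as functions of $(X,Y)\in\mathbb R^2$, and $c=c(u)$, $c'=c'(u)$: $$u_X=\frac{\sin w}{4c}p,\qquad u_Y=\frac{\sin z}{4c}q,$$ $$w_Y=\frac{c'}{8c^2}(\cos z-\cos w)\,q,\qquad z_X=\frac{c'}{8c^2}(\cos w-\cos z)\,p,$$ $$p_Y=\frac{c'}{8c^2}(\sin z-\sin w)\,pq,\qquad q_X=\frac{c'}{8c^2}(\sin w-\sin z)\,pq,$$ $$x_X=\frac{(1+\cos w)p}{4},\qquad x_Y=-\frac{(1+\cos z)q}{4},$$ $$t_X=\frac{(1+\cos w)p}{4c},\qquad t_Y=\frac{(1+\cos z)q}{4c}.$$ The variables $w,z$ are regarded as taking values in $\mathbb R/2\pi\mathbb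 Z$. **Boundary data.** Put $R(s,0)=u_1(s)+c(u_0(s))u_0'(s)$ and $S(s,0)=u_1(s)-c(u_0(s))u_0'(s)$. On the line $\{X+Y=0\}$, at the point $(X,Y)=(s,-s)$ one prescribes $$u=u_0(s),\quad t=0,\quad x=s,\quad w=2\arctan R(s,0),\quad z=2\arctan S(s,0),\quad p=1+R^2(s,0),\quad q=1+S^2(s,0).$$ It is known that the (overdetermined) system with these data has a unique solution on all of $\mathbb R^2$ (smooth if $u_0,u_1$ are smooth), and that the set $\{(x(X,Y),t(X,Y),u(X,Y)):(X,Y)\in\mathbb R^2\}$ is the graph of a function $u=u(x,t)$, which is the unique conservative solution of the Cauchy problem for the wave equation; this is the meaning of $u(x,t)$ here. **Generic data.** $\mathcal U=\big(C^3(\mathbb R)\cap H^1(\mathbb R)\big)\times\big(C^2(\mathbb R)\cap L^2(\mathbb R)\big)$. For the given $T>0$, $\mathcal D\subset\mathcal U$ is an open dense set (known to exist) such that for every $(u_0,u_1)\in\mathcal D$ the corresponding solution of the semilinear system attains none of the following values at any point $(X,Y)$ with $(x(X,Y),t(X,Y))\in\mathbb R\times[0,T]$: $(w,w_X,w_{XX})=(\pi,0,0)$; $(z,z_Y,z_{YY})=(\pi,0,0)$; $(w,z,w_X)=(\pi,\pi,0)$; $(w,z,z_Y)=(\pi,\pi,0)$; $(w,w_X,c'(u))=(\pi,0,0)$; $(z,z_Y,c'(u))=(\pi,0,0)$. **Types of singular points** $P=(X_0,Y_0)$ (where $w=\pi$). Type 1: $w=\pi$, $w_X\neq0$, $z\neq\pi$.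 Type 2: $w=\pi$, $w_X=0$, $w_{XX}\neq0$ (for data in $\mathcal D$ this forces $z\neq\pi$ and $w_Y\neq0$ at $P$). Type 3: $w=z=\pi$. **Singular curves.** Let $\Lambda(X,Y)=(x(X,Y),t(X,Y))$. Singular curves in the $x$-$t$ plane are the images under $\Lambda$ of the curves forming the level sets $\{w=\pi\}$ and $\{z=\pi\}$; along them $u(x,t)$ is not differentiable. "Two new singular curves $\gamma^-,\gamma^+$ originate at $(x_0,t_0)$" means that, locally near $(x_0,t_0)$, the image under $\Lambda$ of the branch of $\{w=\pi\}$ through $P$ consists of two curves $x=\gamma^-(t)<x=\gamma^+(t)$ defined for $t>t_0$, both tending to $x_0$ as $t\downarrow t_0$, with no singular points for $t<t_0$. In (iii), $\gamma$ and $\tilde\gamma$ are the images of the branches of $\{w=\pi\}$ and $\{z=\pi\}$ through $P$. **Notation.** Fractional powers are defined for all real $s$ by $s^{2/3}=(\sqrt[3]{s})^2$ and $s^{3/5}=(\sqrt[5]{s})^3$ (real roots). $\mathcal O(1)$ denotes a quantity that remains bounded for $(x,t)$ in a neighborhood of $(x_0,t_0)$. The constants may depend on the solution and on $P$.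
   Formalization: In (ii), that two new singular curves originate at (x0,t0) is false if c'(u)>0 at P. It is proved when w_Y<0 (i.e. c'(u)<0); when w_Y>0 the time-reversed picture is proved: two singular curves merge and end there. The 3/5 expansion holds in both cases. *)

theory Defs
  imports "HOL-Analysis.Analysis" "HOL-Library.Landau_Symbols" "HOL-Library.Real_Mod"
begin

definition Ck :: "nat \<Rightarrow> (real \<Rightarrow> real) \<Rightarrow> bool" where
  "Ck k f \<longleftrightarrow>
     (\<forall>i<k. (deriv ^^ i) f differentiable_on UNIV) \<and> continuous_on UNIV ((deriv ^^ k) f)"

definition smooth :: "(real \<Rightarrow> real) \<Rightarrow> bool" where
  "smooth f \<longleftrightarrow> (\<forall>k. Ck k f)"

definition dX :: "(real \<Rightarrow> real \<Rightarrow> real) \<Rightarrow> real \<Rightarrow> real \<Rightarrow> real" where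
  "dX f X Y = deriv (\<lambda>s. f s Y) X"

definition dY :: "(real \<Rightarrow> real \<Rightarrow> real) \<Rightarrow> real \<Rightarrow> real \<Rightarrow> real" where
  "dY f X Y = deriv (\<lambda>s. f X s) Y"

definition jointly_continuous :: "(real \<Rightarrow> real \<Rightarrow> real) \<Rightarrow> bool" where
  "jointly_continuous f \<longleftrightarrow> continuous_on UNIV (\<lambda>(X, Y). f X Y)"

primrec Ck_plane :: "nat \<Rightarrow> (real \<Rightarrow> real \<Rightarrow> real) \<Rightarrow> bool" where
  "Ck_plane 0 f \<longleftrightarrow> jointly_continuous f"
| "Ck_plane (Suc k) f \<longleftrightarrow>
     (\<forall>X Y. (\<lambda>s. f s Y) differentiable (at X) \<and> (\<lambda>s. f X s) differentiable (at Y)) \<and>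
     Ck_plane k (dX f) \<and> Ck_plane k (dY f)"

definition smooth_plane :: "(real \<Rightarrow> real \<Rightarrow> real) \<Rightarrow> bool" where
  "smooth_plane f \<longleftrightarrow> (\<forall>k. Ck_plane k f)"

definition assumption_A :: "(real \<Rightarrow> real) \<Rightarrow> bool" where
  "assumption_A c \<longleftrightarrow>
     smooth c \<and>
     (\<exists>\<kappa>>0. \<forall>u. \<kappa> \<le> c u) \<and>
     bounded (range (\<lambda>u. deriv c u / c u)) \<and>
     (\<forall>u. deriv c u = 0 \<longrightarrow> deriv (deriv c) u \<noteq> 0)"

text \<open>The angles \<open>w\<close> and \<open>z\<close> live in the reals modulo \<open>2 * pi\<close>.  Since the plane is simply
  connected, they are represented by their continuous real-valued lifts that equal
  \<open>2 * arctan R\<close> and \<open>2 * arctan S\<close> on the line \<open>X + Y = 0\<close>.  A lift can cross odd multiples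
  of \<open>pi\<close> other than \<open>pi\<close> itself, so the equation \<open>w = pi\<close> is always read as a congruence.\<close>

abbreviation angle_pi :: "real \<Rightarrow> bool" where
  "angle_pi a \<equiv> [a = pi] (rmod (2 * pi))"

definition R_init :: "(real \<Rightarrow> real) \<Rightarrow> (real \<Rightarrow> real) \<Rightarrow> (real \<Rightarrow> real) \<Rightarrow> real \<Rightarrow> real" where
  "R_init c u0 u1 s = u1 s + c (u0 s) * deriv u0 s"

definition S_init :: "(real \<Rightarrow> real) \<Rightarrow> (real \<Rightarrow> real) \<Rightarrow> (real \<Rightarrow> real) \<Rightarrow> real \<Rightarrow> real" where
  "S_init c u0 u1 s = u1 s - c (u0 s) * deriv u0 s"

definition semilinear_eqs ::
  "(real \<Rightarrow> real) \<Rightarrow> (real \<Rightarrow> real \<Rightarrow> real) \<Rightarrow> (real \<Rightarrow> real \<Rightarrow> real) \<Rightarrow> (real \<Rightarrow> real \<Rightarrow> real) \<Rightarrow>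
   (real \<Rightarrow> real \<Rightarrow> real) \<Rightarrow> (real \<Rightarrow> real \<Rightarrow> real) \<Rightarrow> (real \<Rightarrow> real \<Rightarrow> real) \<Rightarrow> (real \<Rightarrow> real \<Rightarrow> real) \<Rightarrow> bool"
where
  "semilinear_eqs c u w z p q x t \<longleftrightarrow> (\<forall>X Y.
     let c0 = c (u X Y); k = deriv c (u X Y) / (8 * (c (u X Y))\<^sup>2);
         W = w X Y; Z = z X Y; P = p X Y; Q = q X Y
     in
     ((\<lambda>s. u s Y) has_real_derivative sin W / (4 * c0) * P) (at X) \<and>
     ((\<lambda>s. u X s) has_real_derivative sin Z / (4 * c0) * Q) (at Y) \<and>
     ((\<lambda>s. w X s) has_real_derivative k * (cos Z - cos W) * Q) (at Y) \<and>
     ((\<lambda>s. z s Y) has_real_derivative k * (cos W - cos Z) * P) (at X) \<and>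
     ((\<lambda>s. p X s) has_real_derivative k * (sin Z - sin W) * (P * Q)) (at Y) \<and>
     ((\<lambda>s. q s Y) has_real_derivative k * (sin W - sin Z) * (P * Q)) (at X) \<and>
     ((\<lambda>s. x s Y) has_real_derivative (1 + cos W) * P / 4) (at X) \<and>
     ((\<lambda>s. x X s) has_real_derivative - ((1 + cos Z) * Q / 4)) (at Y) \<and>
     ((\<lambda>s. t s Y) has_real_derivative (1 + cos W) * P / (4 * c0)) (at X) \<and>
     ((\<lambda>s. t X s) has_real_derivative (1 + cos Z) * Q / (4 * c0)) (at Y))"

definition semilinear_solution ::
  "(real \<Rightarrow> real) \<Rightarrow> (real \<Rightarrow> real) \<Rightarrow> (real \<Rightarrow> real) \<Rightarrow>
   (real \<Rightarrow> real \<Rightarrow> real) \<Rightarrow> (real \<Rightarrow> real \<Rightarrow> real) \<Rightarrow> (real \<Rightarrow> real \<Rightarrow> real) \<Rightarrow>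
   (real \<Rightarrow> real \<Rightarrow> real) \<Rightarrow> (real \<Rightarrow> real \<Rightarrow> real) \<Rightarrow> (real \<Rightarrow> real \<Rightarrow> real) \<Rightarrow> (real \<Rightarrow> real \<Rightarrow> real) \<Rightarrow> bool"
where
  "semilinear_solution c u0 u1 u w z p q x t \<longleftrightarrow>
     (\<forall>f \<in> {u, w, z, p, q, x, t}. jointly_continuous f) \<and>
     semilinear_eqs c u w z p q x t \<and>
     (\<forall>s. u s (- s) = u0 s \<and> t s (- s) = 0 \<and> x s (- s) = s \<and>
          w s (- s) = 2 * arctan (R_init c u0 u1 s) \<and>
          z s (- s) = 2 * arctan (S_init c u0 u1 s) \<and>
          p s (- s) = 1 + (R_init c u0 u1 s)\<^sup>2 \<and>
          q s (- s) = 1 + (S_init c u0 u1 s)\<^sup>2)"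

text \<open>The set of all points \<open>(x, t, u)\<close> is the graph of \<open>v\<close>, as a function on the whole
  \<open>x\<close>-\<open>t\<close> plane; this is what makes \<open>v\<close> the conservative solution.\<close>

definition conservative_graph ::
  "(real \<Rightarrow> real \<Rightarrow> real) \<Rightarrow> (real \<Rightarrow> real \<Rightarrow> real) \<Rightarrow> (real \<Rightarrow> real \<Rightarrow> real) \<Rightarrow> (real \<Rightarrow> real \<Rightarrow> real) \<Rightarrow> bool"
where
  "conservative_graph x t u v \<longleftrightarrow>
     range (\<lambda>(X, Y). (x X Y, t X Y, u X Y)) = range (\<lambda>(\<xi>, \<tau>). (\<xi>, \<tau>, v \<xi> \<tau>))"

text \<open>\<open>C\<^sup>k\<close> over the reals is the normed space of functions with bounded continuous derivatives
  up to order \<open>k\<close>.  For continuously differentiable functions the weak derivative in the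
  definition of \<open>H\<^sup>1\<close> is the classical one.\<close>

definition Ck_space :: "nat \<Rightarrow> (real \<Rightarrow> real) set" where
  "Ck_space k = {f. Ck k f \<and> (\<forall>i\<le>k. bounded (range ((deriv ^^ i) f)))}"

definition Ck_norm :: "nat \<Rightarrow> (real \<Rightarrow> real) \<Rightarrow> real" where
  "Ck_norm k f = (\<Sum>i\<le>k. SUP s. \<bar>(deriv ^^ i) f s\<bar>)"

definition square_integrable :: "(real \<Rightarrow> real) \<Rightarrow> bool" where
  "square_integrable f \<longleftrightarrow> integrable lborel (\<lambda>s. (f s)\<^sup>2)"

definition L2_norm :: "(real \<Rightarrow> real) \<Rightarrow> real" where
  "L2_norm f = sqrt (\<integral>s. (f s)\<^sup>2 \<partial>lborel)"

definition H1_norm :: "(real \<Rightarrow> real) \<Rightarrow> real" where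
  "H1_norm f = sqrt ((L2_norm f)\<^sup>2 + (L2_norm (deriv f))\<^sup>2)"

definition data_space :: "((real \<Rightarrow> real) \<times> (real \<Rightarrow> real)) set" where
  "data_space =
     {f \<in> Ck_space 3. square_integrable f \<and> square_integrable (deriv f)} \<times>
     {g \<in> Ck_space 2. square_integrable g}"

definition data_dist ::
  "(real \<Rightarrow> real) \<times> (real \<Rightarrow> real) \<Rightarrow> (real \<Rightarrow> real) \<times> (real \<Rightarrow> real) \<Rightarrow> real"
where
  "data_dist a b =
     (let f = (\<lambda>s. fst a s - fst b s); g = (\<lambda>s. snd a s - snd b s)
      in Ck_norm 3 f + H1_norm f + Ck_norm 2 g + L2_norm g)"

definition open_dense_data :: "((real \<Rightarrow> real) \<times> (real \<Rightarrow> real)) set \<Rightarrow> bool" where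
  "open_dense_data D \<longleftrightarrow>
     D \<subseteq> data_space \<and>
     (\<forall>a\<in>D. \<exists>\<epsilon>>0. \<forall>b\<in>data_space. data_dist a b < \<epsilon> \<longrightarrow> b \<in> D) \<and>
     (\<forall>a\<in>data_space. \<forall>\<epsilon>>0. \<exists>b\<in>D. data_dist a b < \<epsilon>)"

definition generic_at ::
  "(real \<Rightarrow> real) \<Rightarrow> (real \<Rightarrow> real \<Rightarrow> real) \<Rightarrow> (real \<Rightarrow> real \<Rightarrow> real) \<Rightarrow> (real \<Rightarrow> real \<Rightarrow> real) \<Rightarrow>
   real \<Rightarrow> real \<Rightarrow> bool"
where
  "generic_at c u w z X Y \<longleftrightarrow>
     \<not> (angle_pi (w X Y) \<and> dX w X Y = 0 \<and> dX (dX w) X Y = 0) \<and>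
     \<not> (angle_pi (z X Y) \<and> dY z X Y = 0 \<and> dY (dY z) X Y = 0) \<and>
     \<not> (angle_pi (w X Y) \<and> angle_pi (z X Y) \<and> dX w X Y = 0) \<and>
     \<not> (angle_pi (w X Y) \<and> angle_pi (z X Y) \<and> dY z X Y = 0) \<and>
     \<not> (angle_pi (w X Y) \<and> dX w X Y = 0 \<and> deriv c (u X Y) = 0) \<and>
     \<not> (angle_pi (z X Y) \<and> dY z X Y = 0 \<and> deriv c (u X Y) = 0)"

definition generic_data ::
  "(real \<Rightarrow> real) \<Rightarrow> real \<Rightarrow> ((real \<Rightarrow> real) \<times> (real \<Rightarrow> real)) set \<Rightarrow> bool"
where
  "generic_data c T D \<longleftrightarrow>
     open_dense_data D \<and>
     (\<forall>(u0, u1)\<in>D. \<forall>u w z p q x t.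
        semilinear_solution c u0 u1 u w z p q x t \<longrightarrow>
        (\<forall>X Y. t X Y \<in> {0..T} \<longrightarrow> generic_at c u w z X Y))"

definition Lam :: "(real \<Rightarrow> real \<Rightarrow> real) \<Rightarrow> (real \<Rightarrow> real \<Rightarrow> real) \<Rightarrow> real \<times> real \<Rightarrow> real \<times> real" where
  "Lam x t = (\<lambda>(X, Y). (x X Y, t X Y))"

definition pi_level :: "(real \<Rightarrow> real \<Rightarrow> real) \<Rightarrow> (real \<times> real) set" where
  "pi_level w = {(X, Y). angle_pi (w X Y)}"

definition singular_points ::
  "(real \<Rightarrow> real \<Rightarrow> real) \<Rightarrow> (real \<Rightarrow> real \<Rightarrow> real) \<Rightarrow> (real \<Rightarrow> real \<Rightarrow> real) \<Rightarrow> (real \<Rightarrow> real \<Rightarrow> real) \<Rightarrow>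
   (real \<times> real) set"
where
  "singular_points w z x t = Lam x t ` (pi_level w \<union> pi_level z)"

definition graph_over :: "(real \<Rightarrow> real) \<Rightarrow> real set \<Rightarrow> (real \<times> real) set" where
  "graph_over \<gamma> I = (\<lambda>\<tau>. (\<gamma> \<tau>, \<tau>)) ` I"

text \<open>In the next two definitions the arbitrarily small neighborhoods \<open>N\<close> single out the branch
  of a level set through \<open>(X0, Y0)\<close>.\<close>

definition curves_originate ::
  "(real \<Rightarrow> real \<Rightarrow> real) \<Rightarrow> (real \<Rightarrow> real \<Rightarrow> real) \<Rightarrow> (real \<Rightarrow> real \<Rightarrow> real) \<Rightarrow> (real \<Rightarrow> real \<Rightarrow> real) \<Rightarrow>
   real \<Rightarrow> real \<Rightarrow> bool"
where
  "curves_originate w z x t X0 Y0 \<longleftrightarrow>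
     (let x0 = x X0 Y0; t0 = t X0 Y0 in
      (\<exists>d>0. \<exists>\<gamma>m \<gamma>p.
         continuous_on {t0<..<t0 + d} \<gamma>m \<and> continuous_on {t0<..<t0 + d} \<gamma>p \<and>
         (\<forall>\<tau>\<in>{t0<..<t0 + d}. \<gamma>m \<tau> < \<gamma>p \<tau>) \<and>
         (\<gamma>m \<longlongrightarrow> x0) (at_right t0) \<and> (\<gamma>p \<longlongrightarrow> x0) (at_right t0) \<and>
         (\<forall>e>0. \<exists>N. \<exists>\<delta>\<in>{0<..d}.
            open N \<and> (X0, Y0) \<in> N \<and> N \<subseteq> ball (X0, Y0) e \<and>
            Lam x t ` (N \<inter> pi_level w) =
              insert (x0, t0)
                (graph_over \<gamma>m {t0<..<t0 + \<delta>} \<union> graph_over \<gamma>p {t0<..<t0 + \<delta>}))) \<and>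
      (\<forall>\<^sub>F (\<xi>, \<tau>) in nhds (x0, t0). \<tau> < t0 \<longrightarrow> (\<xi>, \<tau>) \<notin> singular_points w z x t))"

definition curves_cross ::
  "(real \<Rightarrow> real \<Rightarrow> real) \<Rightarrow> (real \<Rightarrow> real \<Rightarrow> real) \<Rightarrow> (real \<Rightarrow> real \<Rightarrow> real) \<Rightarrow> (real \<Rightarrow> real \<Rightarrow> real) \<Rightarrow>
   real \<Rightarrow> real \<Rightarrow> bool"
where
  "curves_cross w z x t X0 Y0 \<longleftrightarrow>
     (let x0 = x X0 Y0; t0 = t X0 Y0 in
      \<exists>d>0. \<exists>\<gamma> \<gamma>'.
        continuous_on {t0 - d<..<t0 + d} \<gamma> \<and> continuous_on {t0 - d<..<t0 + d} \<gamma>' \<and>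
        \<gamma> t0 = x0 \<and> \<gamma>' t0 = x0 \<and>
        (\<forall>\<tau>\<^sub>1\<in>{t0 - d<..<t0}. \<forall>\<tau>\<^sub>2\<in>{t0<..<t0 + d}. (\<gamma> \<tau>\<^sub>1 - \<gamma>' \<tau>\<^sub>1) * (\<gamma> \<tau>\<^sub>2 - \<gamma>' \<tau>\<^sub>2) < 0) \<and>
        (\<forall>e>0. \<exists>N. \<exists>\<delta>\<in>{0<..d}.
           open N \<and> (X0, Y0) \<in> N \<and> N \<subseteq> ball (X0, Y0) e \<and>
           Lam x t ` (N \<inter> pi_level w) = graph_over \<gamma> {t0 - \<delta><..<t0 + \<delta>} \<and>
           Lam x t ` (N \<inter> pi_level z) = graph_over \<gamma>' {t0 - \<delta><..<t0 + \<delta>}))"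

text \<open>At a point with \<open>w = pi\<close>, \<open>w\<^sub>X = 0\<close>, \<open>w\<^sub>X\<^sub>X > 0\<close> the level set \<open>w = pi\<close> is, to leading order,
  \<open>w\<^sub>X\<^sub>X (X - X0)\<^sup>2 / 2 + w\<^sub>Y (Y - Y0) = 0\<close>, where \<open>w\<^sub>Y\<close> has the sign of \<open>c'(u)\<close>.  It lies in
  \<open>Y \<ge> Y0\<close>, hence in the future, if \<open>w\<^sub>Y < 0\<close>, but in \<open>Y \<le> Y0\<close> if \<open>w\<^sub>Y > 0\<close>: two existing
  singular curves then merge and end at the point.  This is the time reversal of
  \<^const>\<open>curves_originate\<close>.\<close>

definition curves_terminate ::
  "(real \<Rightarrow> real \<Rightarrow> real) \<Rightarrow> (real \<Rightarrow> real \<Rightarrow> real) \<Rightarrow> (real \<Rightarrow> real \<Rightarrow> real) \<Rightarrow> (real \<Rightarrow> real \<Rightarrow> real) \<Rightarrow>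
   real \<Rightarrow> real \<Rightarrow> bool"
where
  "curves_terminate w z x t X0 Y0 \<longleftrightarrow> curves_originate w z x (\<lambda>X Y. - t X Y) X0 Y0"

end

theory Submission
  imports Defs
begin

text \<open>
In the characteristic coordinates \<open>(X, Y)\<close> all unknowns are smooth.  The singularities of \<open>u(x, t)\<close>
come only from the change of variables \<open>\<Lambda> = (x, t)\<close>, whose partial derivatives in \<open>X\<close> carry the factor
\<open>1 + cos w\<close> and those in \<open>Y\<close> the factor \<open>1 + cos z\<close>.

Let \<open>w = pi\<close> at \<open>P = (X0, Y0)\<close>, write \<open>h = X - X0\<close>, \<open>k = Y - Y0\<close>, and consider
\<open>s = c(u0) (t - t0) + (x - x0)\<close> and \<open>d = c(u0) (t - t0) - (x - x0)\<close>.  Along the horizontal line through \<open>P\<close>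
the derivative of \<open>s\<close> is close to \<open>(1 + cos w) p / 2\<close>, whereas \<open>u\<^sub>X = sin w p / (4 c)\<close>.  Hence, if \<open>w - pi\<close>
vanishes to order \<open>n\<close> in \<open>h\<close>, then \<open>s \<sim> A h\<^sup>2\<^sup>n\<^sup>+\<^sup>1\<close> and \<open>u - u0 \<sim> B h\<^sup>n\<^sup>+\<^sup>1\<close>, so that \<open>u - u0\<close> is to leading
order a multiple of \<open>s\<close> to the power \<open>(n + 1) / (2n + 1)\<close>.  This is \<open>2/3\<close> at points of Types 1 and 3
(\<open>n = 1\<close>) and \<open>3/5\<close> at points of Type 2 (\<open>n = 2\<close>).  In the vertical direction \<open>s\<close> changes little, because
\<open>s\<^sub>Y = (c(u0) - c(u)) t\<^sub>Y\<close> has a factor that vanishes at \<open>P\<close>.  If \<open>z \<noteq> pi\<close>, then \<open>d \<sim> D k\<close> takes the part of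
the second coordinate; if \<open>z = pi\<close>, then \<open>d \<sim> A' k\<^sup>3\<close> and \<open>u - u0\<close> is the sum of a square in \<open>h\<close> and a
square in \<open>k\<close>, up to cubic terms.  The precise expansions are \<open>horizontal_expansion\<close>,
\<open>one_sided_expansion\<close> and \<open>crossing_expansion\<close>; the lemmas \<open>type1_asymptotics\<close>, \<open>type2_asymptotics\<close> and
\<open>type3_asymptotics\<close> eliminate \<open>h\<close> and \<open>k\<close> from them.  The elimination uses that roots, although not
Lipschitz at \<open>0\<close>, are stable under the perturbations that occur
(\<open>bigo_power_diff_of_higher_power_diff\<close>).

An estimate near \<open>P\<close> becomes one near \<open>(x0, t0)\<close> because every point near \<open>(x0, t0)\<close> is the image of a
point near \<open>P\<close>.  Indeed \<open>x\<close> and \<open>t\<close> are monotone in each variable, and generic data exclude segments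
on which they are constant.  So \<open>\<Lambda>\<close> is injective near \<open>P\<close>, and by invariance of domain it is open
there (\<open>fibre_unique\<close>, \<open>Lam_nhds\<close>).

As for the singular curves: at a point of Type 2, \<open>w\<^sub>Y \<noteq> 0\<close>, so \<open>{w = pi}\<close> is a graph \<open>Y = \<kappa>(X)\<close> with
\<open>\<kappa>' = - w\<^sub>X / w\<^sub>Y\<close>.  Along it \<open>t\<close> has the derivative \<open>t\<^sub>Y \<kappa>'\<close>, which changes sign at \<open>X0\<close> with \<open>w\<^sub>X\<close>.  The time
thus has a strict minimum at \<open>P\<close> if \<open>w\<^sub>Y < 0\<close>, a strict maximum if \<open>w\<^sub>Y > 0\<close>, and the two halves of the graph
are mapped to the two singular curves (\<open>branching_curves\<close>).  At a point of Type 3, \<open>x\<close> and \<open>t\<close> both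
increase along \<open>{z = pi}\<close>; the reflection \<open>X \<leftrightarrow> Y\<close>, \<open>w \<leftrightarrow> z\<close>, \<open>p \<leftrightarrow> q\<close>, \<open>x \<leftrightarrow> - x\<close>, under which the
equations are invariant, shows that \<open>x\<close> decreases with \<open>t\<close> along \<open>{w = pi}\<close>.  So the images cross
(\<open>crossing_curves\<close>).
\<close>

lemmas big_trans = landau_o.big_trans and big_mult = landau_o.big_mult
  and big_power = landau_o.big_power and big_refl = landau_o.big_refl

abbreviation at_point :: "(real \<Rightarrow> real \<Rightarrow> 'a) \<Rightarrow> real \<times> real \<Rightarrow> 'a" (infixl "@@" 999) where
  "f @@ P \<equiv> f (fst P) (snd P)"

section \<open>Stability of roots\<close>

lemma square_diff_mult_le_cube_diff:
  fixes a b :: real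
  shows "\<bar>a\<^sup>2 - b\<^sup>2\<bar> * max \<bar>a\<bar> \<bar>b\<bar> ^ 1 \<le> 3 * \<bar>a ^ 3 - b ^ 3\<bar>"
proof -
  define m where "m = max \<bar>a\<bar> \<bar>b\<bar>"
  have m: "\<bar>a\<bar> \<le> m" "\<bar>b\<bar> \<le> m" "0 \<le> m" by (auto simp: m_def)
  \<comment> \<open>The quadratic factor of \<open>a ^ 3 - b ^ 3\<close> is positive definite.\<close>
  have quad: "3 / 4 * m\<^sup>2 \<le> a\<^sup>2 + a * b + b\<^sup>2"
  proof -
    have "0 \<le> (a + b / 2)\<^sup>2" "0 \<le> (b + a / 2)\<^sup>2" by simp_all
    moreover have "m\<^sup>2 = a\<^sup>2 \<or> m\<^sup>2 = b\<^sup>2" by (auto simp: m_def max_def)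
    ultimately show ?thesis by (auto simp: power2_eq_square algebra_simps)
  qed
  have mm: "2 * m * m \<le> 3 * \<bar>a\<^sup>2 + a * b + b\<^sup>2\<bar>"
  proof -
    have "l \<le> 3 * r" if "l = 2 * k" "3 / 4 * k \<le> q" "q \<le> r" "0 \<le> k" for k l q r :: real using that by simp
    from this[OF _ quad abs_ge_self zero_le_power2] show ?thesis by (simp add: power2_eq_square)
  qed
  have "\<bar>a\<^sup>2 - b\<^sup>2\<bar> * m = \<bar>a - b\<bar> * (\<bar>a + b\<bar> * m)"
    by (simp add: abs_mult[symmetric] power2_eq_square algebra_simps flip: mult.assoc)
  also have "\<dots> \<le> \<bar>a - b\<bar> * (2 * m * m)" using m by (intro mult_left_mono mult_right_mono) auto
  also have "\<dots> \<le> \<bar>a - b\<bar> * (3 * \<bar>a\<^sup>2 + a * b + b\<^sup>2\<bar>)" using mm by (intro mult_left_mono) auto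
  also have "\<dots> = 3 * \<bar>(a - b) * (a\<^sup>2 + a * b + b\<^sup>2)\<bar>" by (simp add: abs_mult)
  also have "(a - b) * (a\<^sup>2 + a * b + b\<^sup>2) = a ^ 3 - b ^ 3"
    by (simp add: algebra_simps power2_eq_square power3_eq_cube)
  finally show ?thesis by (simp add: m_def)
qed

lemma cube_diff_mult_le_quintic_diff:
  fixes a b :: real
  shows "\<bar>a ^ 3 - b ^ 3\<bar> * (max \<bar>a\<bar> \<bar>b\<bar>)\<^sup>2 \<le> 6 * \<bar>a ^ 5 - b ^ 5\<bar>"
proof -
  define m where "m = max \<bar>a\<bar> \<bar>b\<bar>"
  have m: "\<bar>a\<bar> \<le> m" "\<bar>b\<bar> \<le> m" by (auto simp: m_def)
  let ?Q = "a ^ 4 + a ^ 3 * b + a\<^sup>2 * b\<^sup>2 + a * b ^ 3 + b ^ 4"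
  \<comment> \<open>The quartic factor of \<open>a ^ 5 - b ^ 5\<close> is positive definite, by a sum of squares.\<close>
  have quad: "1 / 2 * m ^ 4 \<le> ?Q"
  proof -
    have *: "1 / 2 * y ^ 4 \<le> y ^ 4 + y ^ 3 * y' + y\<^sup>2 * y'\<^sup>2 + y * y' ^ 3 + y' ^ 4" for y y' :: real
    proof -
      have "y ^ 4 + y ^ 3 * y' + y\<^sup>2 * y'\<^sup>2 + y * y' ^ 3 + y' ^ 4 =
        1 / 2 * y ^ 4 + 1 / 2 * (y\<^sup>2 + y * y')\<^sup>2 + 1 / 4 * (y * y')\<^sup>2 + (y * y' / 2 + y'\<^sup>2)\<^sup>2"
        by (simp add: power2_eq_square power3_eq_cube power4_eq_xxxx algebra_simps)
      then show ?thesis by simp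
    qed
    have "m ^ 4 = a ^ 4 \<or> m ^ 4 = b ^ 4" by (auto simp: m_def max_def power_even_abs)
    then show ?thesis using *[of a b] *[of b a] by (auto simp: algebra_simps)
  qed
  have "\<bar>a * b\<bar> \<le> m\<^sup>2" unfolding abs_mult power2_eq_square using m by (intro mult_mono) auto
  moreover have "a\<^sup>2 \<le> m\<^sup>2" "b\<^sup>2 \<le> m\<^sup>2" using m by (auto simp: abs_le_square_iff[symmetric])
  ultimately have Q: "\<bar>a\<^sup>2 + a * b + b\<^sup>2\<bar> \<le> 3 * m\<^sup>2"
    by (simp add: abs_le_iff) (smt (verit) zero_le_power2)
  have "3 * m\<^sup>2 * m\<^sup>2 = 6 * (1 / 2 * m ^ 4)" by (simp add: power2_eq_square power4_eq_xxxx)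
  also have "\<dots> \<le> 6 * ?Q" using quad by (intro mult_left_mono) auto
  also have "\<dots> \<le> 6 * \<bar>?Q\<bar>" by (intro mult_left_mono abs_ge_self) simp
  finally have mm: "3 * m\<^sup>2 * m\<^sup>2 \<le> 6 * \<bar>?Q\<bar>" .
  have "\<bar>a ^ 3 - b ^ 3\<bar> * m\<^sup>2 = \<bar>a - b\<bar> * (\<bar>a\<^sup>2 + a * b + b\<^sup>2\<bar> * m\<^sup>2)"
    unfolding mult.assoc[symmetric] abs_mult[symmetric] by (simp add: algebra_simps power2_eq_square power3_eq_cube)
  also have "\<dots> \<le> \<bar>a - b\<bar> * (3 * m\<^sup>2 * m\<^sup>2)" using Q by (intro mult_left_mono mult_right_mono) auto
  also have "\<dots> \<le> \<bar>a - b\<bar> * (6 * \<bar>?Q\<bar>)" using mm by (intro mult_left_mono) auto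
  also have "\<dots> = 6 * \<bar>(a - b) * ?Q\<bar>" by (simp add: abs_mult)
  also have "(a - b) * ?Q = a ^ 5 - b ^ 5" by (simp add: algebra_simps numeral_eq_Suc)
  finally show ?thesis by (simp add: m_def)
qed

text \<open>Read \<open>a\<close> and \<open>b\<close> as the \<open>n\<close>-th roots of two nearby numbers.  A root is not Lipschitz at \<open>0\<close>, so the
hypothesis weighs the difference of the numbers with the size of \<open>b\<close>, measured against a scale \<open>\<delta>\<close>:
where both roots are smaller than \<open>\<delta>\<close> the claim is trivial, and elsewhere \<open>max \<bar>a\<bar> \<bar>b\<bar>\<close> can be cancelled.\<close>

lemma bigo_power_diff_of_higher_power_diff:
  fixes a b \<delta> :: "'a \<Rightarrow> real"
  assumes key: "\<And>x y :: real. \<bar>x ^ i - y ^ i\<bar> * max \<bar>x\<bar> \<bar>y\<bar> ^ k \<le> C * \<bar>x ^ n - y ^ n\<bar>" and C: "0 \<le> C"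
    and ab: "(\<lambda>P. a P ^ n - b P ^ n) \<in> O[F](\<lambda>P. \<delta> P ^ i * (\<bar>b P\<bar> ^ k + \<delta> P ^ k))" and \<delta>: "\<And>P. 0 \<le> \<delta> P"
  shows "(\<lambda>P. a P ^ i - b P ^ i) \<in> O[F](\<lambda>P. \<delta> P ^ i)"
proof -
  obtain M where M: "0 < M" "\<forall>\<^sub>F P in F. norm (a P ^ n - b P ^ n) \<le> M * norm (\<delta> P ^ i * (\<bar>b P\<bar> ^ k + \<delta> P ^ k))"
    using ab by (rule landau_o.bigE)
  have "\<forall>\<^sub>F P in F. norm (a P ^ i - b P ^ i) \<le> (2 * C * M + 2) * norm (\<delta> P ^ i)"
    using M(2)
  proof eventually_elim
    case (elim P)
    define m where "m = max \<bar>a P\<bar> \<bar>b P\<bar>"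
    have m: "\<bar>a P\<bar> \<le> m" "\<bar>b P\<bar> \<le> m" by (auto simp: m_def)
    have CM: "0 \<le> C * M" using C M(1) by simp
    have "\<bar>a P ^ i - b P ^ i\<bar> \<le> (2 * C * M + 2) * \<delta> P ^ i"
    proof (cases "m \<le> \<delta> P")
      case True
      have "\<bar>a P\<bar> ^ i \<le> \<delta> P ^ i" "\<bar>b P\<bar> ^ i \<le> \<delta> P ^ i" using m True by (auto intro!: power_mono)
      then have "\<bar>a P ^ i - b P ^ i\<bar> \<le> 2 * \<delta> P ^ i" unfolding power_abs[symmetric] by linarith
      also have "\<dots> \<le> (2 * C * M + 2) * \<delta> P ^ i" using CM \<delta>[of P] by (intro mult_right_mono) auto
      finally show ?thesis .
    next
      case False
      have "0 < m" using False \<delta>[of P] by linarith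
      have "\<bar>b P\<bar> ^ k \<le> m ^ k" "\<delta> P ^ k \<le> m ^ k" using m False \<delta>[of P] by (auto intro!: power_mono)
      then have "M * (\<delta> P ^ i * (\<bar>b P\<bar> ^ k + \<delta> P ^ k)) \<le> M * (\<delta> P ^ i * (2 * m ^ k))"
        using M(1) \<delta>[of P] by (intro mult_left_mono) auto
      moreover have "\<bar>a P ^ n - b P ^ n\<bar> \<le> M * (\<delta> P ^ i * (\<bar>b P\<bar> ^ k + \<delta> P ^ k))"
        using elim \<delta>[of P] by (simp add: abs_mult)
      ultimately have "C * \<bar>a P ^ n - b P ^ n\<bar> \<le> C * (M * (\<delta> P ^ i * (2 * m ^ k)))"
        using C by (intro mult_left_mono) linarith+
      with key[of "a P" "b P"] have "\<bar>a P ^ i - b P ^ i\<bar> * m ^ k \<le> (2 * C * M * \<delta> P ^ i) * m ^ k"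
        by (simp add: m_def mult_ac)
      then have "\<bar>a P ^ i - b P ^ i\<bar> \<le> 2 * C * M * \<delta> P ^ i" using \<open>0 < m\<close> by simp
      also have "\<dots> \<le> (2 * C * M + 2) * \<delta> P ^ i" using \<delta>[of P] by (intro mult_right_mono) auto
      finally show ?thesis .
    qed
    then show ?case using \<delta>[of P] by simp
  qed
  then show ?thesis by (rule bigoI)
qed

lemma bigo_square_diff_of_cube_diff:
  fixes a b \<delta> :: "'a \<Rightarrow> real"
  assumes "(\<lambda>P. a P ^ 3 - b P ^ 3) \<in> O[F](\<lambda>P. (\<delta> P)\<^sup>2 * (\<bar>b P\<bar> + \<delta> P))" and "\<And>P. 0 \<le> \<delta> P"
  shows "(\<lambda>P. (a P)\<^sup>2 - (b P)\<^sup>2) \<in> O[F](\<lambda>P. (\<delta> P)\<^sup>2)"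
  by (rule bigo_power_diff_of_higher_power_diff[OF square_diff_mult_le_cube_diff]) (use assms in simp_all)

lemma bigo_cube_diff_of_quintic_diff:
  fixes a b \<delta> :: "'a \<Rightarrow> real"
  assumes "(\<lambda>P. a P ^ 5 - b P ^ 5) \<in> O[F](\<lambda>P. \<delta> P ^ 3 * ((b P)\<^sup>2 + (\<delta> P)\<^sup>2))" and "\<And>P. 0 \<le> \<delta> P"
  shows "(\<lambda>P. a P ^ 3 - b P ^ 3) \<in> O[F](\<lambda>P. \<delta> P ^ 3)"
  by (rule bigo_power_diff_of_higher_power_diff[OF cube_diff_mult_le_quintic_diff]) (use assms in simp_all)

section \<open>Asymptotic estimates near a point\<close>

lemma bigo_ext: "f \<in> O[F](g) \<Longrightarrow> (\<And>x. f' x = f x) \<Longrightarrow> f' \<in> O[F](g)"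
proof -
  assume f: "f \<in> O[F](g)" and eq: "\<And>x. f' x = f x"
  have "f' = f" by (rule ext) (rule eq)
  with f show ?thesis by simp
qed

lemma bigo_of_le:
  fixes f g :: "'a \<Rightarrow> real"
  assumes "\<And>P. \<bar>f P\<bar> \<le> C * g P" "\<And>P. 0 \<le> g P"
  shows "f \<in> O[F](g)"
  by (rule bigoI[where c = C]) (use assms in simp)

lemma bigo_add:
  fixes f g a b :: "'a \<Rightarrow> real"
  assumes "f \<in> O[F](a)" "g \<in> O[F](b)" "\<And>P. 0 \<le> a P" "\<And>P. 0 \<le> b P"
  shows "(\<lambda>P. f P + g P) \<in> O[F](\<lambda>P. a P + b P)"
  by (intro sum_in_bigo(1) big_trans[OF assms(1)] big_trans[OF assms(2)] bigo_of_le[where C = 1]) (simp_all add: assms)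

lemma bigo_diff_add:
  fixes f g k a b :: "'a \<Rightarrow> real"
  assumes "(\<lambda>P. f P - g P) \<in> O[F](a)" "(\<lambda>P. g P - k P) \<in> O[F](b)" "\<And>P. 0 \<le> a P" "\<And>P. 0 \<le> b P"
  shows "(\<lambda>P. f P - k P) \<in> O[F](\<lambda>P. a P + b P)"
  by (rule bigo_ext[OF bigo_add[OF assms]]) simp

lemma bigo_cmult: "f \<in> O[F](g) \<Longrightarrow> (\<lambda>P. a * f P) \<in> O[F](g)"
  for f g :: "'a \<Rightarrow> real"
  by simp

lemma isCont_tendsto_nhds: "isCont f a \<Longrightarrow> (f \<longlongrightarrow> f a) (nhds a)"
  unfolding isCont_def by (rule tendsto_at_iff_tendsto_nhds[THEN iffD1])

lemma power_diff_bigo_nhds: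
  fixes x0 :: real
  assumes "n \<le> m"
  shows "(\<lambda>x. (x - x0) ^ m) \<in> O[nhds x0](\<lambda>x. (x - x0) ^ n)"
proof -
  have "((\<lambda>x. x - x0) \<longlongrightarrow> x0 - x0) (nhds x0)" by (rule tendsto_diff[OF filterlim_ident tendsto_const])
  then have "\<forall>\<^sub>F x in nhds x0. dist (x - x0) 0 < 1" by (intro tendstoD) auto
  then have "\<forall>\<^sub>F x in nhds x0. norm ((x - x0) ^ m) \<le> 1 * norm ((x - x0) ^ n)"
    by eventually_elim (use assms in \<open>auto simp: power_abs intro!: power_decreasing\<close>)
  then show ?thesis by (rule bigoI)
qed

lemma tendsto_imp_bigo_1:
  fixes f :: "'a \<Rightarrow> real"
  assumes "(f \<longlongrightarrow> l) F" shows "f \<in> O[F](\<lambda>_. 1)"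
  by (rule bigoI_tendsto[where c = l]) (use assms in auto)

lemma differentiable_imp_bigo:
  fixes f :: "'a::real_normed_vector \<Rightarrow> real"
  assumes "f differentiable (at a)"
  shows "(\<lambda>y. f y - f a) \<in> O[nhds a](\<lambda>y. norm (y - a))"
proof -
  obtain f' where f': "(f has_derivative f') (at a)" using assms by (auto simp: differentiable_def)
  then obtain M where M: "\<And>v. norm (f' v) \<le> norm v * M"
    using bounded_linear.bounded[OF has_derivative_bounded_linear[OF f']] by blast
  obtain \<delta> where \<delta>: "\<delta> > 0" "\<And>y. norm (y - a) < \<delta> \<Longrightarrow> norm (f y - f a - f' (y - a)) \<le> 1 * norm (y - a)"
    using f' unfolding has_derivative_at_alt by (meson zero_less_one)
  have "\<forall>\<^sub>F y in nhds a. norm (y - a) < \<delta>"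
    using \<delta>(1) by (auto simp: eventually_nhds_metric dist_norm)
  then have "\<forall>\<^sub>F y in nhds a. norm (f y - f a) \<le> (M + 1) * norm (norm (y - a))"
  proof eventually_elim
    case (elim y)
    have "norm (f y - f a) \<le> norm (f y - f a - f' (y - a)) + norm (f' (y - a))"
      using norm_triangle_ineq[of "f y - f a - f' (y - a)" "f' (y - a)"] by simp
    also have "\<dots> \<le> 1 * norm (y - a) + norm (y - a) * M" by (intro add_mono \<delta>(2) elim M)
    finally show ?case by (simp add: algebra_simps)
  qed
  then show ?thesis by (rule bigoI)
qed

lemma DERIV_bigo:
  fixes f :: "real \<Rightarrow> real"
  assumes "(f has_real_derivative D) (at a)"
  shows "(\<lambda>v. f v - f a) \<in> O[nhds a](\<lambda>v. v - a)"
  using differentiable_imp_bigo[of f a] assms by (auto simp: real_differentiable_def)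

lemma eventually_nhds_box:
  fixes X0 Y0 :: real
  shows "(\<forall>\<^sub>F P in nhds (X0, Y0). Q P) \<longleftrightarrow>
    (\<exists>e>0. \<forall>X Y. \<bar>X - X0\<bar> < e \<longrightarrow> \<bar>Y - Y0\<bar> < e \<longrightarrow> Q (X, Y))" (is "?L \<longleftrightarrow> ?R")
proof
  assume ?L
  then obtain e where e: "e > 0" "\<And>P. dist P (X0, Y0) < e \<Longrightarrow> Q P" by (auto simp: eventually_nhds_metric)
  have "Q (X, Y)" if "\<bar>X - X0\<bar> < e / 2" "\<bar>Y - Y0\<bar> < e / 2" for X Y
  proof (rule e(2))
    have "dist (X, Y) (X0, Y0) \<le> \<bar>X - X0\<bar> + \<bar>Y - Y0\<bar>"
      unfolding dist_prod_def dist_real_def by (simp add: sqrt_sum_squares_le_sum_abs)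
    then show "dist (X, Y) (X0, Y0) < e" using that by linarith
  qed
  then show ?R using e(1) by (intro exI[of _ "e / 2"]) auto
next
  assume ?R
  then obtain e where e: "e > 0" "\<And>X Y. \<bar>X - X0\<bar> < e \<Longrightarrow> \<bar>Y - Y0\<bar> < e \<Longrightarrow> Q (X, Y)" by auto
  have "Q P" if "dist P (X0, Y0) < e" for P
    using e(2)[of "fst P" "snd P"] dist_fst_le[of P "(X0, Y0)"] dist_snd_le[of P "(X0, Y0)"] that
    by (simp add: dist_real_def)
  then show ?L using e(1) by (auto simp: eventually_nhds_metric)
qed

lemma tendsto_fst_nhds: "(fst \<longlongrightarrow> a) (nhds (a, b))"
  using tendsto_fst[OF filterlim_ident[of "nhds (a, b)"]] by simp

lemma tendsto_snd_nhds: "(snd \<longlongrightarrow> b) (nhds (a, b))"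
  using tendsto_snd[OF filterlim_ident[of "nhds (a, b)"]] by simp

lemma tendsto_fst_diff_0: "((\<lambda>P. fst P - X0) \<longlongrightarrow> 0) (nhds (X0, Y0))" for X0 Y0 :: real
  using tendsto_diff[OF tendsto_fst_nhds[of X0 Y0] tendsto_const[of X0]] by simp

lemma tendsto_snd_diff_0: "((\<lambda>P. snd P - Y0) \<longlongrightarrow> 0) (nhds (X0, Y0))" for X0 Y0 :: real
  using tendsto_diff[OF tendsto_snd_nhds[of Y0 X0] tendsto_const[of Y0]] by simp

text \<open>The mean value theorem in the vertical direction.  The weight \<open>g\<close> has to increase in the vertical
distance because the intermediate point lies closer to \<open>Y0\<close>.\<close>

lemma mvt_bigo_Y:
  fixes f f' :: "real \<Rightarrow> real \<Rightarrow> real"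
  assumes f: "\<And>X Y. DERIV (\<lambda>s. f X s) Y :> f' X Y"
    and bd: "(\<lambda>P. f' @@ P) \<in> O[nhds (X0, Y0)](\<lambda>P. g \<bar>fst P - X0\<bar> \<bar>snd P - Y0\<bar>)"
    and g: "\<And>a b b'. 0 \<le> a \<Longrightarrow> 0 \<le> b \<Longrightarrow> b \<le> b' \<Longrightarrow> 0 \<le> g a b \<and> g a b \<le> g a b'"
  shows "(\<lambda>P. f @@ P - f (fst P) Y0) \<in>
    O[nhds (X0, Y0)](\<lambda>P. g \<bar>fst P - X0\<bar> \<bar>snd P - Y0\<bar> * \<bar>snd P - Y0\<bar>)"
proof -
  obtain M where M: "0 < M" "\<forall>\<^sub>F P in nhds (X0, Y0). norm (f' @@ P) \<le> M * norm (g \<bar>fst P - X0\<bar> \<bar>snd P - Y0\<bar>)"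
    using bd by (rule landau_o.bigE)
  then obtain e where e: "e > 0"
    "\<And>X Y. \<bar>X - X0\<bar> < e \<Longrightarrow> \<bar>Y - Y0\<bar> < e \<Longrightarrow> \<bar>f' X Y\<bar> \<le> M * \<bar>g \<bar>X - X0\<bar> \<bar>Y - Y0\<bar>\<bar>"
    by (auto simp: eventually_nhds_box)
  have "\<forall>\<^sub>F P in nhds (X0, Y0). norm (f @@ P - f (fst P) Y0)
      \<le> M * norm (g \<bar>fst P - X0\<bar> \<bar>snd P - Y0\<bar> * \<bar>snd P - Y0\<bar>)"
    unfolding eventually_nhds_box
  proof (intro exI[of _ e] conjI allI impI e(1))
    fix X Y assume XY: "\<bar>X - X0\<bar> < e" "\<bar>Y - Y0\<bar> < e"
    have "norm (f X Y - f X Y0) \<le> (M * g \<bar>X - X0\<bar> \<bar>Y - Y0\<bar>) * norm (Y - Y0)"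
    proof (rule differentiable_bound[of "closed_segment Y0 Y"])
      fix y assume y: "y \<in> closed_segment Y0 Y"
      show "(f X has_derivative (*) (f' X y)) (at y within closed_segment Y0 Y)"
        using f[of X y] by (simp add: has_field_derivative_def has_derivative_at_withinI)
      have yY: "\<bar>y - Y0\<bar> \<le> \<bar>Y - Y0\<bar>" using y by (auto simp: closed_segment_eq_real_ivl split: if_splits)
      then have "\<bar>f' X y\<bar> \<le> M * \<bar>g \<bar>X - X0\<bar> \<bar>y - Y0\<bar>\<bar>" using XY by (intro e) auto
      also have "\<dots> \<le> M * g \<bar>X - X0\<bar> \<bar>Y - Y0\<bar>"
        using g[of "\<bar>X - X0\<bar>" "\<bar>y - Y0\<bar>" "\<bar>Y - Y0\<bar>"] yY M(1) by (intro mult_left_mono) auto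
      finally show "onorm ((*) (f' X y)) \<le> M * g \<bar>X - X0\<bar> \<bar>Y - Y0\<bar>"
        by (intro onorm_bound) (auto simp: abs_mult mult_right_mono)
    qed auto
    then show "norm (f (fst (X, Y)) (snd (X, Y)) - f (fst (X, Y)) Y0)
        \<le> M * norm (g \<bar>fst (X, Y) - X0\<bar> \<bar>snd (X, Y) - Y0\<bar> * \<bar>snd (X, Y) - Y0\<bar>)"
      using g[of "\<bar>X - X0\<bar>" "\<bar>Y - Y0\<bar>" "\<bar>Y - Y0\<bar>"] by (simp add: abs_mult mult_ac)
  qed
  then show ?thesis by (rule bigoI)
qed

lemma bigo_swap:
  assumes "f \<in> O[nhds (X0, Y0)](g)"
  shows "(\<lambda>P. f (snd P, fst P)) \<in> O[nhds (Y0, X0)](\<lambda>P. g (snd P, fst P))"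
  by (rule landau_o.big.compose[OF assms])
    (rule tendsto_Pair[OF tendsto_snd_nhds tendsto_fst_nhds])

lemma mvt_bigo_X:
  fixes f f' :: "real \<Rightarrow> real \<Rightarrow> real"
  assumes f: "\<And>X Y. DERIV (\<lambda>s. f s Y) X :> f' X Y"
    and bd: "(\<lambda>P. f' @@ P) \<in> O[nhds (X0, Y0)](\<lambda>P. g \<bar>fst P - X0\<bar> \<bar>snd P - Y0\<bar>)"
    and g: "\<And>a a' b. 0 \<le> a \<Longrightarrow> 0 \<le> b \<Longrightarrow> a \<le> a' \<Longrightarrow> 0 \<le> g a b \<and> g a b \<le> g a' b"
  shows "(\<lambda>P. f @@ P - f X0 (snd P)) \<in>
    O[nhds (X0, Y0)](\<lambda>P. g \<bar>fst P - X0\<bar> \<bar>snd P - Y0\<bar> * \<bar>fst P - X0\<bar>)"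
proof -
  have "(\<lambda>P. f (snd P) (fst P) - f X0 (fst P)) \<in>
    O[nhds (Y0, X0)](\<lambda>P. g \<bar>snd P - X0\<bar> \<bar>fst P - Y0\<bar> * \<bar>snd P - X0\<bar>)"
    by (rule mvt_bigo_Y[where f = "\<lambda>Y X. f X Y" and f' = "\<lambda>Y X. f' X Y" and g = "\<lambda>b a. g a b"])
      (use f g bigo_swap[OF bd] in auto)
  from bigo_swap[OF this] show ?thesis by simp
qed

lemma bigo_fst: "f \<in> O[nhds X0](g) \<Longrightarrow> (\<lambda>P. f (fst P)) \<in> O[nhds (X0, Y0)](\<lambda>P. g (fst P))"
  by (rule landau_o.big.compose[OF _ tendsto_fst_nhds])

lemma bigo_snd: "f \<in> O[nhds Y0](g) \<Longrightarrow> (\<lambda>P. f (snd P)) \<in> O[nhds (X0, Y0)](\<lambda>P. g (snd P))"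
  by (rule landau_o.big.compose[OF _ tendsto_snd_nhds])

lemma abs_bigo_iff_power: "f \<in> O[F](\<lambda>P. \<bar>g P\<bar> ^ n) \<longleftrightarrow> f \<in> O[F](\<lambda>P. g P ^ n :: real)"
  by (simp flip: power_abs)

lemma mvt_bigo:
  fixes f f' :: "real \<Rightarrow> real"
  assumes "\<And>x. (f has_real_derivative f' x) (at x)" and "f' \<in> O[nhds x0](\<lambda>x. (x - x0) ^ m)"
  shows "(\<lambda>x. f x - f x0) \<in> O[nhds x0](\<lambda>x. (x - x0) ^ Suc m)"
proof -
  \<comment> \<open>A function of one variable is a function on the plane that is constant horizontally.\<close>
  have "(\<lambda>P. f' (snd P)) \<in> O[nhds (0, x0)](\<lambda>P. \<bar>snd P - x0\<bar> ^ m)"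
    unfolding abs_bigo_iff_power by (rule bigo_snd[OF assms(2)])
  then have "(\<lambda>P. f (snd P) - f x0) \<in> O[nhds (0 :: real, x0)](\<lambda>P. \<bar>snd P - x0\<bar> ^ m * \<bar>snd P - x0\<bar>)"
    using mvt_bigo_Y[of "\<lambda>_. f" "\<lambda>_. f'" 0 x0 "\<lambda>_ b. b ^ m"] assms(1) by (simp add: power_mono)
  from landau_o.big.compose[OF this tendsto_Pair[OF tendsto_const filterlim_ident]]
  have "(\<lambda>x. f x - f x0) \<in> O[nhds x0](\<lambda>x. \<bar>x - x0\<bar> ^ Suc m)" by (simp add: mult.commute)
  then show ?thesis unfolding abs_bigo_iff_power .
qed

section \<open>Expansions with a leading and a following term\<close>

text \<open>At a point of Type 1 the terms of relative order one do not fit into the error.  They have to be exact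
powers, with some coefficient \<open>b\<close>, to be absorbed by linear terms later.\<close>

definition two_term :: "real \<Rightarrow> nat \<Rightarrow> real \<Rightarrow> (real \<Rightarrow> real) \<Rightarrow> bool" where
  "two_term x0 n a f \<longleftrightarrow>
     (\<exists>b. (\<lambda>x. f x - (a * (x - x0) ^ n + b * (x - x0) ^ (n + 1))) \<in> O[nhds x0](\<lambda>x. (x - x0) ^ (n + 2)))"

lemma two_termI:
  "(\<lambda>x. f x - (a * (x - x0) ^ n + b * (x - x0) ^ (n + 1))) \<in> O[nhds x0](\<lambda>x. (x - x0) ^ (n + 2))
    \<Longrightarrow> two_term x0 n a f"
  by (auto simp: two_term_def)

lemma two_term_leading:
  assumes "two_term x0 n a f"
  shows "(\<lambda>x. f x - a * (x - x0) ^ n) \<in> O[nhds x0](\<lambda>x. (x - x0) ^ (n + 1))"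
proof -
  obtain b where b: "(\<lambda>x. f x - (a * (x - x0) ^ n + b * (x - x0) ^ (n + 1))) \<in> O[nhds x0](\<lambda>x. (x - x0) ^ (n + 2))"
    using assms by (auto simp: two_term_def)
  have "(\<lambda>x. f x - (a * (x - x0) ^ n + b * (x - x0) ^ (n + 1)) + b * (x - x0) ^ (n + 1))
      \<in> O[nhds x0](\<lambda>x. (x - x0) ^ (n + 1))"
    by (intro sum_in_bigo big_trans[OF b] power_diff_bigo_nhds) auto
  then show ?thesis by (simp add: algebra_simps)
qed

lemma two_term_bigo:
  assumes "two_term x0 n a f"
  shows "f \<in> O[nhds x0](\<lambda>x. (x - x0) ^ n)"
proof -
  have "(\<lambda>x. f x - a * (x - x0) ^ n + a * (x - x0) ^ n) \<in> O[nhds x0](\<lambda>x. (x - x0) ^ n)"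
    by (intro sum_in_bigo big_trans[OF two_term_leading[OF assms]] power_diff_bigo_nhds) auto
  then show ?thesis by simp
qed

lemma two_term_mult:
  assumes f: "two_term x0 n a f" and g: "two_term x0 m a' g"
  shows "two_term x0 (n + m) (a * a') (\<lambda>x. f x * g x)"
proof -
  obtain b where b: "(\<lambda>x. f x - (a * (x - x0) ^ n + b * (x - x0) ^ (n + 1))) \<in> O[nhds x0](\<lambda>x. (x - x0) ^ (n + 2))"
    using f by (auto simp: two_term_def)
  obtain b' where b': "(\<lambda>x. g x - (a' * (x - x0) ^ m + b' * (x - x0) ^ (m + 1))) \<in> O[nhds x0](\<lambda>x. (x - x0) ^ (m + 2))"
    using g by (auto simp: two_term_def)
  have 1: "(\<lambda>x. (f x - (a * (x - x0) ^ n + b * (x - x0) ^ (n + 1))) * g x) \<in> O[nhds x0](\<lambda>x. (x - x0) ^ (n + m + 2))"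
    using big_mult[OF b two_term_bigo[OF g]] by (simp add: power_add mult_ac)
  have "(\<lambda>x. a * (x - x0) ^ n + b * (x - x0) ^ (n + 1)) \<in> O[nhds x0](\<lambda>x. (x - x0) ^ n)"
    using power_diff_bigo_nhds[of n "n + 1" x0] by (intro sum_in_bigo) auto
  from big_mult[OF this b']
  have 2: "(\<lambda>x. (a * (x - x0) ^ n + b * (x - x0) ^ (n + 1)) * (g x - (a' * (x - x0) ^ m + b' * (x - x0) ^ (m + 1))))
      \<in> O[nhds x0](\<lambda>x. (x - x0) ^ (n + m + 2))"
    by (simp add: power_add mult_ac)
  have 3: "(\<lambda>x. b * b' * (x - x0) ^ (n + m + 2)) \<in> O[nhds x0](\<lambda>x. (x - x0) ^ (n + m + 2))" by simp
  show ?thesis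
    by (rule two_termI[where b = "a * b' + b * a'"], rule bigo_ext[OF sum_in_bigo(1)[OF sum_in_bigo(1)[OF 1 2] 3]])
      (simp add: algebra_simps power_add power2_eq_square)
qed

lemma two_term_cmult: "two_term x0 n a f \<Longrightarrow> two_term x0 n (r * a) (\<lambda>x. r * f x)"
proof -
  assume "two_term x0 n a f"
  then obtain b where b: "(\<lambda>x. f x - (a * (x - x0) ^ n + b * (x - x0) ^ (n + 1))) \<in> O[nhds x0](\<lambda>x. (x - x0) ^ (n + 2))"
    by (auto simp: two_term_def)
  have "(\<lambda>x. r * (f x - (a * (x - x0) ^ n + b * (x - x0) ^ (n + 1)))) \<in> O[nhds x0](\<lambda>x. (x - x0) ^ (n + 2))"
    using b by simp
  then have "(\<lambda>x. r * f x - (r * a * (x - x0) ^ n + r * b * (x - x0) ^ (n + 1))) \<in> O[nhds x0](\<lambda>x. (x - x0) ^ (n + 2))"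
    by (rule bigo_ext) (simp add: algebra_simps)
  then show ?thesis by (rule two_termI)
qed

lemma two_term_const: "two_term x0 0 a (\<lambda>x. a)"
  by (rule two_termI[where b = 0]) simp

lemma two_term_add:
  assumes "two_term x0 n a f" "two_term x0 n a' g"
  shows "two_term x0 n (a + a') (\<lambda>x. f x + g x)"
proof -
  obtain b where b: "(\<lambda>x. f x - (a * (x - x0) ^ n + b * (x - x0) ^ (n + 1))) \<in> O[nhds x0](\<lambda>x. (x - x0) ^ (n + 2))"
    using assms by (auto simp: two_term_def)
  obtain b' where b': "(\<lambda>x. g x - (a' * (x - x0) ^ n + b' * (x - x0) ^ (n + 1))) \<in> O[nhds x0](\<lambda>x. (x - x0) ^ (n + 2))"
    using assms by (auto simp: two_term_def)
  show ?thesis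
    by (rule two_termI[where b = "b + b'"], rule bigo_ext[OF sum_in_bigo(1)[OF b b']]) (simp add: algebra_simps)
qed

lemma two_term_integral:
  assumes f: "\<And>x. DERIV f x :> f' x" and f': "two_term x0 n a f'"
  shows "two_term x0 (n + 1) (a / (n + 1)) (\<lambda>x. f x - f x0)"
proof -
  obtain b where b: "(\<lambda>x. f' x - (a * (x - x0) ^ n + b * (x - x0) ^ (n + 1))) \<in> O[nhds x0](\<lambda>x. (x - x0) ^ (n + 2))"
    using f' by (auto simp: two_term_def)
  define g where "g = (\<lambda>x. f x - (a / (n + 1) * (x - x0) ^ (n + 1) + b / (n + 2) * (x - x0) ^ (n + 2)))"
  have n: "real n + 1 \<noteq> 0" "real n + 2 \<noteq> 0" by linarith+
  have "DERIV g x :> f' x - (a * (x - x0) ^ n + b * (x - x0) ^ (n + 1))" for x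
    unfolding g_def
    by (rule derivative_eq_intros f refl)+ (use n in \<open>simp add: add.commute\<close>)
  from mvt_bigo[OF this b] have "(\<lambda>x. g x - g x0) \<in> O[nhds x0](\<lambda>x. (x - x0) ^ Suc (n + 2))" .
  then have "(\<lambda>x. g x - g x0) \<in> O[nhds x0](\<lambda>x. (x - x0) ^ (n + 1 + 2))" by (simp add: add.commute)
  then have "(\<lambda>x. f x - f x0 - (a / (n + 1) * (x - x0) ^ (n + 1) + b / (n + 2) * (x - x0) ^ (n + 1 + 1)))
      \<in> O[nhds x0](\<lambda>x. (x - x0) ^ (n + 1 + 2))"
    by (rule bigo_ext) (simp add: g_def add.assoc)
  then show ?thesis by (rule two_termI)
qed

lemma two_term_taylor:
  fixes D :: "nat \<Rightarrow> real \<Rightarrow> real"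
  assumes "\<And>m x. (D m has_real_derivative D (Suc m) x) (at x)" and "\<And>m. m < n \<Longrightarrow> D m x0 = 0"
  shows "two_term x0 n (D n x0 / fact n) (D 0)"
  using assms
proof (induction n arbitrary: D)
  case 0
  have "DERIV (\<lambda>x. D 0 x - D (Suc 0) x0 * (x - x0)) x :> D (Suc 0) x - D (Suc 0) x0" for x
    by (rule derivative_eq_intros 0(1) refl)+ simp
  from mvt_bigo[OF this, of x0 1] DERIV_bigo[OF 0(1)]
  show ?case by (intro two_termI[where b = "D (Suc 0) x0"]) (simp add: numeral_2_eq_2 algebra_simps)
next
  case (Suc n)
  have "two_term x0 n (D (Suc n) x0 / fact n) (D (Suc 0))" using Suc.IH[of "\<lambda>m. D (Suc m)"] Suc.prems by simp
  from two_term_integral[OF Suc.prems(1) this] show ?case using Suc.prems(2)[of 0] by (simp add: mult.commute)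
qed

lemma sin_bigo: "(\<lambda>y::real. sin y - y) \<in> O[nhds 0](\<lambda>y. y ^ 3)"
  and cos_bigo: "(\<lambda>y::real. 1 - cos y - y\<^sup>2 / 2) \<in> O[nhds 0](\<lambda>y. y ^ 4)"
proof -
  have "(\<lambda>y::real. - sin y) \<in> O[nhds 0](\<lambda>y. (y - 0) ^ 1)" using DERIV_bigo[OF DERIV_sin[of 0]] by simp
  from mvt_bigo[OF DERIV_cos this] have 2: "(\<lambda>y::real. cos y - 1) \<in> O[nhds 0](\<lambda>y. (y - 0) ^ 2)" by (simp add: numeral_2_eq_2)
  have "DERIV (\<lambda>y::real. sin y - y) y :> cos y - 1" for y by (auto intro!: derivative_eq_intros)
  from mvt_bigo[OF this 2] show 3: "(\<lambda>y::real. sin y - y) \<in> O[nhds 0](\<lambda>y. y ^ 3)" by (simp add: numeral_3_eq_3)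
  have "DERIV (\<lambda>y::real. 1 - cos y - y\<^sup>2 / 2) y :> sin y - y" for y by (auto intro!: derivative_eq_intros)
  from mvt_bigo[OF this, of 0 3] 3 show "(\<lambda>y::real. 1 - cos y - y\<^sup>2 / 2) \<in> O[nhds 0](\<lambda>y. y ^ 4)"
    by (simp add: eval_nat_numeral)
qed

lemma one_minus_cos_le: "1 - cos y \<le> (y::real)\<^sup>2"
proof -
  have "1 - cos y = 2 * (sin (y / 2))\<^sup>2" using cos_double_sin[of "y / 2"] by simp
  also have "\<dots> \<le> 2 * (y / 2)\<^sup>2" 
    using abs_sin_x_le_abs_x[of "y / 2"] unfolding abs_le_square_iff by (rule mult_left_mono) simp
  also have "\<dots> \<le> y\<^sup>2" by (simp add: power_divide)
  finally show ?thesis .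
qed

lemma two_term_tendsto_0:
  assumes "two_term x0 n a f" "0 < n" shows "(f \<longlongrightarrow> 0) (nhds x0)"
proof -
  obtain M where "\<forall>\<^sub>F x in nhds x0. norm (f x) \<le> M * norm ((x - x0) ^ n)"
    using two_term_bigo[OF assms(1)] by (rule landau_o.bigE)
  moreover have "((\<lambda>x. M * norm ((x - x0) ^ n)) \<longlongrightarrow> M * norm ((x0 - x0) ^ n)) (nhds x0)"
    using isCont_tendsto_nhds[of x0 "\<lambda>x. M * norm ((x - x0) ^ n)"] by simp
  ultimately show ?thesis
    using assms(2) Lim_null_comparison[of f "\<lambda>x. M * norm ((x - x0) ^ n)" "nhds x0"]
    by (simp add: power_0_left)
qed

text \<open>Near an odd multiple of \<open>pi\<close> the sine is an odd function of the distance up to sign, so that its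
error is cubic and both terms of the expansion survive; the cosine below loses nothing either, since its
error is quartic.\<close>

lemma two_term_sin_near_pi:
  assumes w: "two_term x0 n a (\<lambda>x. w x - w0)" and n: "0 < n" and w0: "angle_pi w0"
  shows "two_term x0 n (- a) (\<lambda>x. sin (w x))"
proof -
  have sc: "sin w0 = 0" "cos w0 = - 1" using sin_rcong[OF w0] cos_rcong[OF w0] by auto
  have sin: "sin (w x) = - sin (w x - w0)" for x unfolding sin_diff using sc by simp
  obtain b where b: "(\<lambda>x. w x - w0 - (a * (x - x0) ^ n + b * (x - x0) ^ (n + 1))) \<in> O[nhds x0](\<lambda>x. (x - x0) ^ (n + 2))"
    using w by (auto simp: two_term_def)
  have "(\<lambda>x. sin (w x - w0) - (w x - w0)) \<in> O[nhds x0](\<lambda>x. (w x - w0) ^ 3)"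
    by (rule landau_o.big.compose[OF sin_bigo two_term_tendsto_0[OF w n]])
  also have "(\<lambda>x. (w x - w0) ^ 3) \<in> O[nhds x0](\<lambda>x. ((x - x0) ^ n) ^ 3)"
    by (rule big_power[OF two_term_bigo[OF w]])
  also have "(\<lambda>x. ((x - x0) ^ n) ^ 3) \<in> O[nhds x0](\<lambda>x. (x - x0) ^ (n + 2))"
    unfolding power_mult[symmetric] using n by (intro power_diff_bigo_nhds) auto
  finally have fin: "(\<lambda>x. sin (w x - w0) - (w x - w0)) \<in> O[nhds x0](\<lambda>x. (x - x0) ^ (n + 2))" .
  have "(\<lambda>x. - (sin (w x - w0) - (w x - w0)) - (w x - w0 - (a * (x - x0) ^ n + b * (x - x0) ^ (n + 1))))
      \<in> O[nhds x0](\<lambda>x. (x - x0) ^ (n + 2))"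
    by (rule sum_in_bigo(2)[OF iffD2[OF landau_o.big.uminus_in_iff fin] b])
  then have "(\<lambda>x. sin (w x) - (- a * (x - x0) ^ n + - b * (x - x0) ^ (n + 1))) \<in> O[nhds x0](\<lambda>x. (x - x0) ^ (n + 2))"
  proof (rule bigo_ext)
    fix x
    have "- S - (- a * A + - b * B) = - (S - W) - (W - (a * A + b * B))" for S A B W :: real by simp
    then show "sin (w x) - (- a * (x - x0) ^ n + - b * (x - x0) ^ (n + 1)) =
      - (sin (w x - w0) - (w x - w0)) - (w x - w0 - (a * (x - x0) ^ n + b * (x - x0) ^ (n + 1)))"
      unfolding sin[of x] .
  qed
  then show ?thesis by (rule two_termI)
qed

lemma two_term_one_plus_cos_near_pi:
  assumes w: "two_term x0 n a (\<lambda>x. w x - w0)" and n: "0 < n" and w0: "angle_pi w0"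
  shows "two_term x0 (2 * n) (a\<^sup>2 / 2) (\<lambda>x. 1 + cos (w x))"
proof -
  have sc: "sin w0 = 0" "cos w0 = - 1" using sin_rcong[OF w0] cos_rcong[OF w0] by auto
  have cos: "1 + cos (w x) = 1 - cos (w x - w0)" for x unfolding cos_diff using sc by simp
  have "two_term x0 (n + n) (1/2 * (a * a)) (\<lambda>x. 1/2 * ((w x - w0) * (w x - w0)))"
    by (intro two_term_cmult two_term_mult w)
  then have "two_term x0 (2 * n) (a\<^sup>2 / 2) (\<lambda>x. (w x - w0)\<^sup>2 / 2)"
    by (simp add: power2_eq_square mult_2)
  then obtain b where b: "(\<lambda>x. (w x - w0)\<^sup>2 / 2 - (a\<^sup>2 / 2 * (x - x0) ^ (2 * n) + b * (x - x0) ^ (2 * n + 1)))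
      \<in> O[nhds x0](\<lambda>x. (x - x0) ^ (2 * n + 2))"
    by (auto simp: two_term_def)
  have "(\<lambda>x. 1 - cos (w x - w0) - (w x - w0)\<^sup>2 / 2) \<in> O[nhds x0](\<lambda>x. (w x - w0) ^ 4)"
    by (rule landau_o.big.compose[OF cos_bigo two_term_tendsto_0[OF w n]])
  also have "(\<lambda>x. (w x - w0) ^ 4) \<in> O[nhds x0](\<lambda>x. ((x - x0) ^ n) ^ 4)"
    by (rule big_power[OF two_term_bigo[OF w]])
  also have "(\<lambda>x. ((x - x0) ^ n) ^ 4) \<in> O[nhds x0](\<lambda>x. (x - x0) ^ (2 * n + 2))"
    unfolding power_mult[symmetric] using n by (intro power_diff_bigo_nhds) auto
  finally have fin: "(\<lambda>x. 1 - cos (w x - w0) - (w x - w0)\<^sup>2 / 2) \<in> O[nhds x0](\<lambda>x. (x - x0) ^ (2 * n + 2))" .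
  have "(\<lambda>x. (1 - cos (w x - w0) - (w x - w0)\<^sup>2 / 2) + ((w x - w0)\<^sup>2 / 2 - (a\<^sup>2 / 2 * (x - x0) ^ (2 * n) + b * (x - x0) ^ (2 * n + 1))))
      \<in> O[nhds x0](\<lambda>x. (x - x0) ^ (2 * n + 2))"
    by (rule sum_in_bigo(1)[OF fin b])
  then have "(\<lambda>x. 1 + cos (w x) - (a\<^sup>2 / 2 * (x - x0) ^ (2 * n) + b * (x - x0) ^ (2 * n + 1))) \<in> O[nhds x0](\<lambda>x. (x - x0) ^ (2 * n + 2))"
  proof (rule bigo_ext)
    fix x
    have "C - D = (C - W) + (W - D)" for C D W :: real by simp
    then show "1 + cos (w x) - (a\<^sup>2 / 2 * (x - x0) ^ (2 * n) + b * (x - x0) ^ (2 * n + 1)) =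
      (1 - cos (w x - w0) - (w x - w0)\<^sup>2 / 2) + ((w x - w0)\<^sup>2 / 2 - (a\<^sup>2 / 2 * (x - x0) ^ (2 * n) + b * (x - x0) ^ (2 * n + 1)))"
      unfolding cos[of x] .
  qed
  then show ?thesis by (rule two_termI)
qed

section \<open>Smooth functions on the plane\<close>

lemma angle_pi_iff_cos: "angle_pi a \<longleftrightarrow> cos a = - 1"
proof
  assume "angle_pi a" then show "cos a = - 1" using cos_rcong[of a pi] by simp
next
  assume "cos a = - 1"
  then have "cos a = cos pi" by simp
  then have "[a = pi] (rmod (2 * pi)) \<or> [a = - pi] (rmod (2 * pi))" by (rule cos_eq_cos_conv_rmod)
  moreover have "[- pi = pi] (rmod (2 * pi))" unfolding rcong_altdef by (rule exI[of _ 1]) simp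
  ultimately show "angle_pi a" using rcong_trans by blast
qed

lemma angle_pi_near:
  assumes "angle_pi a" "\<bar>b - a\<bar> < 2 * pi"
  shows "angle_pi b \<longleftrightarrow> b = a"
proof
  assume "angle_pi b"
  then have "[a = b] (rmod (2 * pi))" using assms(1) rcong_sym rcong_trans by blast
  then obtain n where n: "b = a + of_int n * (2 * pi)" unfolding rcong_altdef by blast
  then have "\<bar>of_int n\<bar> * (2 * pi) < 1 * (2 * pi)" using assms(2) by (simp add: abs_mult)
  then have "\<bar>of_int n :: real\<bar> < 1" by (simp only: mult_less_cancel_right_pos[OF pi_gt_zero[THEN mult_pos_pos[OF zero_less_numeral]]])
  then have "n = 0" by linarith
  then show "b = a" using n by simp
qed (use assms(1) in simp)

lemma smooth_planeD:
  assumes "smooth_plane f"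
  shows "smooth_plane (dX f)" "smooth_plane (dY f)" "jointly_continuous f"
    "\<And>X Y. DERIV (\<lambda>s. f s Y) X :> dX f X Y"
    "\<And>X Y. DERIV (\<lambda>s. f X s) Y :> dY f X Y"
proof -
  have S: "Ck_plane (Suc k) f" and 0: "Ck_plane 0 f" for k using assms by (auto simp: smooth_plane_def)
  show "smooth_plane (dX f)" "smooth_plane (dY f)" using S by (auto simp: smooth_plane_def)
  show "jointly_continuous f" using 0 by simp
  fix X Y
  show "DERIV (\<lambda>s. f s Y) X :> dX f X Y"
    using S[of 0] by (auto simp: dX_def DERIV_deriv_iff_real_differentiable)
  show "DERIV (\<lambda>s. f X s) Y :> dY f X Y"
    using S[of 0] by (auto simp: dY_def DERIV_deriv_iff_real_differentiable)
qed

lemma jointly_continuous_tendsto: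
  assumes "jointly_continuous f"
  shows "((\<lambda>P. f @@ P) \<longlongrightarrow> f X0 Y0) (nhds (X0, Y0))"
proof -
  have "isCont (\<lambda>P. f @@ P) (X0, Y0)"
    using assms by (simp add: jointly_continuous_def case_prod_beta continuous_on_eq_continuous_at)
  from isCont_tendsto_nhds[OF this] show ?thesis by simp
qed

lemma smooth_plane_tendsto:
  "smooth_plane f \<Longrightarrow> ((\<lambda>P. f @@ P) \<longlongrightarrow> f X0 Y0) (nhds (X0, Y0))"
  by (rule jointly_continuous_tendsto[OF smooth_planeD(3)])

lemma smooth_plane_eventually_ne:
  assumes "smooth_plane f" "f X0 Y0 \<noteq> r"
  shows "\<forall>\<^sub>F P in nhds (X0, Y0). f @@ P \<noteq> r"
  by (rule tendsto_imp_eventually_ne[OF smooth_plane_tendsto[OF assms(1)] assms(2)])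

lemma plane_has_derivative:
  assumes "\<And>X Y. DERIV (\<lambda>s. f s Y) X :> f1 X Y"
    and "\<And>X Y. DERIV (\<lambda>s. f X s) Y :> f2 X Y"
    and "jointly_continuous f2"
  shows "((\<lambda>(X, Y). f X Y) has_derivative (\<lambda>(h, k). f1 X Y * h + f2 X Y * k)) (at (X, Y))"
proof -
  have "((\<lambda>(x, y). f x y) has_derivative (\<lambda>(tx, ty). (*) (f1 X Y) tx + blinfun_apply (blinfun_mult_right (f2 X Y)) ty))
    (at (X, Y) within UNIV \<times> UNIV)"
  proof (rule has_derivative_partialsI)
    show "((\<lambda>x. f x Y) has_derivative (*) (f1 X Y)) (at X within UNIV)"
      using assms(1) by (simp add: has_field_derivative_def)
    show "((\<lambda>y. f x y) has_derivative blinfun_apply (blinfun_mult_right (f2 x y))) (at y within UNIV)" for x y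
      using assms(2) by (simp add: has_field_derivative_def)
    have "((\<lambda>P. f2 @@ P) \<longlongrightarrow> f2 X Y) (at (X, Y))"
      using jointly_continuous_tendsto[OF assms(3), of X Y] by (simp add: tendsto_mono[OF at_within_le_nhds])
    then show "continuous (at (X, Y) within UNIV \<times> UNIV) (\<lambda>(x, y). blinfun_mult_right (f2 x y))"
      unfolding continuous_within case_prod_beta by (auto intro!: bounded_linear.tendsto[OF bounded_linear_blinfun_mult_right])
  qed auto
  then show ?thesis by (simp add: blinfun_mult_right.rep_eq)
qed

lemma plane_differentiable_imp_bigo:
  fixes f :: "real \<times> real \<Rightarrow> real"
  assumes "f differentiable (at (X0, Y0))"
  shows "(\<lambda>P. f P - f (X0, Y0)) \<in> O[nhds (X0, Y0)](\<lambda>P. \<bar>fst P - X0\<bar> + \<bar>snd P - Y0\<bar>)"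
proof -
  have "norm (P - (X0, Y0)) \<le> \<bar>fst P - X0\<bar> + \<bar>snd P - Y0\<bar>" for P
    by (cases P) (simp add: norm_prod_def sqrt_sum_squares_le_sum_abs)
  then have "(\<lambda>P. norm (P - (X0, Y0))) \<in> O[nhds (X0, Y0)](\<lambda>P. \<bar>fst P - X0\<bar> + \<bar>snd P - Y0\<bar>)"
    by (intro bigo_of_le[where C = 1]) auto
  with differentiable_imp_bigo[OF assms] show ?thesis by (rule big_trans)
qed

lemma smooth_plane_differentiable:
  assumes "smooth_plane f"
  shows "(\<lambda>P. f @@ P) differentiable (at P0)"
proof -
  obtain X Y where [simp]: "P0 = (X, Y)" by (cases P0)
  show ?thesis
    using plane_has_derivative[OF smooth_planeD(4,5)[OF assms] smooth_planeD(3)[OF smooth_planeD(2)[OF assms]], of X Y]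
    unfolding differentiable_def case_prod_beta \<open>P0 = (X, Y)\<close> by blast
qed

lemma smooth_plane_lipschitz:
  assumes f: "smooth_plane f"
  shows "(\<lambda>P. f @@ P - f X0 Y0) \<in> O[nhds (X0, Y0)](\<lambda>P. \<bar>fst P - X0\<bar> + \<bar>snd P - Y0\<bar>)"
  using plane_differentiable_imp_bigo[OF smooth_plane_differentiable[OF f]] by simp

lemma smooth_plane_critical:
  assumes f: "smooth_plane f" and 0: "dX f X0 Y0 = 0"
  shows "(\<lambda>X. f X Y0 - f X0 Y0) \<in> O[nhds X0](\<lambda>X. (X - X0)\<^sup>2)"
proof -
  have "(\<lambda>X. dX f X Y0) \<in> O[nhds X0](\<lambda>X. (X - X0) ^ 1)"
    using DERIV_bigo[OF smooth_planeD(4)[OF smooth_planeD(1)[OF f]], of Y0 X0] 0 by simp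
  from mvt_bigo[OF smooth_planeD(4)[OF f] this] show ?thesis by (simp add: numeral_2_eq_2)
qed

lemma smooth_plane_lipschitz_Y:
  assumes f: "smooth_plane f"
  shows "(\<lambda>P. f @@ P - f (fst P) Y0) \<in> O[nhds (X0, Y0)](\<lambda>P. \<bar>snd P - Y0\<bar>)"
proof -
  have "(\<lambda>P. f @@ P - f (fst P) Y0) \<in> O[nhds (X0, Y0)](\<lambda>P. 1 * \<bar>snd P - Y0\<bar>)"
    by (rule mvt_bigo_Y[OF smooth_planeD(5)[OF f], where g = "\<lambda>_ _. 1"])
      (auto intro: tendsto_imp_bigo_1 smooth_plane_tendsto smooth_planeD(2)[OF f])
  then show ?thesis by simp
qed

lemma DERIV_along_graph:
  assumes "\<And>X Y. DERIV (\<lambda>s. f s Y) X :> f1 X Y"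
    and "\<And>X Y. DERIV (\<lambda>s. f X s) Y :> f2 X Y"
    and "jointly_continuous f2" and \<kappa>: "DERIV \<kappa> X :> \<kappa>'"
  shows "DERIV (\<lambda>s. f s (\<kappa> s)) X :> f1 X (\<kappa> X) + f2 X (\<kappa> X) * \<kappa>'"
proof -
  have "((\<lambda>s. (s, \<kappa> s)) has_derivative (\<lambda>h. (h, \<kappa>' * h))) (at X)"
    using \<kappa> by (intro has_derivative_Pair) (auto simp: has_field_derivative_def)
  from has_derivative_compose[OF this plane_has_derivative[OF assms(1-3)]]
  show ?thesis
    by (simp add: has_field_derivative_def) (erule has_derivative_eq_rhs, simp add: fun_eq_iff algebra_simps)
qed

lemma dX_swap: "dX (\<lambda>X Y. f Y X) = (\<lambda>X Y. dY f Y X)" and dY_swap: "dY (\<lambda>X Y. f Y X) = (\<lambda>X Y. dX f Y X)"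
  by (auto simp: dX_def dY_def fun_eq_iff)

lemma jointly_continuous_swap: "jointly_continuous f \<Longrightarrow> jointly_continuous (\<lambda>X Y. f Y X)"
  unfolding jointly_continuous_def case_prod_beta
  using continuous_on_compose2[of UNIV "\<lambda>P. f @@ P" UNIV "\<lambda>P. (snd P, fst P)"]
  by (simp add: continuous_on_Pair continuous_on_fst continuous_on_snd continuous_on_id)

lemma smooth_plane_swap:
  assumes "smooth_plane f" shows "smooth_plane (\<lambda>X Y. f Y X)"
proof -
  have "Ck_plane k f \<Longrightarrow> Ck_plane k (\<lambda>X Y. f Y X)" for k
  proof (induction k arbitrary: f)
    case 0
    then show ?case by (simp add: jointly_continuous_swap)
  next
    case (Suc k)
    then show ?case by (simp add: dX_swap[of f] dY_swap[of f])
  qed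
  then show ?thesis using assms by (simp add: smooth_plane_def)
qed

lemma DERIV_const_on_interval:
  fixes f :: "real \<Rightarrow> real"
  assumes "DERIV f s :> D" "s \<in> {a<..<b}" "\<And>r. r \<in> {a<..<b} \<Longrightarrow> f r = C"
  shows "D = 0"
proof -
  have "DERIV f s :> 0"
    by (rule has_field_derivative_transform_within_open[of "\<lambda>_. C" 0 s "{a<..<b}"]) (use assms in auto)
  then show ?thesis using DERIV_unique assms(1) by blast
qed

lemma smooth_plane_two_term:
  assumes f: "smooth_plane f" and 0: "\<And>m. 0 < m \<Longrightarrow> m < n \<Longrightarrow> (dX ^^ m) f X0 Y0 = 0" and n: "0 < n"
  shows "two_term X0 n ((dX ^^ n) f X0 Y0 / fact n) (\<lambda>X. f X Y0 - f X0 Y0)"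
proof -
  define D :: "nat \<Rightarrow> real \<Rightarrow> real" where
    "D m = (if m = 0 then (\<lambda>X. f X Y0 - f X0 Y0) else (\<lambda>X. (dX ^^ m) f X Y0))" for m
  have sm: "smooth_plane ((dX ^^ m) f)" for m by (induction m) (auto simp: f smooth_planeD)
  have "(D m has_real_derivative D (Suc m) X) (at X)" for m X
  proof (cases m)
    case 0
    then show ?thesis using smooth_planeD(4)[OF f, of Y0 X]
      by (auto simp: D_def intro!: derivative_eq_intros)
  next
    case (Suc k)
    then show ?thesis using smooth_planeD(4)[OF sm[of m], of Y0 X] by (simp add: D_def)
  qed
  moreover have "D m X0 = 0" if "m < n" for m using 0 that by (simp add: D_def)
  ultimately have "two_term X0 n (D n X0 / fact n) (D 0)" by (rule two_term_taylor)
  moreover have "D 0 = (\<lambda>X. f X Y0 - f X0 Y0)" by (simp add: D_def fun_eq_iff)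
  ultimately show ?thesis using n by (simp add: D_def)
qed

lemma smooth_plane_two_term_0:
  assumes f: "smooth_plane f"
  shows "two_term X0 0 (f X0 Y0) (\<lambda>X. f X Y0)"
proof -
  have "two_term X0 1 (dX f X0 Y0) (\<lambda>X. f X Y0 - f X0 Y0)"
    using smooth_plane_two_term[OF f, of 1] by simp
  from two_term_leading[OF this] show ?thesis
    by (intro two_termI[where b = "dX f X0 Y0"]) (simp add: numeral_2_eq_2 algebra_simps)
qed

lemma semilinear_eqsD:
  assumes "semilinear_eqs c u w z p q x t"
  shows "DERIV (\<lambda>s. u s Y) X :> sin (w X Y) / (4 * c (u X Y)) * p X Y"
    "DERIV (\<lambda>s. u X s) Y :> sin (z X Y) / (4 * c (u X Y)) * q X Y"
    "((\<lambda>s. w X s) has_real_derivative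
      deriv c (u X Y) / (8 * (c (u X Y))\<^sup>2) * (cos (z X Y) - cos (w X Y)) * q X Y) (at Y)"
    "((\<lambda>s. z s Y) has_real_derivative
      deriv c (u X Y) / (8 * (c (u X Y))\<^sup>2) * (cos (w X Y) - cos (z X Y)) * p X Y) (at X)"
    "((\<lambda>s. p X s) has_real_derivative
      deriv c (u X Y) / (8 * (c (u X Y))\<^sup>2) * (sin (z X Y) - sin (w X Y)) * (p X Y * q X Y)) (at Y)"
    "((\<lambda>s. q s Y) has_real_derivative
      deriv c (u X Y) / (8 * (c (u X Y))\<^sup>2) * (sin (w X Y) - sin (z X Y)) * (p X Y * q X Y)) (at X)"
    "DERIV (\<lambda>s. x s Y) X :> (1 + cos (w X Y)) * p X Y / 4"
    "DERIV (\<lambda>s. x X s) Y :> - ((1 + cos (z X Y)) * q X Y / 4)"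
    "DERIV (\<lambda>s. t s Y) X :> (1 + cos (w X Y)) * p X Y / (4 * c (u X Y))"
    "DERIV (\<lambda>s. t X s) Y :> (1 + cos (z X Y)) * q X Y / (4 * c (u X Y))"
  by (insert assms[unfolded semilinear_eqs_def Let_def, THEN spec[where x = X], THEN spec[where x = Y]];
      elim conjE; assumption)+

section \<open>The semilinear system and its reflection symmetry\<close>

text \<open>The local properties of a solution, separated from the boundary data, which are not invariant under the
reflection below.\<close>

locale semilinear_flow =
  fixes c :: "real \<Rightarrow> real" and u w z p q x t :: "real \<Rightarrow> real \<Rightarrow> real"
  assumes eqs: "semilinear_eqs c u w z p q x t"
    and smooth_u: "smooth_plane u" and smooth_w: "smooth_plane w" and smooth_z: "smooth_plane z"
    and smooth_p: "smooth_plane p" and smooth_q: "smooth_plane q"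
    and cont_x: "jointly_continuous x" and cont_t: "jointly_continuous t"
    and c_pos: "0 < c v"
    and c_DERIV: "DERIV c v :> deriv c v"
    and p_pos: "0 < p X Y" and q_pos: "0 < q X Y"
begin

lemmas u_X = semilinear_eqsD(1)[OF eqs] and u_Y = semilinear_eqsD(2)[OF eqs]
  and w_Y = semilinear_eqsD(3)[OF eqs] and z_X = semilinear_eqsD(4)[OF eqs]
  and p_Y = semilinear_eqsD(5)[OF eqs] and q_X = semilinear_eqsD(6)[OF eqs]
  and x_X = semilinear_eqsD(7)[OF eqs] and x_Y = semilinear_eqsD(8)[OF eqs]
  and t_X = semilinear_eqsD(9)[OF eqs] and t_Y = semilinear_eqsD(10)[OF eqs]

text \<open>The reflection that exchanges the two families of characteristics and reverses the \<open>x\<close> axis.  Every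
fact about the curve \<open>w = pi\<close> or the horizontal direction yields one about \<open>z = pi\<close> or the vertical
direction.\<close>

lemma swapped:
  "semilinear_flow c (\<lambda>X Y. u Y X) (\<lambda>X Y. z Y X) (\<lambda>X Y. w Y X) (\<lambda>X Y. q Y X) (\<lambda>X Y. p Y X)
    (\<lambda>X Y. - x Y X) (\<lambda>X Y. t Y X)"
proof
  show "semilinear_eqs c (\<lambda>X Y. u Y X) (\<lambda>X Y. z Y X) (\<lambda>X Y. w Y X) (\<lambda>X Y. q Y X) (\<lambda>X Y. p Y X)
    (\<lambda>X Y. - x Y X) (\<lambda>X Y. t Y X)"
    unfolding semilinear_eqs_def Let_def
  proof (intro allI conjI)
    fix X Y
    show "DERIV (\<lambda>s. q s X) Y :> deriv c (u Y X) / (8 * (c (u Y X))\<^sup>2) * (sin (w Y X) - sin (z Y X)) * (q Y X * p Y X)"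
      "DERIV (p Y) X :> deriv c (u Y X) / (8 * (c (u Y X))\<^sup>2) * (sin (z Y X) - sin (w Y X)) * (q Y X * p Y X)"
      unfolding mult.commute[of "q Y X" "p Y X"] by (rule q_X p_Y)+
    show "DERIV (\<lambda>s. - x Y s) X :> (1 + cos (z Y X)) * q Y X / 4"
      "DERIV (\<lambda>s. - x s X) Y :> - ((1 + cos (w Y X)) * p Y X / 4)"
      using DERIV_minus[OF x_Y[of Y X]] DERIV_minus[OF x_X[of X Y]] by simp_all
  qed (rule u_X u_Y w_Y z_X t_X t_Y)+
  show "jointly_continuous (\<lambda>X Y. - x Y X)"
    using jointly_continuous_swap[OF cont_x] unfolding jointly_continuous_def case_prod_beta
    by (rule continuous_on_minus)
qed (rule smooth_plane_swap[OF smooth_u] smooth_plane_swap[OF smooth_w] smooth_plane_swap[OF smooth_z]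
    smooth_plane_swap[OF smooth_p] smooth_plane_swap[OF smooth_q] jointly_continuous_swap[OF cont_t]
    c_pos c_DERIV p_pos q_pos)+

section \<open>Injectivity and openness of the map to the physical plane\<close>

lemma x_mono: "X \<le> X' \<Longrightarrow> x X Y \<le> x X' Y" and t_mono: "X \<le> X' \<Longrightarrow> t X Y \<le> t X' Y"
proof -
  have "0 \<le> 1 + cos a" for a :: real using cos_ge_minus_one[of a] by linarith
  then have "0 \<le> (1 + cos (w X Y)) * p X Y / 4" "0 \<le> (1 + cos (w X Y)) * p X Y / (4 * c (u X Y))" for X Y
    using p_pos[of X Y] c_pos[of "u X Y"] by simp_all
  then show "X \<le> X' \<Longrightarrow> x X Y \<le> x X' Y" "X \<le> X' \<Longrightarrow> t X Y \<le> t X' Y"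
    using x_X t_X DERIV_nonneg_imp_nondecreasing[of X X'] by blast+
qed

text \<open>A monotone function with equal values at the ends of a segment is constant on it, so that its
derivative, and hence \<open>1 + cos w\<close>, vanishes.\<close>

lemma constant_imp_angle_pi:
  assumes eq: "x X' Y = x X Y \<or> t X' Y = t X Y" and s: "s \<in> {X<..<X'}"
  shows "cos (w s Y) = - 1"
proof -
  have "(1 + cos (w s Y)) * p s Y / 4 = 0 \<or> (1 + cos (w s Y)) * p s Y / (4 * c (u s Y)) = 0"
    using eq
  proof
    assume "x X' Y = x X Y"
    then have "x r Y = x X Y" if "r \<in> {X<..<X'}" for r
      using x_mono[of X r Y] x_mono[of r X' Y] that by auto
    from DERIV_const_on_interval[OF x_X s this] show ?thesis by blast
  next
    assume "t X' Y = t X Y"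
    then have "t r Y = t X Y" if "r \<in> {X<..<X'}" for r
      using t_mono[of X r Y] t_mono[of r X' Y] that by auto
    from DERIV_const_on_interval[OF t_X s this] show ?thesis by blast
  qed
  then show ?thesis using p_pos[of s Y] c_pos[of "u s Y"] by auto
qed

text \<open>This is all that is used of generic data for injectivity: on a segment where \<open>w = pi\<close> both
\<open>w\<^sub>X\<close> and \<open>w\<^sub>X\<^sub>X\<close> vanish, which a nondegenerate point excludes.\<close>

definition nondegenerate :: "real \<Rightarrow> real \<Rightarrow> bool" where
  "nondegenerate X Y \<longleftrightarrow>
     (cos (w X Y) \<noteq> - 1 \<or> dX w X Y \<noteq> 0 \<or> dX (dX w) X Y \<noteq> 0) \<and>
     (cos (z X Y) \<noteq> - 1 \<or> dY z X Y \<noteq> 0 \<or> dY (dY z) X Y \<noteq> 0)"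

lemma degenerate_on_segment:
  assumes pi: "\<And>s. s \<in> {a<..<b} \<Longrightarrow> cos (w s Y) = - 1" and s: "s \<in> {a<..<b}"
  shows "\<not> nondegenerate s Y"
proof -
  have sin0: "sin (w r Y) = 0" if "r \<in> {a<..<b}" for r
    using pi[OF that] sin_cos_squared_add[of "w r Y"] by simp
  have wX: "dX w r Y = 0" if r: "r \<in> {a<..<b}" for r
  proof -
    have "DERIV (\<lambda>s. sin (w s Y)) r :> cos (w r Y) * dX w r Y"
      by (rule derivative_eq_intros smooth_planeD(4)[OF smooth_w] refl)+
    from DERIV_const_on_interval[OF this r sin0] show ?thesis using pi[OF r] by simp
  qed
  moreover have "dX (dX w) s Y = 0"
    by (rule DERIV_const_on_interval[OF smooth_planeD(4)[OF smooth_planeD(1)[OF smooth_w]] s wX])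
  ultimately show ?thesis using pi[OF s] wX[OF s] by (simp add: nondegenerate_def)
qed

lemma nondegenerate_eventually:
  assumes "nondegenerate X0 Y0"
  shows "\<forall>\<^sub>F P in nhds (X0, Y0). nondegenerate @@ P"
proof -
  have *: "\<forall>\<^sub>F P in nhds (X0, Y0). cos (f @@ P) \<noteq> - 1 \<or> g @@ P \<noteq> 0 \<or> h @@ P \<noteq> 0"
    if "smooth_plane f" "smooth_plane g" "smooth_plane h" "cos (f X0 Y0) \<noteq> - 1 \<or> g X0 Y0 \<noteq> 0 \<or> h X0 Y0 \<noteq> 0"
    for f g h X0 Y0
  proof -
    have "\<forall>\<^sub>F P in nhds (X0, Y0). cos (f @@ P) \<noteq> - 1" if "cos (f X0 Y0) \<noteq> - 1"
      by (rule tendsto_imp_eventually_ne[OF tendsto_cos[OF smooth_plane_tendsto[OF \<open>smooth_plane f\<close>]] that])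
    then show ?thesis
      using that(4) smooth_plane_eventually_ne[OF that(2), of X0 Y0 0]
        smooth_plane_eventually_ne[OF that(3), of X0 Y0 0]
      by (auto elim!: eventually_mono)
  qed
  note sm = smooth_w smooth_z smooth_planeD(1)[OF smooth_w] smooth_planeD(2)[OF smooth_z]
    smooth_planeD(1)[OF smooth_planeD(1)[OF smooth_w]] smooth_planeD(2)[OF smooth_planeD(2)[OF smooth_z]]
  show ?thesis
    using assms eventually_conj[OF *[OF sm(1) sm(3) sm(5)] *[OF sm(2) sm(4) sm(6)], of X0 Y0]
    unfolding nondegenerate_def by blast
qed

text \<open>The point \<open>X'\<close> is arbitrary, not near \<open>X0\<close>: the part of the segment from \<open>X\<close> to \<open>X'\<close> inside the
neighborhood already consists of degenerate points.\<close>

lemma horizontal_fibre_trivial: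
  assumes nd: "\<And>X. \<bar>X - X0\<bar> < e \<Longrightarrow> nondegenerate X Y" and X: "\<bar>X - X0\<bar> < e"
    and eq: "x X' Y = x X Y \<or> t X' Y = t X Y"
  shows "X' = X"
proof (rule ccontr)
  assume ne: "X' \<noteq> X"
  define a where "a = max (min X X') (X0 - e)"
  define b where "b = min (max X X') (X0 + e)"
  have ab: "a < b" using ne X by (auto simp: a_def b_def)
  have "cos (w s Y) = - 1" if s: "s \<in> {a<..<b}" for s
  proof (cases "X < X'")
    case True
    then show ?thesis using constant_imp_angle_pi[OF eq, of s] s by (auto simp: a_def b_def)
  next
    case False
    then show ?thesis using constant_imp_angle_pi[of X Y X' s] eq s by (auto simp: a_def b_def)
  qed
  then have "\<not> nondegenerate ((a + b) / 2) Y"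
    using ab by (intro degenerate_on_segment[of a b]) auto
  moreover have "X0 - e \<le> a" "b \<le> X0 + e" by (auto simp: a_def b_def)
  then have "\<bar>(a + b) / 2 - X0\<bar> < e" using ab by (simp add: abs_less_iff field_simps)
  ultimately show False using nd by blast
qed

end

context semilinear_flow
begin

interpretation sw: semilinear_flow c "\<lambda>X Y. u Y X" "\<lambda>X Y. z Y X" "\<lambda>X Y. w Y X" "\<lambda>X Y. q Y X" "\<lambda>X Y. p Y X"
    "\<lambda>X Y. - x Y X" "\<lambda>X Y. t Y X"
  by (rule swapped)

lemma sw_nondegenerate: "sw.nondegenerate Y X \<longleftrightarrow> nondegenerate X Y"
  unfolding sw.nondegenerate_def nondegenerate_def
    dX_swap[of z] dY_swap[of w] dX_swap[of "dY z"] dY_swap[of "dX w"] by (rule conj_commute)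

text \<open>Two points with the same image span a rectangle.  If the second lies up and to the right of the first,
then \<open>t\<close> is monotone along each of the two monotone paths on the boundary of the rectangle, hence constant
there; otherwise \<open>x\<close> is.\<close>

lemma fibre_horizontal_vertical:
  assumes eq: "x X' Y' = x X Y" "t X' Y' = t X Y"
  shows "(x X' Y = x X Y \<or> t X' Y = t X Y) \<and> (x X Y' = x X Y \<or> t X Y' = t X Y)"
proof -
  note xX = x_mono and tX = t_mono
  have xY: "x A B' \<le> x A B" if "B \<le> B'" for A B B' using sw.x_mono[OF that, of A] by simp
  have tY: "t A B \<le> t A B'" if "B \<le> B'" for A B B' using sw.t_mono[OF that, of A] by simp
  consider "X \<le> X'" "Y \<le> Y'" | "X \<le> X'" "Y' \<le> Y" | "X' \<le> X" "Y \<le> Y'" | "X' \<le> X" "Y' \<le> Y" by linarith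
  then show ?thesis
  proof cases
    case 1
    then show ?thesis using tX[of X X' Y] tX[of X X' Y'] tY[of Y Y' X] tY[of Y Y' X'] eq by linarith
  next
    case 2
    then show ?thesis using xX[of X X' Y] xX[of X X' Y'] xY[of Y' Y X] xY[of Y' Y X'] eq by linarith
  next
    case 3
    then show ?thesis using xX[of X' X Y] xX[of X' X Y'] xY[of Y Y' X] xY[of Y Y' X'] eq by linarith
  next
    case 4
    then show ?thesis using tX[of X' X Y] tX[of X' X Y'] tY[of Y' Y X] tY[of Y' Y X'] eq by linarith
  qed
qed

lemma vertical_fibre_trivial:
  assumes "\<And>Y. \<bar>Y - Y0\<bar> < e \<Longrightarrow> nondegenerate X Y" "\<bar>Y - Y0\<bar> < e" "x X Y' = x X Y \<or> t X Y' = t X Y"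
  shows "Y' = Y"
  using assms by (intro sw.horizontal_fibre_trivial[of Y0 e X]) (auto simp: sw_nondegenerate)

text \<open>Near \<open>P\<close> not only is \<open>\<Lambda>\<close> injective: the whole fibre, including points far from \<open>P\<close>, is a single
point.\<close>

lemma fibre_unique:
  assumes "nondegenerate X0 Y0"
  shows "\<forall>\<^sub>F A in nhds (X0, Y0). \<forall>B. Lam x t B = Lam x t A \<longrightarrow> B = A"
proof -
  obtain e where e: "e > 0" "\<And>X Y. \<bar>X - X0\<bar> < e \<Longrightarrow> \<bar>Y - Y0\<bar> < e \<Longrightarrow> nondegenerate X Y"
    using nondegenerate_eventually[OF assms] by (auto simp: eventually_nhds_box)
  show ?thesis
    unfolding eventually_nhds_box
  proof (intro exI[of _ e] conjI allI impI e(1))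
    fix X Y B assume XY: "\<bar>X - X0\<bar> < e" "\<bar>Y - Y0\<bar> < e" and B: "Lam x t B = Lam x t (X, Y)"
    obtain X' Y' where [simp]: "B = (X', Y')" by (cases B)
    have "x X' Y' = x X Y" "t X' Y' = t X Y" using B by (auto simp: Lam_def)
    note fib = fibre_horizontal_vertical[OF this]
    have "X' = X" using horizontal_fibre_trivial[of X0 e Y X X'] e(2) XY fib by blast
    moreover have "Y' = Y" using vertical_fibre_trivial[of Y0 e X Y Y'] e(2) XY fib by blast
    ultimately show "B = (X, Y)" by simp
  qed
qed

lemma continuous_on_Lam: "continuous_on S (Lam x t)"
proof -
  have "continuous_on UNIV (\<lambda>P. (x @@ P, t @@ P))"
    using cont_x cont_t by (intro continuous_on_Pair) (auto simp: jointly_continuous_def case_prod_beta)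
  then show ?thesis by (auto simp: Lam_def case_prod_beta intro: continuous_on_subset)
qed

lemma open_Lam_image:
  assumes "open N" "inj_on (Lam x t) N" shows "open (Lam x t ` N)"
  by (rule invariance_of_domain[OF continuous_on_Lam assms])

text \<open>By invariance of domain.  The inverse function theorem does not apply, as the differential of \<open>\<Lambda>\<close> is
singular wherever \<open>w = pi\<close> or \<open>z = pi\<close>.\<close>

lemma Lam_nhds:
  assumes nd: "nondegenerate X0 Y0" and ev: "\<forall>\<^sub>F A in nhds (X0, Y0). Q A"
  shows "\<forall>\<^sub>F B in nhds (x X0 Y0, t X0 Y0). \<exists>A. B = Lam x t A \<and> Q A"
proof -
  have "\<forall>\<^sub>F A in nhds (X0, Y0). Q A \<and> (\<forall>B. Lam x t B = Lam x t A \<longrightarrow> B = A)"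
    using ev fibre_unique[OF nd] by (rule eventually_conj)
  then obtain N where N: "open N" "(X0, Y0) \<in> N" "\<And>A. A \<in> N \<Longrightarrow> Q A"
    "\<And>A B. A \<in> N \<Longrightarrow> Lam x t B = Lam x t A \<Longrightarrow> B = A"
    unfolding eventually_nhds by blast
  have "open (Lam x t ` N)" by (rule open_Lam_image[OF N(1)]) (use N(4) in \<open>auto intro: inj_onI\<close>)
  moreover have "(x X0 Y0, t X0 Y0) \<in> Lam x t ` N" using N(2) by (force simp: Lam_def)
  ultimately show ?thesis unfolding eventually_nhds using N(3) by blast
qed

lemma graph_value:
  assumes "conservative_graph x t u v" shows "v (x X Y) (t X Y) = u X Y"
proof -
  have "(x X Y, t X Y, u X Y) \<in> range (\<lambda>(\<xi>, \<tau>). (\<xi>, \<tau>, v \<xi> \<tau>))"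
    using assms unfolding conservative_graph_def by (metis (mono_tags, lifting) case_prod_conv rangeI)
  then show ?thesis by auto
qed

lemma bigo_transfer:
  fixes G g :: "real \<Rightarrow> real \<Rightarrow> real"
  assumes nd: "nondegenerate X0 Y0"
    and bigo: "(\<lambda>P. G (x @@ P) (t @@ P)) \<in> O[nhds (X0, Y0)](\<lambda>P. g (x @@ P) (t @@ P))"
  shows "case_prod G \<in> O[nhds (x X0 Y0, t X0 Y0)](case_prod g)"
proof -
  obtain M where "\<forall>\<^sub>F P in nhds (X0, Y0). norm (G (x @@ P) (t @@ P)) \<le> M * norm (g (x @@ P) (t @@ P))"
    using bigo by (rule landau_o.bigE)
  from Lam_nhds[OF nd this]
  have "\<forall>\<^sub>F B in nhds (x X0 Y0, t X0 Y0). norm (case_prod G B) \<le> M * norm (case_prod g B)"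
    by eventually_elim (auto simp: Lam_def)
  then show ?thesis by (rule bigoI)
qed

end

section \<open>Elimination of the characteristic coordinates\<close>

lemma bigo_power_cancel:
  fixes f g :: "'a \<Rightarrow> real"
  assumes "(\<lambda>x. f x ^ n) \<in> O[F](\<lambda>x. g x ^ n)" "0 < n"
  shows "f \<in> O[F](g)"
proof -
  obtain M where M: "0 < M" "\<forall>\<^sub>F x in F. norm (f x ^ n) \<le> M * norm (g x ^ n)"
    using assms(1) by (rule landau_o.bigE)
  have Mn: "M \<le> (max 1 M) ^ n"
    using power_increasing[of 1 n "max 1 M"] assms(2) by simp
  have "\<forall>\<^sub>F x in F. norm (f x) \<le> max 1 M * norm (g x)"
    using M(2)
  proof eventually_elim
    case (elim x)
    then have "\<bar>f x\<bar> ^ n \<le> M * \<bar>g x\<bar> ^ n" by (simp add: power_abs)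
    also have "\<dots> \<le> (max 1 M) ^ n * \<bar>g x\<bar> ^ n" by (intro mult_right_mono Mn) auto
    finally have "\<bar>f x\<bar> ^ n \<le> (max 1 M * \<bar>g x\<bar>) ^ n" by (simp add: power_mult_distrib)
    then have "\<bar>f x\<bar> \<le> max 1 M * \<bar>g x\<bar>" using assms(2) by (subst (asm) power_mono_iff) auto
    then show ?case by simp
  qed
  then show ?thesis by (rule bigoI)
qed

text \<open>The two equations \<open>s \<approx> A a\<close> and \<open>d \<approx> D b\<close> bound \<open>a\<close> and \<open>b\<close> by \<open>s\<close> and \<open>d\<close>, although each error involves
both unknowns, since together the errors are absorbed by \<open>\<bar>a\<bar> + \<bar>b\<bar>\<close>.\<close>

lemma leading_terms_bigo:
  fixes a b s d :: "'a \<Rightarrow> real"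
  assumes A: "A \<noteq> 0" and D: "D \<noteq> 0"
    and s: "(\<lambda>P. s P - A * a P) \<in> o[F](\<lambda>P. \<bar>a P\<bar> + \<bar>b P\<bar>)"
    and d: "(\<lambda>P. d P - D * b P) \<in> o[F](\<lambda>P. \<bar>a P\<bar> + \<bar>b P\<bar>)"
  shows "(\<lambda>P. \<bar>a P\<bar> + \<bar>b P\<bar>) \<in> O[F](\<lambda>P. \<bar>s P\<bar> + \<bar>d P\<bar>)"
proof -
  let ?g = "\<lambda>P. \<bar>a P\<bar> + \<bar>b P\<bar>" and ?h = "\<lambda>P. \<bar>s P / A\<bar> + \<bar>d P / D\<bar>"
  have "(\<lambda>P. \<bar>1 / A * (s P - A * a P)\<bar> + \<bar>1 / D * (d P - D * b P)\<bar>) \<in> o[F](?g)"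
    using s d A D by (intro sum_in_smallo(1)) simp_all
  moreover have "\<bar>?g P - ?h P\<bar> \<le> 1 * (\<bar>1 / A * (s P - A * a P)\<bar> + \<bar>1 / D * (d P - D * b P)\<bar>)" for P
  proof -
    have "1 / A * (s P - A * a P) = s P / A - a P" "1 / D * (d P - D * b P) = d P / D - b P"
      using A D by (simp_all add: field_simps)
    moreover have "\<bar>\<bar>a'\<bar> + \<bar>b'\<bar> - (\<bar>s'\<bar> + \<bar>d'\<bar>)\<bar> \<le> 1 * (\<bar>s' - a'\<bar> + \<bar>d' - b'\<bar>)" for a' b' s' d' :: real
      by (smt (verit))
    ultimately show ?thesis by metis
  qed
  then have "(\<lambda>P. ?g P - ?h P) \<in> O[F](\<lambda>P. \<bar>1 / A * (s P - A * a P)\<bar> + \<bar>1 / D * (d P - D * b P)\<bar>)"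
    by (rule bigo_of_le) simp
  ultimately have "(\<lambda>P. ?g P - ?h P) \<in> o[F](?g)" by (rule landau_o.big_small_trans[rotated])
  from landau_o.big.diff_absorb2[OF this] have "?g \<in> O[F](?h)" by simp
  moreover have "?h \<in> O[F](\<lambda>P. \<bar>s P\<bar> + \<bar>d P\<bar>)" by (rule bigo_add) (simp_all add: A D)
  ultimately show ?thesis by (rule big_trans)
qed

lemma bigo_tendsto_0_imp_smallo:
  fixes f g e :: "'a \<Rightarrow> real"
  assumes "f \<in> O[F](\<lambda>P. g P * e P)" and "(e \<longlongrightarrow> 0) F"
  shows "f \<in> o[F](g)"
proof -
  have "e \<in> o[F](\<lambda>_. 1)" by (rule smalloI_tendsto) (use assms(2) in auto)
  then have "(\<lambda>P. g P * e P) \<in> o[F](\<lambda>P. g P * 1)" by (rule landau_o.big_small_mult[OF big_refl])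
  with assms(1) show ?thesis by (simp add: landau_o.big_small_trans)
qed

lemma bigo_power_le:
  fixes H :: "'a \<Rightarrow> real"
  assumes "(H \<longlongrightarrow> 0) F" "n \<le> m"
  shows "(\<lambda>P. H P ^ m) \<in> O[F](\<lambda>P. H P ^ n)"
proof -
  have "(\<lambda>P. H P ^ n * H P ^ (m - n)) \<in> O[F](\<lambda>P. H P ^ n * 1 ^ (m - n))"
    by (intro big_mult big_power tendsto_imp_bigo_1[OF assms(1)] big_refl)
  then show ?thesis using assms(2) by (simp add: power_add[symmetric])
qed

lemma fractional_power:
  fixes r :: real
  assumes "0 \<le> r" "0 < n" and that: "0 < m"
  shows "(r powr (1 / real n)) ^ m = r powr (real m / real n)"
proof (cases "r = 0")
  case True
  then show ?thesis using that by (simp add: power_0_left)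
next
  case False
  then have "(r powr (1 / real n)) ^ m = (r powr (1 / real n)) powr real m"
    using assms by (simp add: powr_realpow)
  then show ?thesis by (simp add: powr_powr)
qed

lemma tendsto_powr_0:
  fixes r :: "'a \<Rightarrow> real"
  assumes "(r \<longlongrightarrow> 0) F" "\<And>P. 0 \<le> r P" "0 < a"
  shows "((\<lambda>P. r P powr a) \<longlongrightarrow> 0) F"
  using tendsto_powr2[OF assms(1) tendsto_const[of a]] assms by simp

lemma tendsto_0_mult_smallo:
  fixes a b g :: "'a \<Rightarrow> real"
  assumes "b \<in> O[F](g)" and "(a \<longlongrightarrow> 0) F"
  shows "(\<lambda>P. a P * b P) \<in> o[F](g)"
  using bigo_tendsto_0_imp_smallo[OF big_mult[OF assms(1) big_refl] assms(2)] by (simp add: mult.commute)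

lemma tendsto_power_abs_0:
  fixes H :: "'a \<Rightarrow> real"
  assumes "(H \<longlongrightarrow> 0) F" "0 < n" shows "((\<lambda>P. \<bar>H P\<bar> ^ n) \<longlongrightarrow> 0) F"
  using tendsto_power[OF tendsto_rabs_zero[OF assms(1)], of n] assms(2) by (simp add: power_0_left)

lemma power_smallo:
  fixes H :: "'a \<Rightarrow> real"
  assumes "(\<lambda>P. \<bar>H P\<bar> ^ n) \<in> O[F](g)" "(H \<longlongrightarrow> 0) F" "n < m"
  shows "(\<lambda>P. \<bar>H P\<bar> ^ m) \<in> o[F](g)"
proof -
  have "(\<lambda>P. \<bar>H P\<bar> ^ (m - n) * \<bar>H P\<bar> ^ n) \<in> o[F](g)"
    by (rule tendsto_0_mult_smallo[OF assms(1) tendsto_power_abs_0[OF assms(2)]]) (use assms(3) in simp)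
  then show ?thesis using assms(3) by (simp flip: power_add)
qed

text \<open>In all three lemmas \<open>H\<close> and \<open>K\<close> are the distances \<open>X - X0\<close> and \<open>Y - Y0\<close>, \<open>s\<close> and \<open>d\<close> the two
characteristic combinations of \<open>x - x0\<close> and \<open>t - t0\<close>, \<open>U\<close> is \<open>u - u0\<close> and \<open>r\<close> is the distance in the
\<open>x\<close>-\<open>t\<close> plane.

Here \<open>H\<close> is of order \<open>r powr (1/3)\<close> and \<open>K\<close> of order \<open>r\<close>, and the admissible error is of order \<open>H ^ 4\<close>.  The
term \<open>G * H ^ 4\<close> of \<open>s\<close> changes \<open>root 3 s\<close> by a multiple of \<open>H\<^sup>2\<close>, hence its square by a multiple of
\<open>H ^ 3\<close>.  This change and the cubic term of \<open>U\<close> are multiples of \<open>s\<close>, up to the error; they account for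
the linear term with coefficient \<open>b1\<close>.\<close>

lemma type1_asymptotics:
  fixes H K s d U r :: "'a \<Rightarrow> real"
  assumes H0: "(H \<longlongrightarrow> 0) F" and K0: "(K \<longlongrightarrow> 0) F" and r0: "(r \<longlongrightarrow> 0) F"
    and r_nonneg: "\<And>P. 0 \<le> r P" and A: "A \<noteq> 0" and D: "D \<noteq> 0"
    and s: "(\<lambda>P. s P - (A * H P ^ 3 + G * H P ^ 4)) \<in> O[F](\<lambda>P. (\<bar>K P\<bar> + \<bar>H P\<bar>\<^sup>2) * \<bar>K P\<bar> + \<bar>H P\<bar> ^ 5)"
    and d: "(\<lambda>P. d P - D * K P) \<in> O[F](\<lambda>P. (\<bar>H P\<bar> + \<bar>K P\<bar>) * \<bar>K P\<bar> + \<bar>H P\<bar> ^ 5)"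
    and U: "(\<lambda>P. U P - (\<alpha> * K P + B * (H P)\<^sup>2 + \<gamma> * H P ^ 3)) \<in> O[F](\<lambda>P. (\<bar>H P\<bar> + \<bar>K P\<bar>) * \<bar>K P\<bar> + \<bar>H P\<bar> ^ 4)"
    and sr: "s \<in> O[F](r)" and dr: "d \<in> O[F](r)"
  shows "\<exists>b1 b2. (\<lambda>P. U P - (B / (root 3 A)\<^sup>2 * (root 3 (s P))\<^sup>2 + b1 * s P + b2 * d P)) \<in> O[F](\<lambda>P. r P powr (4 / 3))"
proof -
  let ?h = "\<lambda>P. \<bar>H P\<bar>" and ?k = "\<lambda>P. \<bar>K P\<bar>"
  note expand = distrib_right power2_eq_square[symmetric]
  note s = s[unfolded expand] and d = d[unfolded expand] and U = U[unfolded expand]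
  define \<rho> where "\<rho> P = r P powr (1 / 3)" for P
  have \<rho>_pow: "\<rho> P ^ 3 = r P" "\<rho> P ^ 4 = r P powr (4 / 3)" for P
    using fractional_power[OF r_nonneg, of 3 3 P] fractional_power[OF r_nonneg, of 3 4 P] r_nonneg[of P]
    by (simp_all add: \<rho>_def)
  have \<rho>0: "(\<rho> \<longlongrightarrow> 0) F" unfolding \<rho>_def by (rule tendsto_powr_0[OF r0 r_nonneg]) simp
  note H_lim = tendsto_power_abs_0[OF H0]
  define g where "g P = \<bar>H P ^ 3\<bar> + ?k P" for P
  have Hg: "(\<lambda>P. ?h P ^ 3) \<in> O[F](g)" and Kg: "(\<lambda>P. ?k P) \<in> O[F](g)"
    by (rule bigo_of_le[where C = 1]; simp add: g_def power_abs)+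
  have H_small: "(\<lambda>P. ?h P ^ n) \<in> o[F](g)" if "3 < n" for n by (rule power_smallo[OF Hg H0 that])
  have KK_small: "(\<lambda>P. (?k P)\<^sup>2) \<in> o[F](g)" by (rule power_smallo[where n = 1]) (use Kg K0 in simp_all)
  note HK_small = tendsto_0_mult_smallo[OF Kg]
  \<comment> \<open>The leading parts of \<open>s\<close> and \<open>d\<close> are \<open>A * H ^ 3\<close> and \<open>D * K\<close>; the rest is small compared with \<open>g\<close>.\<close>
  have s3: "(\<lambda>P. s P - A * H P ^ 3) \<in> o[F](g)"
  proof -
    have "(\<lambda>P. (?k P)\<^sup>2 + (?h P)\<^sup>2 * ?k P + ?h P ^ 5) \<in> o[F](g)"
      by (intro sum_in_smallo(1) H_small HK_small H_lim KK_small) simp_all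
    from landau_o.big_small_trans[OF s this]
    have 1: "(\<lambda>P. s P - (A * H P ^ 3 + G * H P ^ 4)) \<in> o[F](g)" .
    have 2: "(\<lambda>P. G * H P ^ 4) \<in> o[F](g)" using H_small[of 4] by (simp add: power_even_abs)
    show ?thesis using sum_in_smallo(1)[OF 1 2] by simp
  qed
  have dK: "(\<lambda>P. d P - D * K P) \<in> o[F](g)"
    by (rule landau_o.big_small_trans[OF d])
      (intro sum_in_smallo(1) H_small HK_small tendsto_rabs_zero H0 KK_small; simp)
  have "g \<in> O[F](\<lambda>P. \<bar>s P\<bar> + \<bar>d P\<bar>)"
    using leading_terms_bigo[OF A D, of s "\<lambda>P. H P ^ 3" F K d] s3 dK unfolding g_def by blast
  moreover have "(\<lambda>P. \<bar>s P\<bar> + \<bar>d P\<bar>) \<in> O[F](r)" using sr dr by (intro sum_in_bigo(1)) simp_all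
  ultimately have gr: "g \<in> O[F](r)" by (rule big_trans)
  have "(\<lambda>P. ?h P ^ 3) \<in> O[F](\<lambda>P. \<rho> P ^ 3)"
    unfolding \<rho>_pow by (rule big_trans[OF Hg gr])
  from bigo_power_cancel[OF this] have H\<rho>: "(\<lambda>P. ?h P) \<in> O[F](\<rho>)" by simp
  have K\<rho>: "(\<lambda>P. ?k P) \<in> O[F](\<lambda>P. \<rho> P ^ 3)"
    unfolding \<rho>_pow by (rule big_trans[OF Kg gr])
  have H4: "(\<lambda>P. ?h P ^ 4) \<in> O[F](\<lambda>P. \<rho> P ^ 4)" by (rule big_power[OF H\<rho>])
  have HK: "(\<lambda>P. ?h P * ?k P) \<in> O[F](\<lambda>P. \<rho> P ^ 4)"
    using big_mult[OF H\<rho> K\<rho>] by (simp add: numeral_eq_Suc del: landau_o.big.abs_in_iff)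
  have KK: "(\<lambda>P. (?k P)\<^sup>2) \<in> O[F](\<lambda>P. \<rho> P ^ 4 * (\<rho> P)\<^sup>2)"
    using big_power[OF K\<rho>, of 2] by (simp add: power_mult[symmetric] power_add[symmetric])
  have \<rho>6: "(\<lambda>P. \<rho> P ^ 4 * (\<rho> P)\<^sup>2) \<in> O[F](\<lambda>P. \<rho> P ^ 4)"
    using bigo_power_le[OF \<rho>0, of 4 6] by (simp add: power_add[symmetric])

  \<comment> \<open>With this choice the cube of \<open>b\<close> agrees with \<open>A * H ^ 3 + G * H ^ 4\<close> up to order five, so that \<open>b\<close> is
    the root of the known part of \<open>s\<close> up to the admissible error.\<close>
  define \<kappa> where "\<kappa> = G / (3 * A)"
  define b where "b P = root 3 A * H P * (1 + \<kappa> * H P)" for P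
  have A3: "root 3 A ^ 3 = A" by (simp add: odd_real_root_pow)
  have A0: "root 3 A \<noteq> 0" using A by simp
  define m where "m P = \<bar>b P\<bar> + (\<rho> P)\<^sup>2" for P
  have Hm: "(\<lambda>P. ?h P) \<in> O[F](m)"
  proof -
    have "((\<lambda>P. \<kappa> * H P) \<longlongrightarrow> \<kappa> * 0) F" by (rule tendsto_mult[OF tendsto_const H0])
    then have "\<forall>\<^sub>F P in F. dist (\<kappa> * H P) 0 < 1 / 2" by (intro tendstoD) simp_all
    then have "\<forall>\<^sub>F P in F. norm (?h P) \<le> 2 / \<bar>root 3 A\<bar> * norm (m P)"
    proof eventually_elim
      case (elim P)
      have "1 / 2 \<le> \<bar>1 + \<kappa> * H P\<bar>" using elim unfolding dist_real_def by arith
      then have "\<bar>root 3 A\<bar> * ?h P * (1 / 2) \<le> \<bar>root 3 A\<bar> * ?h P * \<bar>1 + \<kappa> * H P\<bar>"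
        by (intro mult_left_mono) auto
      also have "\<dots> = \<bar>b P\<bar>" by (simp add: b_def abs_mult)
      also have "\<dots> \<le> m P" by (simp add: m_def)
      finally have "\<bar>root 3 A\<bar> * ?h P * (1 / 2) \<le> m P" .
      moreover have "0 \<le> m P" by (simp add: m_def)
      ultimately show ?case using A0 by (simp add: field_simps)
    qed
    then show ?thesis by (rule bigoI)
  qed
  have \<rho>m: "(\<lambda>P. (\<rho> P)\<^sup>2) \<in> O[F](m)" by (rule bigo_of_le[where C = 1]) (simp_all add: m_def)
  \<comment> \<open>The weight of the stability lemma for cube roots with the scale \<open>\<rho>\<^sup>2\<close>.\<close>
  define Q where "Q P = \<rho> P ^ 4 * m P" for P
  have H5: "(\<lambda>P. ?h P ^ 5) \<in> O[F](Q)"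
    using big_mult[OF H4 Hm] unfolding Q_def by (simp add: numeral_eq_Suc mult_ac del: landau_o.big.abs_in_iff)
  have H6: "(\<lambda>P. ?h P ^ 6) \<in> O[F](Q)"
    using big_trans[OF bigo_power_le[OF tendsto_rabs_zero[OF H0], of 5 6] H5] by simp
  have HHK: "(\<lambda>P. (?h P)\<^sup>2 * ?k P) \<in> O[F](Q)"
    unfolding Q_def by (rule bigo_ext[OF big_mult[OF HK Hm]]) (simp add: power2_eq_square)
  have KKQ: "(\<lambda>P. (?k P)\<^sup>2) \<in> O[F](Q)"
    unfolding Q_def by (rule big_trans[OF KK big_mult[OF big_refl \<rho>m]])
  have sQ: "(\<lambda>P. s P - (A * H P ^ 3 + G * H P ^ 4)) \<in> O[F](Q)"
    by (rule big_trans[OF s]) (intro sum_in_bigo(1) H5 HHK KKQ)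
  have b3: "b P ^ 3 = A * H P ^ 3 + G * H P ^ 4 + A * (3 * \<kappa>\<^sup>2 * H P ^ 5 + \<kappa> ^ 3 * H P ^ 6)" for P
  proof -
    have "G = 3 * A * \<kappa>" using A by (simp add: \<kappa>_def)
    then show ?thesis unfolding b_def power_mult_distrib A3
      by (simp add: algebra_simps numeral_eq_Suc)
  qed
  have "(\<lambda>P. \<bar>H P ^ 5\<bar>) \<in> O[F](Q)" "(\<lambda>P. \<bar>H P ^ 6\<bar>) \<in> O[F](Q)"
    using H5 H6 by (simp_all only: power_abs)
  then have "(\<lambda>P. (s P - (A * H P ^ 3 + G * H P ^ 4)) - A * (3 * \<kappa>\<^sup>2 * H P ^ 5 + \<kappa> ^ 3 * H P ^ 6)) \<in> O[F](Q)"
    using A by (intro sum_in_bigo(2)[OF sQ]) (simp add: sum_in_bigo)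
  then have "(\<lambda>P. root 3 (s P) ^ 3 - b P ^ 3) \<in> O[F](\<lambda>P. ((\<rho> P)\<^sup>2)\<^sup>2 * (\<bar>b P\<bar> + (\<rho> P)\<^sup>2))"
    unfolding b3 by (simp add: odd_real_root_pow Q_def[abs_def] m_def power_mult[symmetric] diff_diff_eq)
  from bigo_square_diff_of_cube_diff[OF this]
  have e2: "(\<lambda>P. (root 3 (s P))\<^sup>2 - (b P)\<^sup>2) \<in> O[F](\<lambda>P. \<rho> P ^ 4)" by (simp add: power_mult[symmetric])

  have H4': "(\<lambda>P. H P ^ 4) \<in> O[F](\<lambda>P. \<rho> P ^ 4)" using H4 by (simp add: power_even_abs)
  have KK4: "(\<lambda>P. (?k P)\<^sup>2) \<in> O[F](\<lambda>P. \<rho> P ^ 4)" by (rule big_trans[OF KK \<rho>6])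
  have H5': "(\<lambda>P. ?h P ^ 5) \<in> O[F](\<lambda>P. \<rho> P ^ 4)"
    using big_trans[OF bigo_power_le[OF tendsto_rabs_zero[OF H0], of 4 5] H4] by simp
  have HHK': "(\<lambda>P. (?h P)\<^sup>2 * ?k P) \<in> O[F](\<lambda>P. \<rho> P ^ 4)"
  proof -
    have "(\<lambda>P. ?h P * (?h P * ?k P)) \<in> O[F](\<lambda>P. 1 * \<rho> P ^ 4)"
      by (rule big_mult[OF tendsto_imp_bigo_1[OF tendsto_rabs_zero[OF H0]] HK])
    then show ?thesis unfolding mult_1_left by (rule bigo_ext) (simp add: power2_eq_square)
  qed
  have e1: "(\<lambda>P. U P - (\<alpha> * K P + B * (H P)\<^sup>2 + \<gamma> * H P ^ 3)) \<in> O[F](\<lambda>P. \<rho> P ^ 4)"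
    by (rule big_trans[OF U]) (intro sum_in_bigo(1) H4 HK KK4)
  have e3: "(\<lambda>P. s P - (A * H P ^ 3 + G * H P ^ 4)) \<in> O[F](\<lambda>P. \<rho> P ^ 4)"
    by (rule big_trans[OF s]) (intro sum_in_bigo(1) H5' HHK' KK4)
  have e4: "(\<lambda>P. d P - D * K P) \<in> O[F](\<lambda>P. \<rho> P ^ 4)"
    by (rule big_trans[OF d]) (intro sum_in_bigo(1) H5' HK KK4)
  \<comment> \<open>The coefficient of \<open>H ^ 3\<close> that is left over is moved into \<open>s\<close>, and that of \<open>K\<close> into \<open>d\<close>.\<close>
  define b1 where "b1 = (\<gamma> - 2 * B * \<kappa>) / A"
  define b2 where "b2 = \<alpha> / D"
  have "(\<lambda>P. (U P - (\<alpha> * K P + B * (H P)\<^sup>2 + \<gamma> * H P ^ 3))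
      - B / (root 3 A)\<^sup>2 * ((root 3 (s P))\<^sup>2 - (b P)\<^sup>2)
      - b1 * (s P - (A * H P ^ 3 + G * H P ^ 4)) - b2 * (d P - D * K P)
      - (B * \<kappa>\<^sup>2 + b1 * G) * H P ^ 4) \<in> O[F](\<lambda>P. \<rho> P ^ 4)"
    by (rule sum_in_bigo(2)[OF sum_in_bigo(2)[OF sum_in_bigo(2)[OF sum_in_bigo(2)[OF e1
        bigo_cmult[OF e2]] bigo_cmult[OF e3]] bigo_cmult[OF e4]] bigo_cmult[OF H4']])
  moreover have "U P - (B / (root 3 A)\<^sup>2 * (root 3 (s P))\<^sup>2 + b1 * s P + b2 * d P) =
      (U P - (\<alpha> * K P + B * (H P)\<^sup>2 + \<gamma> * H P ^ 3))
      - B / (root 3 A)\<^sup>2 * ((root 3 (s P))\<^sup>2 - (b P)\<^sup>2)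
      - b1 * (s P - (A * H P ^ 3 + G * H P ^ 4)) - b2 * (d P - D * K P)
      - (B * \<kappa>\<^sup>2 + b1 * G) * H P ^ 4" for P
  proof -
    have "B / (root 3 A)\<^sup>2 * (b P)\<^sup>2 = B * (H P)\<^sup>2 + 2 * B * \<kappa> * H P ^ 3 + B * \<kappa>\<^sup>2 * H P ^ 4"
      unfolding b_def power_mult_distrib using A0 by (simp add: field_simps numeral_eq_Suc)
    moreover have "b1 * A = \<gamma> - 2 * B * \<kappa>" "b2 * D = \<alpha>" using A D by (simp_all add: b1_def b2_def)
    then have "b1 * (A * H P ^ 3) = (\<gamma> - 2 * B * \<kappa>) * H P ^ 3" "b2 * (D * K P) = \<alpha> * K P"
      by (simp_all only: mult.assoc[symmetric])
    ultimately show ?thesis by (auto simp: algebra_simps)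
  qed
  ultimately have "(\<lambda>P. U P - (B / (root 3 A)\<^sup>2 * (root 3 (s P))\<^sup>2 + b1 * s P + b2 * d P)) \<in> O[F](\<lambda>P. \<rho> P ^ 4)"
    by (rule bigo_ext)
  then show ?thesis unfolding \<rho>_pow by blast
qed

text \<open>Now \<open>H\<close> is of order \<open>r powr (1/5)\<close>, \<open>K\<close> of order \<open>r\<close>, and the error of order \<open>H ^ 4\<close>; the term linear in
\<open>K\<close> is smaller, so the leading powers suffice.\<close>

lemma type2_asymptotics:
  fixes H K s d U r :: "'a \<Rightarrow> real"
  assumes H0: "(H \<longlongrightarrow> 0) F" and K0: "(K \<longlongrightarrow> 0) F" and r0: "(r \<longlongrightarrow> 0) F"
    and r_nonneg: "\<And>P. 0 \<le> r P" and A: "A \<noteq> 0" and D: "D \<noteq> 0"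
    and s: "(\<lambda>P. s P - A * H P ^ 5) \<in> O[F](\<lambda>P. (\<bar>K P\<bar> + \<bar>H P\<bar> ^ 3) * \<bar>K P\<bar> + \<bar>H P\<bar> ^ 6)"
    and d: "(\<lambda>P. d P - D * K P) \<in> O[F](\<lambda>P. (\<bar>H P\<bar> + \<bar>K P\<bar>) * \<bar>K P\<bar> + \<bar>H P\<bar> ^ 7)"
    and U: "(\<lambda>P. U P - B * H P ^ 3) \<in> O[F](\<lambda>P. \<bar>K P\<bar> + \<bar>H P\<bar> ^ 4)"
    and sr: "s \<in> O[F](r)" and dr: "d \<in> O[F](r)"
  shows "(\<lambda>P. U P - B / root 5 A ^ 3 * root 5 (s P) ^ 3) \<in> O[F](\<lambda>P. r P powr (4 / 5))"
proof -
  let ?h = "\<lambda>P. \<bar>H P\<bar>" and ?k = "\<lambda>P. \<bar>K P\<bar>"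
  note expand = distrib_right power2_eq_square[symmetric]
  note s = s[unfolded expand] and d = d[unfolded expand]
  \<comment> \<open>The stability lemma for fifth roots is applied with the scale \<open>r powr (4/15)\<close>, whose cube is the error.
    The common denominator makes all exponents of \<open>\<theta>\<close> integers.\<close>
  define \<theta> where "\<theta> P = r P powr (1 / 15)" for P
  have \<theta>_pow: "\<theta> P ^ 15 = r P" "\<theta> P ^ 12 = r P powr (4 / 5)" for P
    using fractional_power[OF r_nonneg, of 15 15 P] fractional_power[OF r_nonneg, of 15 12 P] r_nonneg[of P]
    by (simp_all add: \<theta>_def)
  have \<theta>0: "(\<theta> \<longlongrightarrow> 0) F" unfolding \<theta>_def by (rule tendsto_powr_0[OF r0 r_nonneg]) simp
  have \<theta>_nonneg: "0 \<le> \<theta> P" for P by (simp add: \<theta>_def)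
  note H_lim = tendsto_power_abs_0[OF H0]
  define g where "g P = \<bar>H P ^ 5\<bar> + ?k P" for P
  have Hg: "(\<lambda>P. ?h P ^ 5) \<in> O[F](g)" and Kg: "(\<lambda>P. ?k P) \<in> O[F](g)"
    by (rule bigo_of_le[where C = 1]; simp add: g_def power_abs)+
  have H_small: "(\<lambda>P. ?h P ^ n) \<in> o[F](g)" if "5 < n" for n by (rule power_smallo[OF Hg H0 that])
  have KK_small: "(\<lambda>P. (?k P)\<^sup>2) \<in> o[F](g)" by (rule power_smallo[where n = 1]) (use Kg K0 in simp_all)
  note HK_small = tendsto_0_mult_smallo[OF Kg]
  have s5: "(\<lambda>P. s P - A * H P ^ 5) \<in> o[F](g)"
    by (rule landau_o.big_small_trans[OF s])
      (intro sum_in_smallo(1) H_small HK_small H_lim KK_small; simp)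
  have dK: "(\<lambda>P. d P - D * K P) \<in> o[F](g)"
    by (rule landau_o.big_small_trans[OF d])
      (intro sum_in_smallo(1) H_small HK_small tendsto_rabs_zero H0 KK_small; simp)
  have "g \<in> O[F](\<lambda>P. \<bar>s P\<bar> + \<bar>d P\<bar>)"
    using leading_terms_bigo[OF A D, of s "\<lambda>P. H P ^ 5" F K d] s5 dK unfolding g_def by blast
  moreover have "(\<lambda>P. \<bar>s P\<bar> + \<bar>d P\<bar>) \<in> O[F](r)" using sr dr by (intro sum_in_bigo(1)) simp_all
  ultimately have gr: "g \<in> O[F](r)" by (rule big_trans)
  have "(\<lambda>P. ?h P ^ 5) \<in> O[F](\<lambda>P. (\<theta> P ^ 3) ^ 5)"
    unfolding power_mult[symmetric] using big_trans[OF Hg gr] by (simp add: \<theta>_pow)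
  from bigo_power_cancel[OF this] have H\<theta>: "(\<lambda>P. ?h P) \<in> O[F](\<lambda>P. \<theta> P ^ 3)" by simp
  have K\<theta>: "(\<lambda>P. ?k P) \<in> O[F](\<lambda>P. \<theta> P ^ 15)"
    unfolding \<theta>_pow by (rule big_trans[OF Kg gr])
  have H4: "(\<lambda>P. ?h P ^ 4) \<in> O[F](\<lambda>P. \<theta> P ^ 12)"
    using big_power[OF H\<theta>, of 4] by (simp add: power_mult[symmetric])
  have HK: "(\<lambda>P. ?h P * ?k P) \<in> O[F](\<lambda>P. \<theta> P ^ 12)"
    using big_trans[OF big_mult[OF H\<theta> K\<theta>, unfolded power_add[symmetric]] bigo_power_le[OF \<theta>0, of 12 "3 + 15"]]
    by linarith
  have K12: "(\<lambda>P. ?k P) \<in> O[F](\<lambda>P. \<theta> P ^ 12)"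
    by (rule big_trans[OF K\<theta> bigo_power_le[OF \<theta>0]]) simp
  have K8: "(\<lambda>P. ?k P) \<in> O[F](\<lambda>P. \<theta> P ^ 8)"
    by (rule big_trans[OF K\<theta> bigo_power_le[OF \<theta>0]]) simp

  define b where "b P = root 5 A * H P" for P
  have A5: "root 5 A ^ 5 = A" by (simp add: odd_real_root_pow)
  have A0: "root 5 A \<noteq> 0" using A by simp
  define m where "m P = (b P)\<^sup>2 + (\<theta> P ^ 4)\<^sup>2" for P
  have Hm: "(\<lambda>P. (?h P)\<^sup>2) \<in> O[F](m)"
  proof (rule bigo_of_le[where C = "1 / (root 5 A)\<^sup>2"])
    show "\<bar>(?h P)\<^sup>2\<bar> \<le> 1 / (root 5 A)\<^sup>2 * m P" for P
      using A0 by (simp add: m_def b_def power_mult_distrib field_simps)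
  qed (simp add: m_def)
  have \<theta>m: "(\<lambda>P. \<theta> P ^ 8) \<in> O[F](m)"
    by (rule bigo_of_le[where C = 1]) (simp_all add: m_def power_mult[symmetric])
  define Q where "Q P = \<theta> P ^ 12 * m P" for P
  have H6: "(\<lambda>P. ?h P ^ 6) \<in> O[F](Q)"
    unfolding Q_def by (rule bigo_ext[OF big_mult[OF H4 Hm]]) (simp add: power_add[symmetric] del: power2_abs)
  have HHHK: "(\<lambda>P. ?h P ^ 3 * ?k P) \<in> O[F](Q)"
    unfolding Q_def by (rule bigo_ext[OF big_mult[OF HK Hm]]) (simp add: numeral_eq_Suc del: power2_abs abs_mult_self_eq)
  have KK: "(\<lambda>P. (?k P)\<^sup>2) \<in> O[F](Q)"
    unfolding Q_def by (rule bigo_ext[OF big_mult[OF K12 big_trans[OF K8 \<theta>m]]]) (simp add: power2_eq_square)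
  have sQ: "(\<lambda>P. s P - A * H P ^ 5) \<in> O[F](Q)"
    by (rule big_trans[OF s]) (intro sum_in_bigo(1) H6 HHHK KK)
  have "b P ^ 5 = A * H P ^ 5" for P by (simp add: b_def power_mult_distrib A5)
  then have "(\<lambda>P. root 5 (s P) ^ 5 - b P ^ 5) \<in> O[F](\<lambda>P. (\<theta> P ^ 4) ^ 3 * ((b P)\<^sup>2 + (\<theta> P ^ 4)\<^sup>2))"
    using sQ by (simp add: odd_real_root_pow Q_def[abs_def] m_def power_mult[symmetric])
  from bigo_cube_diff_of_quintic_diff[OF this]
  have e2: "(\<lambda>P. root 5 (s P) ^ 3 - b P ^ 3) \<in> O[F](\<lambda>P. \<theta> P ^ 12)"
    by (simp add: power_mult[symmetric] \<theta>_nonneg)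
  have e1: "(\<lambda>P. U P - B * H P ^ 3) \<in> O[F](\<lambda>P. \<theta> P ^ 12)"
    by (rule big_trans[OF U]) (intro sum_in_bigo(1) H4 K12)
  have "(\<lambda>P. (U P - B * H P ^ 3) - B / root 5 A ^ 3 * (root 5 (s P) ^ 3 - b P ^ 3)) \<in> O[F](\<lambda>P. \<theta> P ^ 12)"
    by (rule sum_in_bigo(2)[OF e1 bigo_cmult[OF e2]])
  moreover have "U P - B / root 5 A ^ 3 * root 5 (s P) ^ 3 =
      (U P - B * H P ^ 3) - B / root 5 A ^ 3 * (root 5 (s P) ^ 3 - b P ^ 3)" for P
    unfolding b_def power_mult_distrib using A0 by (simp add: field_simps)
  ultimately have "(\<lambda>P. U P - B / root 5 A ^ 3 * root 5 (s P) ^ 3) \<in> O[F](\<lambda>P. \<theta> P ^ 12)" by (rule bigo_ext)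
  then show ?thesis unfolding \<theta>_pow .
qed

text \<open>Now \<open>H\<close> and \<open>K\<close> are both of order \<open>r powr (1/3)\<close>, and \<open>s\<close> and \<open>d\<close> play symmetric parts.  The terms of
order \<open>H ^ 4\<close> only contribute to the error, which is of order \<open>r\<close>.\<close>

lemma type3_asymptotics:
  fixes H K s d U r :: "'a \<Rightarrow> real"
  assumes H0: "(H \<longlongrightarrow> 0) F" and K0: "(K \<longlongrightarrow> 0) F" and r0: "(r \<longlongrightarrow> 0) F"
    and r_nonneg: "\<And>P. 0 \<le> r P" and A: "A \<noteq> 0" and A': "A' \<noteq> 0"
    and s: "(\<lambda>P. s P - A * H P ^ 3) \<in> O[F](\<lambda>P. \<bar>H P\<bar> ^ 4 + \<bar>K P\<bar> ^ 5)"
    and d: "(\<lambda>P. d P - A' * K P ^ 3) \<in> O[F](\<lambda>P. \<bar>K P\<bar> ^ 4 + \<bar>H P\<bar> ^ 5)"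
    and U: "(\<lambda>P. U P - (B * (H P)\<^sup>2 + B' * (K P)\<^sup>2)) \<in> O[F](\<lambda>P. \<bar>H P\<bar> ^ 3 + \<bar>K P\<bar> ^ 3)"
    and sr: "s \<in> O[F](r)" and dr: "d \<in> O[F](r)"
  shows "(\<lambda>P. U P - (B / (root 3 A)\<^sup>2 * (root 3 (s P))\<^sup>2 + B' / (root 3 A')\<^sup>2 * (root 3 (d P))\<^sup>2)) \<in> O[F](r)"
proof -
  let ?h = "\<lambda>P. \<bar>H P\<bar>" and ?k = "\<lambda>P. \<bar>K P\<bar>"
  \<comment> \<open>The scale of the stability lemma is \<open>\<theta> ^ 3\<close>, the square root of \<open>r\<close>.\<close>
  define \<theta> where "\<theta> P = r P powr (1 / 6)" for P
  have \<theta>_pow: "\<theta> P ^ 6 = r P" for P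
    using fractional_power[OF r_nonneg, of 6 6 P] r_nonneg[of P] by (simp add: \<theta>_def)
  have \<theta>0: "(\<theta> \<longlongrightarrow> 0) F" unfolding \<theta>_def by (rule tendsto_powr_0[OF r0 r_nonneg]) simp
  have \<theta>_nonneg: "0 \<le> \<theta> P" for P by (simp add: \<theta>_def)
  define g where "g P = \<bar>H P ^ 3\<bar> + \<bar>K P ^ 3\<bar>" for P
  have Hg: "(\<lambda>P. ?h P ^ 3) \<in> O[F](g)" and Kg: "(\<lambda>P. ?k P ^ 3) \<in> O[F](g)"
    by (rule bigo_of_le[where C = 1]; simp add: g_def power_abs)+
  note small = power_smallo[OF Hg H0] power_smallo[OF Kg K0]
  have s3: "(\<lambda>P. s P - A * H P ^ 3) \<in> o[F](g)"
    by (rule landau_o.big_small_trans[OF s]) (intro sum_in_smallo(1) small; simp)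
  have d3: "(\<lambda>P. d P - A' * K P ^ 3) \<in> o[F](g)"
    by (rule landau_o.big_small_trans[OF d]) (intro sum_in_smallo(1) small; simp)
  have "g \<in> O[F](\<lambda>P. \<bar>s P\<bar> + \<bar>d P\<bar>)"
    using leading_terms_bigo[OF A A', of s "\<lambda>P. H P ^ 3" F "\<lambda>P. K P ^ 3" d] s3 d3 unfolding g_def by blast
  moreover have "(\<lambda>P. \<bar>s P\<bar> + \<bar>d P\<bar>) \<in> O[F](r)" using sr dr by (intro sum_in_bigo(1)) simp_all
  ultimately have gr: "g \<in> O[F](r)" by (rule big_trans)

  have root_part: "(\<lambda>P. (root 3 (f P))\<^sup>2 - (root 3 C * h P)\<^sup>2) \<in> O[F](\<lambda>P. \<theta> P ^ 6)"
    if f: "(\<lambda>P. f P - C * h P ^ 3) \<in> O[F](\<lambda>P. \<bar>h P\<bar> ^ 4 + \<bar>k P\<bar> ^ 5)" and C: "C \<noteq> 0"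
      and hg: "(\<lambda>P. \<bar>h P\<bar> ^ 3) \<in> O[F](g)" and kg: "(\<lambda>P. \<bar>k P\<bar> ^ 3) \<in> O[F](g)"
    for f h k :: "'a \<Rightarrow> real" and C
  proof -
    have h6: "(\<lambda>P. \<bar>h P\<bar> ^ 3) \<in> O[F](\<lambda>P. \<theta> P ^ 6)"
      unfolding \<theta>_pow by (rule big_trans[OF hg gr])
    have "(\<lambda>P. \<bar>k P\<bar> ^ 3) \<in> O[F](\<lambda>P. (\<theta> P ^ 2) ^ 3)"
      unfolding power_mult[symmetric] using big_trans[OF kg gr] by (simp add: \<theta>_pow)
    from bigo_power_cancel[OF this] have "(\<lambda>P. \<bar>k P\<bar>) \<in> O[F](\<lambda>P. \<theta> P ^ 2)" by simp
    from big_power[OF this, of 5] have "(\<lambda>P. \<bar>k P\<bar> ^ 5) \<in> O[F](\<lambda>P. \<theta> P ^ 10)"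
      by (simp add: power_mult[symmetric])
    also have "(\<lambda>P. \<theta> P ^ 10) \<in> O[F](\<lambda>P. \<theta> P ^ 9)" by (rule bigo_power_le[OF \<theta>0]) simp
    finally have k5: "(\<lambda>P. \<bar>k P\<bar> ^ 5) \<in> O[F](\<lambda>P. \<theta> P ^ 9)" .
    define b where "b P = root 3 C * h P" for P
    define m where "m P = \<bar>b P\<bar> + \<theta> P ^ 3" for P
    have C0: "root 3 C \<noteq> 0" using C by simp
    have hm: "(\<lambda>P. \<bar>h P\<bar>) \<in> O[F](m)"
    proof (rule bigo_of_le[where C = "1 / \<bar>root 3 C\<bar>"])
      show "\<bar>\<bar>h P\<bar>\<bar> \<le> 1 / \<bar>root 3 C\<bar> * m P" for P
        using C0 \<theta>_nonneg[of P] by (simp add: m_def b_def abs_mult field_simps)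
    qed (simp add: m_def \<theta>_nonneg)
    have \<theta>m: "(\<lambda>P. \<theta> P ^ 3) \<in> O[F](m)"
      by (rule bigo_of_le[where C = 1]) (simp_all add: m_def \<theta>_nonneg)
    have "(\<lambda>P. \<bar>h P\<bar> ^ 4) \<in> O[F](\<lambda>P. \<theta> P ^ 6 * m P)"
      by (rule bigo_ext[OF big_mult[OF h6 hm]]) (simp add: numeral_eq_Suc del: power2_abs abs_mult_self_eq)
    moreover have "(\<lambda>P. \<bar>k P\<bar> ^ 5) \<in> O[F](\<lambda>P. \<theta> P ^ 6 * m P)"
    proof -
      have "(\<lambda>P. \<theta> P ^ 6 * \<theta> P ^ 3) \<in> O[F](\<lambda>P. \<theta> P ^ 6 * m P)"
        by (rule big_mult[OF big_refl \<theta>m])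
      then show ?thesis using k5 big_trans by (simp add: power_add[symmetric]) blast
    qed
    ultimately have "(\<lambda>P. f P - C * h P ^ 3) \<in> O[F](\<lambda>P. \<theta> P ^ 6 * m P)"
      by (intro big_trans[OF f] sum_in_bigo(1))
    moreover have "b P ^ 3 = C * h P ^ 3" for P by (simp add: b_def power_mult_distrib odd_real_root_pow)
    ultimately have "(\<lambda>P. root 3 (f P) ^ 3 - b P ^ 3) \<in> O[F](\<lambda>P. (\<theta> P ^ 3)\<^sup>2 * (\<bar>b P\<bar> + \<theta> P ^ 3))"
      by (simp add: odd_real_root_pow m_def power_mult[symmetric])
    from bigo_square_diff_of_cube_diff[OF this] show ?thesis
      by (simp add: power_mult[symmetric] \<theta>_nonneg b_def)
  qed
  have e2: "(\<lambda>P. (root 3 (s P))\<^sup>2 - (root 3 A * H P)\<^sup>2) \<in> O[F](r)"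
    using root_part[OF s A Hg Kg] unfolding \<theta>_pow .
  have e3: "(\<lambda>P. (root 3 (d P))\<^sup>2 - (root 3 A' * K P)\<^sup>2) \<in> O[F](r)"
    using root_part[OF d A' Kg Hg] unfolding \<theta>_pow .
  have e1: "(\<lambda>P. U P - (B * (H P)\<^sup>2 + B' * (K P)\<^sup>2)) \<in> O[F](r)"
    by (rule big_trans[OF U])
      (intro sum_in_bigo(1) big_trans[OF Hg gr] big_trans[OF Kg gr])
  have "(\<lambda>P. (U P - (B * (H P)\<^sup>2 + B' * (K P)\<^sup>2)) - B / (root 3 A)\<^sup>2 * ((root 3 (s P))\<^sup>2 - (root 3 A * H P)\<^sup>2)
      - B' / (root 3 A')\<^sup>2 * ((root 3 (d P))\<^sup>2 - (root 3 A' * K P)\<^sup>2)) \<in> O[F](r)"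
    by (rule sum_in_bigo(2)[OF sum_in_bigo(2)[OF e1 bigo_cmult[OF e2]] bigo_cmult[OF e3]])
  moreover have "U P - (B / (root 3 A)\<^sup>2 * (root 3 (s P))\<^sup>2 + B' / (root 3 A')\<^sup>2 * (root 3 (d P))\<^sup>2) =
      (U P - (B * (H P)\<^sup>2 + B' * (K P)\<^sup>2)) - B / (root 3 A)\<^sup>2 * ((root 3 (s P))\<^sup>2 - (root 3 A * H P)\<^sup>2)
      - B' / (root 3 A')\<^sup>2 * ((root 3 (d P))\<^sup>2 - (root 3 A' * K P)\<^sup>2)" for P
  proof -
    have "root 3 A \<noteq> 0" "root 3 A' \<noteq> 0" using A A' by simp_all
    then have "B / (root 3 A)\<^sup>2 * (root 3 A * H P)\<^sup>2 = B * (H P)\<^sup>2"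
      "B' / (root 3 A')\<^sup>2 * (root 3 A' * K P)\<^sup>2 = B' * (K P)\<^sup>2"
      by (simp_all add: power_mult_distrib)
    then show ?thesis by (simp add: right_diff_distrib)
  qed
  ultimately show ?thesis by (rule bigo_ext)
qed

section \<open>Expansions in characteristic coordinates\<close>

context semilinear_flow
begin

text \<open>The two combinations of the time and space increments that vanish, to first order, along the
characteristic directions at \<open>P\<close>.\<close>

definition back_char :: "real \<Rightarrow> real \<Rightarrow> real \<Rightarrow> real \<Rightarrow> real" where
  "back_char X0 Y0 X Y = c (u X0 Y0) * (t X Y - t X0 Y0) + (x X Y - x X0 Y0)"

definition fwd_char :: "real \<Rightarrow> real \<Rightarrow> real \<Rightarrow> real \<Rightarrow> real" where
  "fwd_char X0 Y0 X Y = c (u X0 Y0) * (t X Y - t X0 Y0) - (x X Y - x X0 Y0)"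

abbreviation radius :: "real \<Rightarrow> real \<Rightarrow> real \<times> real \<Rightarrow> real" where
  "radius X0 Y0 P \<equiv> \<bar>t @@ P - t X0 Y0\<bar> + \<bar>x @@ P - x X0 Y0\<bar>"

lemma c_nonzero [simp]: "c v \<noteq> 0"
  using c_pos[of v] by simp

lemma back_char_DERIV_X:
  "((\<lambda>s. back_char X0 Y0 s Y) has_real_derivative
    (1 + cos (w X Y)) * (p X Y * (1 / 4 * (c (u X0 Y0) * (1 / c (u X Y)) + 1)))) (at X)"
  unfolding back_char_def
  by (rule derivative_eq_intros x_X t_X refl)+ (simp add: field_simps)

lemma back_char_DERIV_Y:
  "((\<lambda>s. back_char X0 Y0 X s) has_real_derivative
    (c (u X0 Y0) - c (u X Y)) * (1 + cos (z X Y)) * (q X Y / (4 * c (u X Y)))) (at Y)"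
  unfolding back_char_def
  by (rule derivative_eq_intros x_Y t_Y refl)+ (simp add: field_simps)

lemma fwd_char_DERIV_X:
  "((\<lambda>s. fwd_char X0 Y0 s Y) has_real_derivative
    (1 + cos (w X Y)) * (p X Y * (1 / 4 * (c (u X0 Y0) * (1 / c (u X Y)) - 1)))) (at X)"
  unfolding fwd_char_def
  by (rule derivative_eq_intros x_X t_X refl)+ (simp add: field_simps)

lemma fwd_char_DERIV_Y:
  "((\<lambda>s. fwd_char X0 Y0 X s) has_real_derivative
    (c (u X0 Y0) + c (u X Y)) * (1 + cos (z X Y)) * (q X Y / (4 * c (u X Y)))) (at Y)"
  unfolding fwd_char_def
  by (rule derivative_eq_intros x_Y t_Y refl)+ (simp add: field_simps)

lemma dX_u: "dX u X Y = sin (w X Y) / (4 * c (u X Y)) * p X Y"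
  unfolding dX_def by (rule DERIV_imp_deriv[OF u_X])

lemma dY_u: "dY u X Y = sin (z X Y) / (4 * c (u X Y)) * q X Y"
  unfolding dY_def by (rule DERIV_imp_deriv[OF u_Y])

lemma dY_w: "dY w X Y = deriv c (u X Y) / (8 * (c (u X Y))\<^sup>2) * (cos (z X Y) - cos (w X Y)) * q X Y"
  unfolding dY_def by (rule DERIV_imp_deriv[OF w_Y])

lemma dX_z: "dX z X Y = deriv c (u X Y) / (8 * (c (u X Y))\<^sup>2) * (cos (w X Y) - cos (z X Y)) * p X Y"
  unfolding dX_def by (rule DERIV_imp_deriv[OF z_X])

text \<open>Where \<open>w = pi\<close>, the derivative \<open>u\<^sub>X\<close> vanishes, so \<open>c(u)\<close> is constant to first order on the horizontal
line.\<close>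

lemma inverse_c_bigo:
  assumes pi: "angle_pi (w X0 Y0)"
  shows "(\<lambda>X. 1 / c (u X Y0) - 1 / c (u X0 Y0)) \<in> O[nhds X0](\<lambda>X. (X - X0)\<^sup>2)"
proof -
  have "sin (w X0 Y0) = 0" using sin_rcong[OF pi] by simp
  then have u2: "(\<lambda>X. u X Y0 - u X0 Y0) \<in> O[nhds X0](\<lambda>X. (X - X0)\<^sup>2)"
    by (intro smooth_plane_critical smooth_u) (simp add: dX_u)
  have "DERIV (\<lambda>v. 1 / c v) v :> - deriv c v / (c v)\<^sup>2" for v
    by (rule derivative_eq_intros c_DERIV refl c_nonzero)+ (simp add: power2_eq_square)
  then have "(\<lambda>v. 1 / c v - 1 / c (u X0 Y0)) \<in> O[nhds (u X0 Y0)](\<lambda>v. v - u X0 Y0)" by (rule DERIV_bigo)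
  moreover have "((\<lambda>X. u X Y0) \<longlongrightarrow> u X0 Y0) (nhds X0)"
    using isCont_tendsto_nhds[OF DERIV_isCont[OF u_X]] by simp
  ultimately have "(\<lambda>X. 1 / c (u X Y0) - 1 / c (u X0 Y0)) \<in> O[nhds X0](\<lambda>X. u X Y0 - u X0 Y0)"
    by (rule landau_o.big.compose)
  from big_trans[OF this u2] show ?thesis .
qed

lemma inverse_c_two_term:
  assumes pi: "angle_pi (w X0 Y0)"
  shows "two_term X0 0 (1 / c (u X0 Y0)) (\<lambda>X. 1 / c (u X Y0))"
  using inverse_c_bigo[OF pi] by (intro two_termI[where b = 0]) (simp add: numeral_2_eq_2)

text \<open>The derivatives of the three functions along the horizontal line contain \<open>1 + cos w\<close>, \<open>sin w\<close> and
\<open>(1 + cos w) (c(u0) - c(u))\<close>, of orders \<open>2n\<close>, \<open>n\<close> and \<open>2n + 2\<close>.\<close>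

lemma horizontal_expansion:
  assumes pi: "angle_pi (w X0 Y0)" and w: "two_term X0 n a (\<lambda>X. w X Y0 - w X0 Y0)" and n: "0 < n"
  shows "two_term X0 (2 * n + 1) (a\<^sup>2 * p X0 Y0 / (4 * (2 * n + 1))) (\<lambda>X. back_char X0 Y0 X Y0)"
    and "two_term X0 (n + 1) (- (a * p X0 Y0 / (4 * c (u X0 Y0) * (n + 1)))) (\<lambda>X. u X Y0 - u X0 Y0)"
    and "(\<lambda>X. fwd_char X0 Y0 X Y0) \<in> O[nhds X0](\<lambda>X. (X - X0) ^ (2 * n + 3))"
proof -
  note inv = inverse_c_two_term[OF pi]
  note cosw = two_term_one_plus_cos_near_pi[OF w n pi]
  note sinw = two_term_sin_near_pi[OF w n pi]
  note p0 = smooth_plane_two_term_0[OF smooth_p, of X0 Y0]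
  let ?c = "c (u X0 Y0)"
  have "two_term X0 (2 * n + (0 + 0)) (a\<^sup>2 / 2 * (p X0 Y0 * (1 / 4 * (?c * (1 / ?c) + 1))))
      (\<lambda>X. (1 + cos (w X Y0)) * (p X Y0 * (1 / 4 * (?c * (1 / c (u X Y0)) + 1))))"
    by (intro two_term_mult[OF cosw] two_term_mult[OF p0] two_term_cmult two_term_add inv two_term_const)
  then have "two_term X0 (2 * n) (a\<^sup>2 * p X0 Y0 / 4)
      (\<lambda>X. (1 + cos (w X Y0)) * (p X Y0 * (1 / 4 * (?c * (1 / c (u X Y0)) + 1))))" by simp
  from two_term_integral[OF back_char_DERIV_X this]
  show "two_term X0 (2 * n + 1) (a\<^sup>2 * p X0 Y0 / (4 * (2 * n + 1))) (\<lambda>X. back_char X0 Y0 X Y0)"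
    by (simp add: back_char_def[of X0 Y0 X0 Y0] algebra_simps)
  have "two_term X0 (n + (0 + 0)) (- a * (1 / 4 * (1 / ?c) * p X0 Y0))
      (\<lambda>X. sin (w X Y0) * (1 / 4 * (1 / c (u X Y0)) * p X Y0))"
    by (intro two_term_mult[OF sinw] two_term_mult p0 two_term_cmult inv)
  moreover have "sin (w X Y0) * (1 / 4 * (1 / c (u X Y0)) * p X Y0) = sin (w X Y0) / (4 * c (u X Y0)) * p X Y0" for X
    by simp
  ultimately have "two_term X0 n (- a * (1 / 4 * (1 / ?c) * p X0 Y0)) (\<lambda>X. sin (w X Y0) / (4 * c (u X Y0)) * p X Y0)"
    by simp
  from two_term_integral[OF u_X this]
  show "two_term X0 (n + 1) (- (a * p X0 Y0 / (4 * c (u X0 Y0) * (n + 1)))) (\<lambda>X. u X Y0 - u X0 Y0)"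
    by (simp add: mult_ac)
  from big_mult[OF two_term_bigo[OF cosw] big_mult[OF two_term_bigo[OF p0]
      bigo_cmult[OF bigo_cmult[OF inverse_c_bigo[OF pi], of ?c], of "1 / 4"]]]
  have "(\<lambda>X. (1 + cos (w X Y0)) * (p X Y0 * (1 / 4 * (?c * (1 / c (u X Y0) - 1 / ?c)))))
      \<in> O[nhds X0](\<lambda>X. (X - X0) ^ (2 * n + 2))" by (simp only: power_add power_0 mult_1_left)
  then have "(\<lambda>X. (1 + cos (w X Y0)) * (p X Y0 * (1 / 4 * (?c * (1 / c (u X Y0)) - 1))))
      \<in> O[nhds X0](\<lambda>X. (X - X0) ^ (2 * n + 2))" by (simp add: right_diff_distrib)
  from mvt_bigo[OF fwd_char_DERIV_X this]
  show "(\<lambda>X. fwd_char X0 Y0 X Y0) \<in> O[nhds X0](\<lambda>X. (X - X0) ^ (2 * n + 3))"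
    by (simp add: fwd_char_def[of X0 Y0 X0 Y0] numeral_3_eq_3)
qed

lemma c_u_bigo:
  "(\<lambda>P. c (u X0 Y0) - c (u @@ P)) \<in> O[nhds (X0, Y0)](\<lambda>P. u @@ P - u X0 Y0)"
proof -
  have "(\<lambda>v. c v - c (u X0 Y0)) \<in> O[nhds (u X0 Y0)](\<lambda>v. v - u X0 Y0)" by (rule DERIV_bigo[OF c_DERIV])
  from landau_o.big.compose[OF this smooth_plane_tendsto[OF smooth_u, of X0 Y0]]
  have "(\<lambda>P. - (c (u @@ P) - c (u X0 Y0))) \<in> O[nhds (X0, Y0)](\<lambda>P. u @@ P - u X0 Y0)"
    unfolding landau_o.big.uminus_in_iff .
  then show ?thesis by simp
qed

lemma q_over_c_bigo_1: "(\<lambda>P. q @@ P / (4 * c (u @@ P))) \<in> O[nhds (X0, Y0)](\<lambda>_. 1)"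
proof (rule tendsto_imp_bigo_1)
  have "isCont c v" for v using c_DERIV by (rule DERIV_isCont)
  then have "((\<lambda>P. c (u @@ P)) \<longlongrightarrow> c (u X0 Y0)) (nhds (X0, Y0))"
    by (rule isCont_tendsto_compose[OF _ smooth_plane_tendsto[OF smooth_u]])
  then show "((\<lambda>P. q @@ P / (4 * c (u @@ P))) \<longlongrightarrow> q X0 Y0 / (4 * c (u X0 Y0))) (nhds (X0, Y0))"
    by (intro tendsto_divide[OF smooth_plane_tendsto[OF smooth_q] tendsto_mult[OF tendsto_const]]) simp_all
qed

text \<open>The derivative is \<open>(c(u0) - c(u)) t\<^sub>Y\<close>; its two small factors are estimated separately, as the second
one is small only if \<open>z = pi\<close> at \<open>P\<close>.\<close>

lemma back_char_vertical:
  assumes u: "(\<lambda>P. u @@ P - u X0 Y0) \<in> O[nhds (X0, Y0)](\<lambda>P. g1 \<bar>fst P - X0\<bar> \<bar>snd P - Y0\<bar>)"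
    and z: "(\<lambda>P. 1 + cos (z @@ P)) \<in> O[nhds (X0, Y0)](\<lambda>P. g2 \<bar>fst P - X0\<bar> \<bar>snd P - Y0\<bar>)"
    and g1: "\<And>a b b'. 0 \<le> a \<Longrightarrow> 0 \<le> b \<Longrightarrow> b \<le> b' \<Longrightarrow> 0 \<le> g1 a b \<and> g1 a b \<le> g1 a b'"
    and g2: "\<And>a b b'. 0 \<le> a \<Longrightarrow> 0 \<le> b \<Longrightarrow> b \<le> b' \<Longrightarrow> 0 \<le> g2 a b \<and> g2 a b \<le> g2 a b'"
  shows "(\<lambda>P. back_char X0 Y0 @@ P - back_char X0 Y0 (fst P) Y0) \<in> O[nhds (X0, Y0)](\<lambda>P.
      g1 \<bar>fst P - X0\<bar> \<bar>snd P - Y0\<bar> * g2 \<bar>fst P - X0\<bar> \<bar>snd P - Y0\<bar> * \<bar>snd P - Y0\<bar>)"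
proof (rule mvt_bigo_Y[OF back_char_DERIV_Y, where g = "\<lambda>a b. g1 a b * g2 a b"])
  show "(\<lambda>P. (c (u X0 Y0) - c (u @@ P)) * (1 + cos (z @@ P)) *
        (q @@ P / (4 * c (u @@ P))))
      \<in> O[nhds (X0, Y0)](\<lambda>P. g1 \<bar>fst P - X0\<bar> \<bar>snd P - Y0\<bar> * g2 \<bar>fst P - X0\<bar> \<bar>snd P - Y0\<bar>)"
    using big_mult[OF big_mult[OF big_trans[OF c_u_bigo u] z] q_over_c_bigo_1] by simp
  show "0 \<le> g1 a b * g2 a b \<and> g1 a b * g2 a b \<le> g1 a b' * g2 a b'" if "0 \<le> a" "0 \<le> b" "b \<le> b'" for a b b'
    using g1[OF that] g2[OF that] by (auto intro!: mult_mono)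
qed

lemma fwd_char_vertical:
  "(\<lambda>P. fwd_char X0 Y0 @@ P - fwd_char X0 Y0 (fst P) Y0
      - (1 + cos (z X0 Y0)) * q X0 Y0 / 2 * (snd P - Y0))
    \<in> O[nhds (X0, Y0)](\<lambda>P. (\<bar>fst P - X0\<bar> + \<bar>snd P - Y0\<bar>) * \<bar>snd P - Y0\<bar>)"
proof -
  \<comment> \<open>The vertical derivative of \<open>fwd_char\<close> and its value at \<open>P\<close>.\<close>
  define E where "E P = (c (u X0 Y0) + c (u @@ P)) * (1 + cos (z @@ P)) *
    (q @@ P / (4 * c (u @@ P)))" for P
  define D where "D = (1 + cos (z X0 Y0)) * q X0 Y0 / 2"
  have ED: "E (X0, Y0) = D" by (simp add: E_def D_def)
  have "c differentiable (at v)" for v using c_DERIV by (auto simp: real_differentiable_def)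
  then have cu: "(\<lambda>P. c (u @@ P)) differentiable (at P0)" for P0
    using differentiable_chain_at[OF smooth_plane_differentiable[OF smooth_u], unfolded o_def] by blast
  have "cos differentiable (at v)" for v :: real
    unfolding real_differentiable_def using DERIV_cos by blast
  then have cosz: "(\<lambda>P. cos (z @@ P)) differentiable (at P0)" for P0
    using differentiable_chain_at[OF smooth_plane_differentiable[OF smooth_z], unfolded o_def] by blast
  have "E differentiable (at (X0, Y0))" unfolding E_def
    by (intro differentiable_mult differentiable_add differentiable_divide differentiable_const
        cu cosz smooth_plane_differentiable smooth_q) simp
  from plane_differentiable_imp_bigo[OF this]
  have 1: "(\<lambda>P. E (fst P, snd P) - D) \<in> O[nhds (X0, Y0)](\<lambda>P. \<bar>fst P - X0\<bar> + \<bar>snd P - Y0\<bar>)" by (simp add: ED)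
  have 2: "DERIV (\<lambda>s. fwd_char X0 Y0 X s - D * (s - Y0)) Y :> E (X, Y) - D" for X Y
    by (rule derivative_eq_intros fwd_char_DERIV_Y refl)+ (simp add: E_def)
  from mvt_bigo_Y[OF 2, where g = "\<lambda>a b. a + b", OF 1] show ?thesis by (simp add: D_def algebra_simps)
qed

lemma char_bigo_radius:
  shows "(\<lambda>P. back_char X0 Y0 @@ P) \<in> O[F](radius X0 Y0)"
    and "(\<lambda>P. fwd_char X0 Y0 @@ P) \<in> O[F](radius X0 Y0)"
proof -
  have t: "(\<lambda>P. t @@ P - t X0 Y0) \<in> O[F](radius X0 Y0)" and x: "(\<lambda>P. x @@ P - x X0 Y0) \<in> O[F](radius X0 Y0)"
    by (rule bigo_of_le[where C = 1]; simp)+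
  show "(\<lambda>P. back_char X0 Y0 @@ P) \<in> O[F](radius X0 Y0)" unfolding back_char_def
    by (rule sum_in_bigo(1)[OF bigo_cmult[OF t] x])
  show "(\<lambda>P. fwd_char X0 Y0 @@ P) \<in> O[F](radius X0 Y0)" unfolding fwd_char_def
    by (rule sum_in_bigo(2)[OF bigo_cmult[OF t] x])
qed

lemma radius_tendsto_0:
  "((radius X0 Y0) \<longlongrightarrow> 0) (nhds (X0, Y0))"
proof -
  have "((radius X0 Y0)
    \<longlongrightarrow> \<bar>t X0 Y0 - t X0 Y0\<bar> + \<bar>x X0 Y0 - x X0 Y0\<bar>) (nhds (X0, Y0))"
    by (intro tendsto_add tendsto_rabs tendsto_diff tendsto_const jointly_continuous_tendsto cont_t cont_x)
  then show ?thesis by simp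
qed

lemma one_sided_expansion:
  assumes pi: "angle_pi (w X0 Y0)" and w: "two_term X0 n a (\<lambda>X. w X Y0 - w X0 Y0)" and n: "0 < n"
  shows "(\<lambda>P. u @@ P - u (fst P) Y0) \<in> O[nhds (X0, Y0)](\<lambda>P. \<bar>snd P - Y0\<bar>)"
    and "(\<lambda>P. back_char X0 Y0 @@ P - back_char X0 Y0 (fst P) Y0) \<in> O[nhds (X0, Y0)](\<lambda>P.
      (\<bar>snd P - Y0\<bar> + \<bar>fst P - X0\<bar> ^ (n + 1)) * \<bar>snd P - Y0\<bar>)"
    and "(\<lambda>P. fwd_char X0 Y0 @@ P - (1 + cos (z X0 Y0)) * q X0 Y0 / 2 * (snd P - Y0))
      \<in> O[nhds (X0, Y0)](\<lambda>P. (\<bar>fst P - X0\<bar> + \<bar>snd P - Y0\<bar>) * \<bar>snd P - Y0\<bar> + \<bar>fst P - X0\<bar> ^ (2 * n + 3))"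
proof -
  let ?h = "\<lambda>P :: real \<times> real. \<bar>fst P - X0\<bar>" and ?k = "\<lambda>P :: real \<times> real. \<bar>snd P - Y0\<bar>"
  show u1: "(\<lambda>P. u @@ P - u (fst P) Y0) \<in> O[nhds (X0, Y0)](\<lambda>P. ?k P)"
    by (rule smooth_plane_lipschitz_Y[OF smooth_u])
  have u2: "(\<lambda>P. u (fst P) Y0 - u X0 Y0) \<in> O[nhds (X0, Y0)](\<lambda>P. ?h P ^ (n + 1))"
    unfolding abs_bigo_iff_power by (rule bigo_fst[OF two_term_bigo[OF horizontal_expansion(2)[OF assms]]])
  have u: "(\<lambda>P. u @@ P - u X0 Y0) \<in> O[nhds (X0, Y0)](\<lambda>P. ?k P + ?h P ^ (n + 1))"
    by (rule bigo_diff_add[OF u1 u2]) simp_all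
  have z: "(\<lambda>P. 1 + cos (z @@ P)) \<in> O[nhds (X0, Y0)](\<lambda>P. 1)"
    by (rule tendsto_imp_bigo_1[OF tendsto_add[OF tendsto_const tendsto_cos[OF smooth_plane_tendsto[OF smooth_z]]]])
  from back_char_vertical[where ?g1.0 = "\<lambda>a b. b + a ^ (n + 1)" and ?g2.0 = "\<lambda>_ _. 1", OF u z]
  show "(\<lambda>P. back_char X0 Y0 @@ P - back_char X0 Y0 (fst P) Y0) \<in> O[nhds (X0, Y0)](\<lambda>P. (?k P + ?h P ^ (n + 1)) * ?k P)"
    by simp
  have "(\<lambda>P. fwd_char X0 Y0 (fst P) Y0) \<in> O[nhds (X0, Y0)](\<lambda>P. ?h P ^ (2 * n + 3))"
    unfolding abs_bigo_iff_power by (rule bigo_fst[OF horizontal_expansion(3)[OF assms]])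
  from bigo_add[OF fwd_char_vertical this]
  show "(\<lambda>P. fwd_char X0 Y0 @@ P - (1 + cos (z X0 Y0)) * q X0 Y0 / 2 * (snd P - Y0))
      \<in> O[nhds (X0, Y0)](\<lambda>P. (?h P + ?k P) * ?k P + ?h P ^ (2 * n + 3))" by simp
qed

section \<open>Expansions of the solution at singular points\<close>

lemma type1_expansion:
  assumes pi: "angle_pi (w X0 Y0)" and wX: "dX w X0 Y0 \<noteq> 0" and z: "cos (z X0 Y0) \<noteq> - 1"
  shows "\<exists>a b1 b2. a \<noteq> 0 \<and>
    (\<lambda>P. u @@ P - (u X0 Y0 - a * (root 3 (back_char X0 Y0 @@ P))\<^sup>2
        + b1 * (x @@ P - x X0 Y0) + b2 * (t @@ P - t X0 Y0)))
    \<in> O[nhds (X0, Y0)](\<lambda>P. radius X0 Y0 P powr (4 / 3))"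
proof -
  let ?h = "\<lambda>P :: real \<times> real. \<bar>fst P - X0\<bar>" and ?k = "\<lambda>P :: real \<times> real. \<bar>snd P - Y0\<bar>"
  have w1: "two_term X0 1 (dX w X0 Y0) (\<lambda>X. w X Y0 - w X0 Y0)"
    using smooth_plane_two_term[OF smooth_w, of 1] by simp
  have "1 + 1 = (2 :: nat)" "2 * 1 + 3 = (5 :: nat)" by simp_all
  note hor = horizontal_expansion[OF pi w1 zero_less_one] and one = one_sided_expansion[OF pi w1 zero_less_one, unfolded this]
  \<comment> \<open>The leading coefficients of \<open>horizontal_expansion\<close> for \<open>n = 1\<close>, and that of \<open>fwd_char_vertical\<close>.\<close>
  define A where "A = (dX w X0 Y0)\<^sup>2 * p X0 Y0 / 12"
  define B where "B = - (dX w X0 Y0 * p X0 Y0 / (8 * c (u X0 Y0)))"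
  define D where "D = (1 + cos (z X0 Y0)) * q X0 Y0 / 2"
  have A: "A \<noteq> 0" and B: "B \<noteq> 0" using wX p_pos[of X0 Y0] by (simp_all add: A_def B_def)
  have D: "D \<noteq> 0" using z q_pos[of X0 Y0] by (simp add: D_def add_eq_0_iff)
  have "two_term X0 3 A (\<lambda>X. back_char X0 Y0 X Y0)"
    using hor(1) by (simp add: A_def numeral_3_eq_3)
  then obtain G where "(\<lambda>X. back_char X0 Y0 X Y0 - (A * (X - X0) ^ 3 + G * (X - X0) ^ 4)) \<in> O[nhds X0](\<lambda>X. (X - X0) ^ 5)"
    by (auto simp: two_term_def)
  from bigo_fst[OF this]
  have s1: "(\<lambda>P. back_char X0 Y0 (fst P) Y0 - (A * (fst P - X0) ^ 3 + G * (fst P - X0) ^ 4)) \<in> O[nhds (X0, Y0)](\<lambda>P. ?h P ^ 5)"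
    unfolding abs_bigo_iff_power .
  have "two_term X0 2 B (\<lambda>X. u X Y0 - u X0 Y0)"
    using hor(2) by (simp add: B_def numeral_2_eq_2)
  then obtain \<gamma> where "(\<lambda>X. u X Y0 - u X0 Y0 - (B * (X - X0) ^ 2 + \<gamma> * (X - X0) ^ 3)) \<in> O[nhds X0](\<lambda>X. (X - X0) ^ 4)"
    by (auto simp: two_term_def)
  from bigo_fst[OF this]
  have U1: "(\<lambda>P. u (fst P) Y0 - u X0 Y0 - (B * (fst P - X0) ^ 2 + \<gamma> * (fst P - X0) ^ 3)) \<in> O[nhds (X0, Y0)](\<lambda>P. ?h P ^ 4)"
    unfolding abs_bigo_iff_power .
  define \<alpha> where "\<alpha> = dY u X0 Y0"
  have dU: "DERIV (\<lambda>s. u X s - \<alpha> * s) Y :> dY u X Y - \<alpha>" for X Y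
    by (rule derivative_eq_intros smooth_planeD(5)[OF smooth_u] refl)+ simp
  have U2: "(\<lambda>P. (u @@ P - \<alpha> * snd P) - (u (fst P) Y0 - \<alpha> * Y0)) \<in>
      O[nhds (X0, Y0)](\<lambda>P. (?h P + ?k P) * ?k P)"
    by (rule mvt_bigo_Y[OF dU, where g = "\<lambda>a b. a + b"])
      (use smooth_plane_lipschitz[OF smooth_planeD(2)[OF smooth_u]] in \<open>auto simp: \<alpha>_def\<close>)

  have "\<exists>b1 b2. (\<lambda>P. (u @@ P - u X0 Y0) - (B / (root 3 A)\<^sup>2 * (root 3 (back_char X0 Y0 @@ P))\<^sup>2
      + b1 * back_char X0 Y0 @@ P + b2 * fwd_char X0 Y0 @@ P))
      \<in> O[nhds (X0, Y0)](\<lambda>P. radius X0 Y0 P powr (4 / 3))"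
  proof (rule type1_asymptotics[where H = "\<lambda>P. fst P - X0" and K = "\<lambda>P. snd P - Y0" and D = D and G = G
        and \<alpha> = \<alpha> and \<gamma> = \<gamma>, OF tendsto_fst_diff_0 tendsto_snd_diff_0 radius_tendsto_0 _ A D])
    show "(\<lambda>P. back_char X0 Y0 @@ P - (A * (fst P - X0) ^ 3 + G * (fst P - X0) ^ 4)) \<in> O[nhds (X0, Y0)](\<lambda>P.
        (?k P + (?h P)\<^sup>2) * ?k P + ?h P ^ 5)"
      by (rule bigo_diff_add[OF one(2) s1]) simp_all
    show "(\<lambda>P. fwd_char X0 Y0 @@ P - D * (snd P - Y0)) \<in> O[nhds (X0, Y0)](\<lambda>P. (?h P + ?k P) * ?k P + ?h P ^ 5)"
      using one(3) by (simp add: D_def)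
    show "(\<lambda>P. u @@ P - u X0 Y0 - (\<alpha> * (snd P - Y0) + B * (fst P - X0)\<^sup>2 + \<gamma> * (fst P - X0) ^ 3))
       \<in> O[nhds (X0, Y0)](\<lambda>P. (?h P + ?k P) * ?k P + ?h P ^ 4)"
      by (rule bigo_ext[OF bigo_add[OF U2 U1]]) (simp, simp, simp add: algebra_simps)
  qed (simp_all add: char_bigo_radius)
  then obtain b1 b2 where b: "(\<lambda>P. (u @@ P - u X0 Y0) - (B / (root 3 A)\<^sup>2 * (root 3 (back_char X0 Y0 @@ P))\<^sup>2
      + b1 * back_char X0 Y0 @@ P + b2 * fwd_char X0 Y0 @@ P))
      \<in> O[nhds (X0, Y0)](\<lambda>P. radius X0 Y0 P powr (4 / 3))" by blast
  show ?thesis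
  proof (rule exI[of _ "- (B / (root 3 A)\<^sup>2)"], rule exI[of _ "b1 - b2"], rule exI[of _ "c (u X0 Y0) * (b1 + b2)"], rule conjI)
    show "- (B / (root 3 A)\<^sup>2) \<noteq> 0" using A B by simp
    \<comment> \<open>The two combinations are independent, so they express the linear terms in \<open>x - x0\<close> and \<open>t - t0\<close>.\<close>
    have lin: "b1 * back_char X0 Y0 X Y + b2 * fwd_char X0 Y0 X Y
        = (b1 - b2) * (x X Y - x X0 Y0) + c (u X0 Y0) * (b1 + b2) * (t X Y - t X0 Y0)" for X Y
      by (simp add: back_char_def fwd_char_def algebra_simps)
    show "(\<lambda>P. u @@ P - (u X0 Y0 - - (B / (root 3 A)\<^sup>2) * (root 3 (back_char X0 Y0 @@ P))\<^sup>2
        + (b1 - b2) * (x @@ P - x X0 Y0) + c (u X0 Y0) * (b1 + b2) * (t @@ P - t X0 Y0)))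
      \<in> O[nhds (X0, Y0)](\<lambda>P. radius X0 Y0 P powr (4 / 3))"
      by (rule bigo_ext[OF b]) (simp add: lin add.assoc)
  qed
qed

lemma type2_expansion:
  assumes pi: "angle_pi (w X0 Y0)" and wX: "dX w X0 Y0 = 0" and wXX: "dX (dX w) X0 Y0 \<noteq> 0" and z: "cos (z X0 Y0) \<noteq> - 1"
  shows "\<exists>a. a \<noteq> 0 \<and> (\<lambda>P. u @@ P - (u X0 Y0 + a * root 5 (back_char X0 Y0 @@ P) ^ 3))
    \<in> O[nhds (X0, Y0)](\<lambda>P. radius X0 Y0 P powr (4 / 5))"
proof -
  let ?h = "\<lambda>P :: real \<times> real. \<bar>fst P - X0\<bar>" and ?k = "\<lambda>P :: real \<times> real. \<bar>snd P - Y0\<bar>"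
  define a where "a = dX (dX w) X0 Y0 / 2"
  have "(dX ^^ m) w X0 Y0 = 0" if "0 < m" "m < 2" for m using that wX by (cases "m = 1") auto
  then have w2: "two_term X0 2 a (\<lambda>X. w X Y0 - w X0 Y0)"
    using smooth_plane_two_term[OF smooth_w, of 2 X0 Y0] by (simp add: a_def numeral_2_eq_2)
  have a0: "a \<noteq> 0" using wXX by (simp add: a_def)
  have "2 + 1 = (3 :: nat)" "2 * 2 + 3 = (7 :: nat)" by simp_all
  note hor = horizontal_expansion[OF pi w2 pos2] and one = one_sided_expansion[OF pi w2 pos2, unfolded this]
  \<comment> \<open>The same coefficients for \<open>n = 2\<close>.\<close>
  define A where "A = a\<^sup>2 * p X0 Y0 / 20"
  define B where "B = - (a * p X0 Y0 / (12 * c (u X0 Y0)))"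
  define D where "D = (1 + cos (z X0 Y0)) * q X0 Y0 / 2"
  have A: "A \<noteq> 0" and B: "B \<noteq> 0" using a0 p_pos[of X0 Y0] by (simp_all add: A_def B_def)
  have D: "D \<noteq> 0" using z q_pos[of X0 Y0] by (simp add: D_def add_eq_0_iff)
  have "two_term X0 5 A (\<lambda>X. back_char X0 Y0 X Y0)" using hor(1) by (simp add: A_def)
  from bigo_fst[OF two_term_leading[OF this]]
  have s1: "(\<lambda>P. back_char X0 Y0 (fst P) Y0 - A * (fst P - X0) ^ 5) \<in> O[nhds (X0, Y0)](\<lambda>P. ?h P ^ 6)"
    unfolding abs_bigo_iff_power by simp
  have "two_term X0 3 B (\<lambda>X. u X Y0 - u X0 Y0)" using hor(2) by (simp add: B_def)
  from bigo_fst[OF two_term_leading[OF this]]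
  have U1: "(\<lambda>P. u (fst P) Y0 - u X0 Y0 - B * (fst P - X0) ^ 3) \<in> O[nhds (X0, Y0)](\<lambda>P. ?h P ^ 4)"
    unfolding abs_bigo_iff_power by simp
  have "(\<lambda>P. (u @@ P - u X0 Y0) - B / root 5 A ^ 3 * root 5 (back_char X0 Y0 @@ P) ^ 3)
      \<in> O[nhds (X0, Y0)](\<lambda>P. radius X0 Y0 P powr (4 / 5))"
  proof (rule type2_asymptotics[where H = "\<lambda>P. fst P - X0" and K = "\<lambda>P. snd P - Y0" and D = D,
        OF tendsto_fst_diff_0 tendsto_snd_diff_0 radius_tendsto_0 _ A D])
    show "(\<lambda>P. back_char X0 Y0 @@ P - A * (fst P - X0) ^ 5) \<in> O[nhds (X0, Y0)](\<lambda>P. (?k P + ?h P ^ 3) * ?k P + ?h P ^ 6)"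
      by (rule bigo_diff_add[OF one(2) s1]) simp_all
    show "(\<lambda>P. fwd_char X0 Y0 @@ P - D * (snd P - Y0)) \<in> O[nhds (X0, Y0)](\<lambda>P. (?h P + ?k P) * ?k P + ?h P ^ 7)"
      using one(3) by (simp add: D_def)
    show "(\<lambda>P. u @@ P - u X0 Y0 - B * (fst P - X0) ^ 3) \<in> O[nhds (X0, Y0)](\<lambda>P. ?k P + ?h P ^ 4)"
      by (rule bigo_ext[OF bigo_add[OF one(1) U1]]) simp_all
  qed (simp_all add: char_bigo_radius)
  then show ?thesis
    by (intro exI[of _ "B / root 5 A ^ 3"] conjI) (use A B in \<open>simp_all add: diff_diff_eq\<close>)
qed

lemma u_quadratic:
  assumes w: "sin (w X0 Y0) = 0" and z: "sin (z X0 Y0) = 0"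
  shows "(\<lambda>P. u @@ P - u X0 Y0) \<in> O[nhds (X0, Y0)](\<lambda>P. \<bar>fst P - X0\<bar>\<^sup>2 + \<bar>snd P - Y0\<bar>\<^sup>2)"
proof -
  let ?h = "\<lambda>P :: real \<times> real. \<bar>fst P - X0\<bar>" and ?k = "\<lambda>P :: real \<times> real. \<bar>snd P - Y0\<bar>"
  define G where "G P = (?h P)\<^sup>2 + (?k P)\<^sup>2" for P
  have "dX u X0 Y0 = 0" "dY u X0 Y0 = 0" using w z by (simp_all add: dX_u dY_u)
  then have "dX (\<lambda>X Y. u Y X) Y0 X0 = 0" by (simp add: dX_swap[of u])
  from smooth_plane_critical[OF smooth_plane_swap[OF smooth_u] this]
  have "(\<lambda>Y. u X0 Y - u X0 Y0) \<in> O[nhds Y0](\<lambda>Y. (Y - Y0)\<^sup>2)" .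
  from bigo_snd[OF this] have 1: "(\<lambda>P. u X0 (snd P) - u X0 Y0) \<in> O[nhds (X0, Y0)](\<lambda>P. (?k P)\<^sup>2)"
    unfolding abs_bigo_iff_power .
  have 2: "(\<lambda>P. u @@ P - u X0 (snd P)) \<in> O[nhds (X0, Y0)](\<lambda>P. (?h P + ?k P) * ?h P)"
    by (rule mvt_bigo_X[OF smooth_planeD(4)[OF smooth_u], where g = "\<lambda>a b. a + b"])
      (use smooth_plane_lipschitz[OF smooth_planeD(1)[OF smooth_u], of X0 Y0] \<open>dX u X0 Y0 = 0\<close> in auto)
  have "(\<lambda>P. (?k P)\<^sup>2) \<in> O[nhds (X0, Y0)](G)" by (rule bigo_of_le[where C = 1]) (simp_all add: G_def)
  moreover have "(\<lambda>P. (?h P + ?k P) * ?h P) \<in> O[nhds (X0, Y0)](G)"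
  proof (rule bigo_of_le[where C = 2])
    fix P :: "real \<times> real"
    have "(a + b) * a \<le> 2 * (a\<^sup>2 + b\<^sup>2)" for a b :: real
    proof -
      have "2 * (a\<^sup>2 + b\<^sup>2) = (a + b) * a + ((a - b)\<^sup>2 + a\<^sup>2 + 3 * b\<^sup>2) / 2"
        by (simp add: power2_eq_square field_simps)
      then show ?thesis by simp
    qed
    from this[of "?h P" "?k P"]
    show "\<bar>(?h P + ?k P) * ?h P\<bar> \<le> 2 * G P"
      unfolding G_def by (simp add: abs_mult)
  qed (simp add: G_def)
  ultimately show ?thesis
    using sum_in_bigo(1)[OF big_trans[OF 2] big_trans[OF 1], of G]
    unfolding G_def[abs_def] by simp
qed

text \<open>Along the vertical direction \<open>s\<^sub>Y\<close> now has the factor \<open>c(u0) - c(u)\<close>, quadratic in the distance to \<open>P\<close>,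
and the factor \<open>1 + cos z\<close>.  Since \<open>z\<^sub>X\<close> vanishes at \<open>P\<close>, too, the latter is of order \<open>k\<^sup>2 + h\<^sup>4\<close>.  The mixed
terms are dominated by \<open>h\<^sup>4 + k\<^sup>5\<close>, so \<open>s\<close> depends to leading order on \<open>h\<close> alone.\<close>

lemma crossing_expansion:
  assumes w: "angle_pi (w X0 Y0)" and z: "angle_pi (z X0 Y0)"
  shows "(\<lambda>P. back_char X0 Y0 @@ P - (dX w X0 Y0)\<^sup>2 * p X0 Y0 / 12 * (fst P - X0) ^ 3)
      \<in> O[nhds (X0, Y0)](\<lambda>P. \<bar>fst P - X0\<bar> ^ 4 + \<bar>snd P - Y0\<bar> ^ 5)" (is "?S \<in> _")
    and "(\<lambda>P. u (fst P) Y0 - u X0 Y0 - - (dX w X0 Y0 * p X0 Y0 / (8 * c (u X0 Y0))) * (fst P - X0)\<^sup>2)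
      \<in> O[nhds (X0, Y0)](\<lambda>P. \<bar>fst P - X0\<bar> ^ 3)"
proof -
  let ?h = "\<lambda>P :: real \<times> real. \<bar>fst P - X0\<bar>" and ?k = "\<lambda>P :: real \<times> real. \<bar>snd P - Y0\<bar>"
  have trig: "sin (w X0 Y0) = 0" "cos (w X0 Y0) = - 1" "sin (z X0 Y0) = 0" "cos (z X0 Y0) = - 1"
    using sin_rcong[OF w] cos_rcong[OF w] sin_rcong[OF z] cos_rcong[OF z] by auto
  have w1: "two_term X0 1 (dX w X0 Y0) (\<lambda>X. w X Y0 - w X0 Y0)"
    using smooth_plane_two_term[OF smooth_w, of 1] by simp
  note hor = horizontal_expansion[OF w w1 zero_less_one]
  have "two_term X0 3 ((dX w X0 Y0)\<^sup>2 * p X0 Y0 / 12) (\<lambda>X. back_char X0 Y0 X Y0)"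
    using hor(1) by (simp add: numeral_3_eq_3)
  from bigo_fst[OF two_term_leading[OF this]]
  have s1: "(\<lambda>P. back_char X0 Y0 (fst P) Y0 - (dX w X0 Y0)\<^sup>2 * p X0 Y0 / 12 * (fst P - X0) ^ 3)
      \<in> O[nhds (X0, Y0)](\<lambda>P. ?h P ^ 4)"
    unfolding abs_bigo_iff_power by simp
  have "two_term X0 2 (- (dX w X0 Y0 * p X0 Y0 / (8 * c (u X0 Y0)))) (\<lambda>X. u X Y0 - u X0 Y0)"
    using hor(2) by (simp add: numeral_2_eq_2)
  from bigo_fst[OF two_term_leading[OF this]]
  show "(\<lambda>P. u (fst P) Y0 - u X0 Y0 - - (dX w X0 Y0 * p X0 Y0 / (8 * c (u X0 Y0))) * (fst P - X0)\<^sup>2)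
      \<in> O[nhds (X0, Y0)](\<lambda>P. ?h P ^ 3)"
    unfolding abs_bigo_iff_power by simp
  have "dX z X0 Y0 = 0" using trig by (simp add: dX_z)
  from bigo_fst[OF smooth_plane_critical[OF smooth_z this]]
  have z1: "(\<lambda>P. z (fst P) Y0 - z X0 Y0) \<in> O[nhds (X0, Y0)](\<lambda>P. (?h P)\<^sup>2)" unfolding abs_bigo_iff_power .
  have "(\<lambda>P. z @@ P - z X0 Y0) \<in> O[nhds (X0, Y0)](\<lambda>P. ?k P + (?h P)\<^sup>2)"
    by (rule bigo_diff_add[OF smooth_plane_lipschitz_Y[OF smooth_z] z1]) simp_all
  note z2 = big_power[OF this, of 2]
  have cosz: "\<bar>1 + cos (z X Y)\<bar> \<le> (z X Y - z X0 Y0)\<^sup>2" for X Y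
  proof -
    have "0 \<le> 1 + cos (z X Y)" using cos_ge_minus_one[of "z X Y"] by linarith
    then show ?thesis using one_minus_cos_le[of "z X Y - z X0 Y0"] trig by (simp add: cos_diff)
  qed
  have "(\<lambda>P. 1 + cos (z @@ P)) \<in> O[nhds (X0, Y0)](\<lambda>P. (z @@ P - z X0 Y0)\<^sup>2)"
    by (rule bigo_of_le[where C = 1]) (simp_all add: cosz)
  also note z2
  also have "(\<lambda>P. (?k P + (?h P)\<^sup>2)\<^sup>2) \<in> O[nhds (X0, Y0)](\<lambda>P. (?k P)\<^sup>2 + ?h P ^ 4)"
  proof (rule bigo_of_le[where C = 2])
    fix P :: "real \<times> real"
    have "(a + b)\<^sup>2 \<le> 2 * (a\<^sup>2 + b\<^sup>2)" for a b :: real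
      using zero_le_power2[of "a - b"] by (simp add: power2_eq_square algebra_simps)
    from this[of "?k P" "(?h P)\<^sup>2"]
    show "\<bar>(?k P + (?h P)\<^sup>2)\<^sup>2\<bar> \<le> 2 * ((?k P)\<^sup>2 + ?h P ^ 4)" by simp
  qed simp
  finally have z3: "(\<lambda>P. 1 + cos (z @@ P)) \<in> O[nhds (X0, Y0)](\<lambda>P. (?k P)\<^sup>2 + ?h P ^ 4)" .
  have "(\<lambda>P. back_char X0 Y0 @@ P - back_char X0 Y0 (fst P) Y0) \<in> O[nhds (X0, Y0)](\<lambda>P.
      ((?h P)\<^sup>2 + (?k P)\<^sup>2) * ((?k P)\<^sup>2 + ?h P ^ 4) * ?k P)"
    by (rule back_char_vertical[where ?g1.0 = "\<lambda>a b. a\<^sup>2 + b\<^sup>2" and ?g2.0 = "\<lambda>a b. b\<^sup>2 + a ^ 4", OF u_quadratic[OF trig(1,3)] z3])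
      (auto intro!: power_mono)
  also have "(\<lambda>P. ((?h P)\<^sup>2 + (?k P)\<^sup>2) * ((?k P)\<^sup>2 + ?h P ^ 4) * ?k P)
      \<in> O[nhds (X0, Y0)](\<lambda>P. ?h P ^ 4 + ?k P ^ 5)"
  proof (rule bigoI[where c = 3])
    have "\<forall>\<^sub>F P in nhds (X0, Y0). dist (fst P - X0) 0 < 1" "\<forall>\<^sub>F P in nhds (X0, Y0). dist (snd P - Y0) 0 < 1"
      by (intro tendstoD[OF tendsto_fst_diff_0] tendstoD[OF tendsto_snd_diff_0]; simp)+
    then show "\<forall>\<^sub>F P in nhds (X0, Y0).
        norm (((?h P)\<^sup>2 + (?k P)\<^sup>2) * ((?k P)\<^sup>2 + ?h P ^ 4) * ?k P)
        \<le> 3 * norm (?h P ^ 4 + ?k P ^ 5)"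
    proof eventually_elim
      case (elim P)
      have "(a\<^sup>2 + b\<^sup>2) * (b\<^sup>2 + a ^ 4) * b \<le> 3 * (a ^ 4 + b ^ 5)" if a: "0 \<le> a" "a \<le> 1" and b: "0 \<le> b" "b \<le> 1" for a b :: real
      proof -
        have 1: "a\<^sup>2 * b ^ 3 \<le> a ^ 4 + b ^ 5"
        proof (cases "a \<le> b")
          case True
          have "a\<^sup>2 * b ^ 3 \<le> b\<^sup>2 * b ^ 3" using True a b by (intro mult_right_mono power_mono) auto
          also have "\<dots> = b ^ 5" by (simp add: power_add[symmetric])
          finally show ?thesis using a by (simp add: add_increasing)
        next
          case False
          have "a\<^sup>2 * b ^ 3 \<le> a\<^sup>2 * b\<^sup>2" using b by (intro mult_left_mono power_decreasing) auto
          also have "\<dots> \<le> a\<^sup>2 * a\<^sup>2" using False a b by (intro mult_left_mono power_mono) auto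
          also have "\<dots> = a ^ 4" by (simp add: power_add[symmetric])
          finally show ?thesis using b by (simp add: add_increasing2)
        qed
        have le1: "a ^ 6 * b \<le> a ^ 4 * 1" using a b by (intro mult_mono power_decreasing) auto
        have "b ^ 3 \<le> 1" using b by (intro power_le_one) auto
        then have le2: "a ^ 4 * b ^ 3 \<le> a ^ 4 * 1" using a by (intro mult_left_mono) auto
        have "(a\<^sup>2 + b\<^sup>2) * (b\<^sup>2 + a ^ 4) * b = a\<^sup>2 * b ^ 3 + a ^ 6 * b + b ^ 5 + a ^ 4 * b ^ 3"
          by (simp add: algebra_simps numeral_eq_Suc)
        also have "\<dots> \<le> (a ^ 4 + b ^ 5) + a ^ 4 * 1 + b ^ 5 + a ^ 4 * 1"
          by (intro add_mono 1 le1 le2 order_refl)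
        also have "\<dots> \<le> 3 * (a ^ 4 + b ^ 5)" using b by simp
        finally show ?thesis .
      qed
      from this[of "?h P" "?k P"] elim show ?case
        by (simp add: dist_real_def abs_mult)
    qed
  qed
  finally have s2: "(\<lambda>P. back_char X0 Y0 @@ P - back_char X0 Y0 (fst P) Y0)
      \<in> O[nhds (X0, Y0)](\<lambda>P. ?h P ^ 4 + ?k P ^ 5)" .
  have "(\<lambda>P. ?h P ^ 4) \<in> O[nhds (X0, Y0)](\<lambda>P. ?h P ^ 4 + ?k P ^ 5)"
    by (rule bigo_of_le[where C = 1]) simp_all
  from sum_in_bigo(1)[OF s2 big_trans[OF s1 this]]
  show "?S \<in> O[nhds (X0, Y0)](\<lambda>P. ?h P ^ 4 + ?k P ^ 5)" by (rule bigo_ext) simp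
qed

end

context semilinear_flow
begin

interpretation sw: semilinear_flow c "\<lambda>X Y. u Y X" "\<lambda>X Y. z Y X" "\<lambda>X Y. w Y X" "\<lambda>X Y. q Y X" "\<lambda>X Y. p Y X"
    "\<lambda>X Y. - x Y X" "\<lambda>X Y. t Y X"
  by (rule swapped)

lemma sw_back_char: "sw.back_char Y0 X0 Y X = fwd_char X0 Y0 X Y"
  by (simp add: sw.back_char_def fwd_char_def)

text \<open>One half is \<open>crossing_expansion\<close>, the other its reflection.  It remains to see that \<open>u - u0\<close> splits into
a function of \<open>h\<close> and a function of \<open>k\<close>: the mixed derivative of \<open>u\<close> vanishes at \<open>P\<close>, because \<open>u\<^sub>Y\<close> has the
factor \<open>sin z\<close> and \<open>z\<^sub>X = 0\<close>, so the mixed difference is cubic.\<close>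

lemma type3_expansion:
  assumes w: "angle_pi (w X0 Y0)" and z: "angle_pi (z X0 Y0)" and wX: "dX w X0 Y0 \<noteq> 0" and zY: "dY z X0 Y0 \<noteq> 0"
  shows "\<exists>a1 a2. a1 \<noteq> 0 \<and> a2 \<noteq> 0 \<and>
    (\<lambda>P. u @@ P - (u X0 Y0 + a1 * (root 3 (back_char X0 Y0 @@ P))\<^sup>2
        + a2 * (root 3 (fwd_char X0 Y0 @@ P))\<^sup>2))
    \<in> O[nhds (X0, Y0)](radius X0 Y0)"
proof -
  let ?h = "\<lambda>P :: real \<times> real. \<bar>fst P - X0\<bar>" and ?k = "\<lambda>P :: real \<times> real. \<bar>snd P - Y0\<bar>"
  have trig: "sin (w X0 Y0) = 0" "cos (w X0 Y0) = - 1" "sin (z X0 Y0) = 0" "cos (z X0 Y0) = - 1"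
    using sin_rcong[OF w] cos_rcong[OF w] sin_rcong[OF z] cos_rcong[OF z] by auto
  define A where "A = (dX w X0 Y0)\<^sup>2 * p X0 Y0 / 12"
  define A' where "A' = (dY z X0 Y0)\<^sup>2 * q X0 Y0 / 12"
  define B where "B = - (dX w X0 Y0 * p X0 Y0 / (8 * c (u X0 Y0)))"
  define B' where "B' = - (dY z X0 Y0 * q X0 Y0 / (8 * c (u X0 Y0)))"
  have AB: "A \<noteq> 0" "B \<noteq> 0" "A' \<noteq> 0" "B' \<noteq> 0"
    using wX zY p_pos[of X0 Y0] q_pos[of X0 Y0] by (simp_all add: A_def B_def A'_def B'_def)
  note wexp = crossing_expansion[OF w z, folded A_def B_def]
  note zexp = sw.crossing_expansion[OF z w, unfolded dX_swap[of z] sw_back_char, folded A'_def B'_def]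
  have dXY: "dX (dY u) X0 Y0 = 0"
  proof -
    have "DERIV (\<lambda>s. c (u s Y0)) X0 :> deriv c (u X0 Y0) * dX u X0 Y0"
      using DERIV_chain[OF c_DERIV smooth_planeD(4)[OF smooth_u]] by (simp add: o_def)
    from DERIV_mult[OF DERIV_divide[OF DERIV_chain2[OF DERIV_sin z_X[of Y0 X0]] DERIV_cmult[OF this, of 4]] smooth_planeD(4)[OF smooth_q, of Y0 X0]]
    have "DERIV (\<lambda>s. dY u s Y0) X0 :> 0"
      unfolding dY_u using trig by simp
    then show ?thesis unfolding dX_def by (rule DERIV_imp_deriv)
  qed
  have "(\<lambda>P. dX (dY u) @@ P) \<in> O[nhds (X0, Y0)](\<lambda>P. ?h P + ?k P)"
    using smooth_plane_lipschitz[OF smooth_planeD(1)[OF smooth_planeD(2)[OF smooth_u]], of X0 Y0] dXY by simp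
  from mvt_bigo_X[OF smooth_planeD(4)[OF smooth_planeD(2)[OF smooth_u]], where g = "\<lambda>a b. a + b", OF this]
  have 1: "(\<lambda>P. dY u @@ P - dY u X0 (snd P)) \<in>
      O[nhds (X0, Y0)](\<lambda>P. (?h P + ?k P) * ?h P)" by simp
  have 2: "DERIV (\<lambda>s. u X s - u X0 s) Y :> dY u X Y - dY u X0 Y" for X Y
    by (intro DERIV_diff smooth_planeD(5)[OF smooth_u])
  have "(\<lambda>P. (u @@ P - u X0 (snd P)) - (u (fst P) Y0 - u X0 Y0)) \<in>
      O[nhds (X0, Y0)](\<lambda>P. (?h P + ?k P) * ?h P * ?k P)"
    by (rule mvt_bigo_Y[where g = "\<lambda>a b. (a + b) * a", OF 2 1]) (auto intro: mult_right_mono)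
  also have "(\<lambda>P. (?h P + ?k P) * ?h P * ?k P)
      \<in> O[nhds (X0, Y0)](\<lambda>P. ?h P ^ 3 + ?k P ^ 3)"
  proof (rule bigo_of_le[where C = 2])
    have *: "(a + b) * a * b \<le> 2 * (a ^ 3 + b ^ 3)" if "0 \<le> a" "0 \<le> b" for a b :: real
    proof -
      have "0 \<le> (a + b) * (a - b)\<^sup>2" "0 \<le> a ^ 3" "0 \<le> b ^ 3" using that by simp_all
      then show ?thesis by (simp add: power2_eq_square power3_eq_cube algebra_simps)
    qed
    show "\<bar>(?h P + ?k P) * ?h P * ?k P\<bar>
        \<le> 2 * (?h P ^ 3 + ?k P ^ 3)" for P :: "real \<times> real"
      using *[of "?h P" "?k P"] by (simp add: abs_mult)
  qed simp
  finally have mixed: "(\<lambda>P. (u @@ P - u X0 (snd P)) - (u (fst P) Y0 - u X0 Y0)) \<in>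
      O[nhds (X0, Y0)](\<lambda>P. ?h P ^ 3 + ?k P ^ 3)" .
  have "(\<lambda>P. (u @@ P - u X0 Y0) - (B / (root 3 A)\<^sup>2 * (root 3 (back_char X0 Y0 @@ P))\<^sup>2
        + B' / (root 3 A')\<^sup>2 * (root 3 (fwd_char X0 Y0 @@ P))\<^sup>2))
      \<in> O[nhds (X0, Y0)](radius X0 Y0)"
  proof (rule type3_asymptotics[where H = "\<lambda>P. fst P - X0" and K = "\<lambda>P. snd P - Y0",
        OF tendsto_fst_diff_0 tendsto_snd_diff_0 radius_tendsto_0 _ AB(1,3)])
    show "(\<lambda>P. back_char X0 Y0 @@ P - A * (fst P - X0) ^ 3)
      \<in> O[nhds (X0, Y0)](\<lambda>P. ?h P ^ 4 + ?k P ^ 5)" by (rule wexp(1))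
    show "(\<lambda>P. fwd_char X0 Y0 @@ P - A' * (snd P - Y0) ^ 3)
      \<in> O[nhds (X0, Y0)](\<lambda>P. ?k P ^ 4 + ?h P ^ 5)" using bigo_swap[OF zexp(1)] by simp
    have "(\<lambda>P. u X0 (snd P) - u X0 Y0 - B' * (snd P - Y0)\<^sup>2) \<in> O[nhds (X0, Y0)](\<lambda>P. ?k P ^ 3)"
      using bigo_swap[OF zexp(2)] by simp
    from sum_in_bigo(1)[OF bigo_add[OF wexp(2) this] mixed]
    show "(\<lambda>P. u @@ P - u X0 Y0 - (B * (fst P - X0)\<^sup>2 + B' * (snd P - Y0)\<^sup>2))
      \<in> O[nhds (X0, Y0)](\<lambda>P. ?h P ^ 3 + ?k P ^ 3)" by (rule bigo_ext) simp_all
  qed (simp_all add: char_bigo_radius)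
  then have "(\<lambda>P. u @@ P - (u X0 Y0 + B / (root 3 A)\<^sup>2 * (root 3 (back_char X0 Y0 @@ P))\<^sup>2
        + B' / (root 3 A')\<^sup>2 * (root 3 (fwd_char X0 Y0 @@ P))\<^sup>2))
      \<in> O[nhds (X0, Y0)](radius X0 Y0)"
    by (rule bigo_ext) simp
  moreover have "B / (root 3 A)\<^sup>2 \<noteq> 0" "B' / (root 3 A')\<^sup>2 \<noteq> 0" using AB by simp_all
  ultimately show ?thesis by blast
qed

end

section \<open>Level curves and their images\<close>

lemma curve_as_graph:
  fixes \<theta> \<phi> :: "real \<Rightarrow> real"
  assumes "continuous_on {a..b} \<theta>" "continuous_on {a..b} \<phi>" and inj: "inj_on \<theta> {a..b}"
  obtains \<gamma> where "continuous_on (\<theta> ` {a..b}) \<gamma>" "\<forall>X\<in>{a..b}. \<gamma> (\<theta> X) = \<phi> X"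
proof (rule that[of "\<phi> \<circ> the_inv_into {a..b} \<theta>"])
  show "continuous_on (\<theta> ` {a..b}) (\<phi> \<circ> the_inv_into {a..b} \<theta>)"
    by (rule continuous_on_compose[OF continuous_on_inv_into[OF assms(1) compact_Icc inj]])
      (simp add: the_inv_into_onto[OF inj] assms(2))
qed (simp add: the_inv_into_f_f[OF inj])

lemma strictly_increasing_off_point:
  fixes f f' :: "real \<Rightarrow> real"
  assumes f: "\<And>s. a \<le> s \<Longrightarrow> s \<le> b \<Longrightarrow> DERIV f s :> f' s"
    and pos: "\<And>s. a \<le> s \<Longrightarrow> s \<le> b \<Longrightarrow> s \<noteq> m \<Longrightarrow> 0 < f' s"
    and XY: "a \<le> X" "X < Y" "Y \<le> b"
  shows "f X < f Y"
proof -
  have inc: "f r < f s" if "a \<le> r" "r < s" "s \<le> b" "m \<notin> {r<..<s}" for r s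
  proof (rule DERIV_pos_imp_increasing_open[OF that(2)])
    show "\<exists>y. DERIV f v :> y \<and> 0 < y" if "r < v" "v < s" for v
    proof -
      have "v \<noteq> m" using that \<open>m \<notin> {r<..<s}\<close> by auto
      then show ?thesis using f[of v] pos[of v] that \<open>a \<le> r\<close> \<open>s \<le> b\<close> by force
    qed
    show "continuous_on {r..s} f"
      by (rule DERIV_atLeastAtMost_imp_continuous_on) (use f that in \<open>meson order_trans less_imp_le\<close>)
  qed
  show ?thesis
  proof (cases "m \<in> {X<..<Y}")
    case True
    then have "f X < f m" "f m < f Y" using XY by (intro inc; auto)+
    then show ?thesis by simp
  next
    case False
    then show ?thesis using XY by (intro inc)
  qed
qed

text \<open>The map \<open>(X, Y) \<mapsto> (X, f X Y)\<close> is injective on a box, so by invariance of domain it has a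
differentiable inverse on an open set; its second component on the level of \<open>f\<close> is \<open>\<kappa>\<close>.\<close>

lemma implicit_graph:
  assumes f: "smooth_plane f" and fY: "dY f X0 Y0 \<noteq> 0" and Q: "\<forall>\<^sub>F P in nhds (X0, Y0). Q P"
  obtains e \<delta> \<kappa> where "0 < e" "0 < \<delta>" "\<kappa> X0 = Y0"
    "\<forall>X Y. \<bar>X - X0\<bar> < e \<longrightarrow> \<bar>Y - Y0\<bar> < \<delta> \<longrightarrow> Q (X, Y) \<and> (f X Y = f X0 Y0 \<longleftrightarrow> Y = \<kappa> X)"
    "\<forall>X. \<bar>X - X0\<bar> < e \<longrightarrow>
      \<bar>\<kappa> X - Y0\<bar> < \<delta> \<and> DERIV \<kappa> X :> - (dX f X (\<kappa> X) / dY f X (\<kappa> X))"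
proof -
  obtain \<delta> where \<delta>: "0 < \<delta>"
    and box: "\<And>X Y. \<bar>X - X0\<bar> < \<delta> \<Longrightarrow> \<bar>Y - Y0\<bar> < \<delta> \<Longrightarrow> Q (X, Y) \<and> dY f X Y \<noteq> 0"
    using eventually_conj[OF Q smooth_plane_eventually_ne[OF smooth_planeD(2)[OF f] fY]] by (auto simp: eventually_nhds_box)
  define S where "S = {X0 - \<delta><..<X0 + \<delta>} \<times> {Y0 - \<delta><..<Y0 + \<delta>}"
  have S: "(X, Y) \<in> S \<longleftrightarrow> \<bar>X - X0\<bar> < \<delta> \<and> \<bar>Y - Y0\<bar> < \<delta>" for X Y by (auto simp: S_def abs_less_iff)
  have "open S" by (simp add: S_def open_Times)
  define \<Phi> where "\<Phi> P = (fst P, f @@ P)" for P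
  have \<Phi>_der: "(\<Phi> has_derivative (\<lambda>(h, k). (h, dX f X Y * h + dY f X Y * k))) (at (X, Y))" for X Y
    using has_derivative_Pair[OF has_derivative_fst[OF has_derivative_ident]
        plane_has_derivative[OF smooth_planeD(4,5)[OF f] smooth_planeD(3)[OF smooth_planeD(2)[OF f]]]]
    by (simp add: \<Phi>_def[abs_def] case_prod_beta')
  have \<Phi>_cont: "continuous_on S \<Phi>"
    using has_derivative_continuous[OF \<Phi>_der] by (auto intro!: continuous_at_imp_continuous_on)
  have less: "f X Y \<noteq> f X Y'" if "Y < Y'" "(X, Y) \<in> S" "(X, Y') \<in> S" for X Y Y'
  proof -
    from MVT2[OF that(1) smooth_planeD(5)[OF f]]
    obtain \<xi> where \<xi>: "Y < \<xi>" "\<xi> < Y'" "f X Y' - f X Y = (Y' - Y) * dY f X \<xi>" by blast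
    have "dY f X \<xi> \<noteq> 0" using box[of X \<xi>] \<xi> that by (auto simp: S abs_less_iff)
    then show ?thesis using \<xi>(3) that(1) by auto
  qed
  have inj: "inj_on \<Phi> S"
  proof (rule inj_onI)
    fix P P' assume P: "P \<in> S" "P' \<in> S" "\<Phi> P = \<Phi> P'"
    obtain X Y X' Y' where [simp]: "P = (X, Y)" "P' = (X', Y')" by (cases P, cases P')
    show "P = P'" using P less[of Y Y' X] less[of Y' Y X] by (cases Y Y' rule: linorder_cases) (auto simp: \<Phi>_def)
  qed
  define v where "v = f X0 Y0"
  define g where "g = inv_into S \<Phi>"
  define \<kappa> where "\<kappa> X = snd (g (X, v))" for X
  have g: "g (\<Phi> P) = P" if "P \<in> S" for P using inv_into_f_f[OF inj that] by (simp add: g_def)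
  have uniq: "Y = \<kappa> X" if "(X, Y) \<in> S" "f X Y = v" for X Y
    using g[OF that(1)] that(2) by (simp add: \<Phi>_def \<kappa>_def)
  have "(X0, Y0) \<in> S" using \<delta> by (simp add: S)
  then have "(X0, v) \<in> \<Phi> ` S" by (force simp: \<Phi>_def v_def)
  then have "\<forall>\<^sub>F P in nhds (X0, v). P \<in> \<Phi> ` S"
    using invariance_of_domain[OF \<Phi>_cont \<open>open S\<close> inj] by (rule eventually_nhds_in_open[rotated])
  then obtain e where e: "0 < e" "\<And>X. \<bar>X - X0\<bar> < e \<Longrightarrow> (X, v) \<in> \<Phi> ` S"
    unfolding eventually_nhds_box by force
  have \<kappa>: "(X, \<kappa> X) \<in> S" "f X (\<kappa> X) = v" if "\<bar>X - X0\<bar> < e" for X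
    using e(2)[OF that] uniq by (auto simp: \<Phi>_def)
  have \<kappa>_der: "DERIV \<kappa> X :> - (dX f X (\<kappa> X) / dY f X (\<kappa> X))" if X: "\<bar>X - X0\<bar> < e" for X
  proof -
    let ?a = "dX f X (\<kappa> X)" and ?b = "dY f X (\<kappa> X)"
    have "?b \<noteq> 0" using box[of X "\<kappa> X"] \<kappa>(1)[OF X] by (auto simp: S)
    then have "(\<lambda>(h, k). (h, ?a * h + ?b * k)) \<circ> (\<lambda>(h, k). (h, (k - ?a * h) / ?b)) = id" by auto
    from has_derivative_inverse_strong[OF \<open>open S\<close> \<kappa>(1)[OF X] \<Phi>_cont g \<Phi>_der this]
    have "(g has_derivative (\<lambda>(h, k). (h, (k - ?a * h) / ?b))) (at (X, v))" by (simp add: \<Phi>_def \<kappa>(2)[OF X])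
    from has_derivative_snd[OF has_derivative_compose[OF has_derivative_Pair[OF has_derivative_ident has_derivative_const] this]]
    have "(\<kappa> has_derivative (\<lambda>h. - (?a * h) / ?b)) (at X)" by (simp add: \<kappa>_def[abs_def])
    then show ?thesis unfolding has_field_derivative_def by (rule has_derivative_eq_rhs) (simp add: fun_eq_iff)
  qed
  show thesis
  proof (rule that[OF e(1) \<delta>])
    show "\<kappa> X0 = Y0" using uniq[OF \<open>(X0, Y0) \<in> S\<close>] by (simp add: v_def)
    show "\<forall>X Y. \<bar>X - X0\<bar> < e \<longrightarrow> \<bar>Y - Y0\<bar> < \<delta> \<longrightarrow> Q (X, Y) \<and> (f X Y = f X0 Y0 \<longleftrightarrow> Y = \<kappa> X)"
      using box uniq \<kappa> unfolding S v_def by blast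
    show "\<forall>X. \<bar>X - X0\<bar> < e \<longrightarrow>
        \<bar>\<kappa> X - Y0\<bar> < \<delta> \<and> (\<kappa> has_real_derivative - (dX f X (\<kappa> X) / dY f X (\<kappa> X))) (at X)"
      using \<kappa>(1) \<kappa>_der unfolding S by blast
  qed
qed

lemma dist_pair_le_abs: "dist (X, Y) (X0, Y0) < e \<Longrightarrow> \<bar>X - X0\<bar> < e \<and> \<bar>Y - Y0\<bar> < e" for X Y X0 Y0 :: real
  using dist_fst_le[of "(X, Y)" "(X0, Y0)"] dist_snd_le[of "(X, Y)" "(X0, Y0)"] by (auto simp: dist_real_def)

lemma DERIV_eventually_ne:
  fixes f :: "real \<Rightarrow> real"
  assumes "DERIV f a :> D" "D \<noteq> 0"
  shows "\<forall>\<^sub>F s in at a. f s \<noteq> f a"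
proof -
  have "((\<lambda>s. (f s - f a) / (s - a)) \<longlongrightarrow> D) (at a)" using assms(1) by (simp add: has_field_derivative_iff)
  from tendsto_imp_eventually_ne[OF this assms(2)] show ?thesis by eventually_elim auto
qed

lemma eventually_at_abs:
  "(\<forall>\<^sub>F s in at (a::real). P s) \<longleftrightarrow> (\<exists>e>0. \<forall>s. \<bar>s - a\<bar> < e \<longrightarrow> s \<noteq> a \<longrightarrow> P s)"
  by (auto simp: eventually_at dist_real_def)

lemma curve_in_ball:
  fixes \<kappa> :: "real \<Rightarrow> real"
  assumes "isCont \<kappa> X0" "0 < r"
  obtains \<eta> where "0 < \<eta>" "\<And>X. \<bar>X - X0\<bar> < \<eta> \<Longrightarrow> dist (X, \<kappa> X) (X0, \<kappa> X0) < r"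
proof -
  have "((\<lambda>X. (X, \<kappa> X)) \<longlongrightarrow> (X0, \<kappa> X0)) (nhds X0)"
    by (rule tendsto_Pair[OF filterlim_ident isCont_tendsto_nhds[OF assms(1)]])
  from tendstoD[OF this assms(2)] show thesis using that by (auto simp: eventually_nhds_metric dist_real_def)
qed

context semilinear_flow
begin

lemma continuous_t_Y: "jointly_continuous (\<lambda>X Y. (1 + cos (z X Y)) * q X Y / (4 * c (u X Y)))"
proof -
  have cu: "continuous_on UNIV (\<lambda>P. c (u @@ P))"
    by (rule continuous_on_compose2[of UNIV c]) 
      (use smooth_planeD(3)[OF smooth_u] DERIV_isCont[OF c_DERIV] in
        \<open>auto simp: jointly_continuous_def case_prod_beta intro: continuous_at_imp_continuous_on\<close>)
  show ?thesis
    using smooth_planeD(3)[OF smooth_z] smooth_planeD(3)[OF smooth_q] cu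
    unfolding jointly_continuous_def case_prod_beta by (intro continuous_intros) auto
qed

lemma continuous_x_Y: "jointly_continuous (\<lambda>X Y. - ((1 + cos (z X Y)) * q X Y / 4))"
  using smooth_planeD(3)[OF smooth_z] smooth_planeD(3)[OF smooth_q]
  unfolding jointly_continuous_def case_prod_beta by (intro continuous_intros) auto

lemma t_along_graph:
  assumes "DERIV \<kappa> X :> \<kappa>'"
  shows "DERIV (\<lambda>s. t s (\<kappa> s)) X :> (1 + cos (w X (\<kappa> X))) * p X (\<kappa> X) / (4 * c (u X (\<kappa> X)))
    + (1 + cos (z X (\<kappa> X))) * q X (\<kappa> X) / (4 * c (u X (\<kappa> X))) * \<kappa>'"
  by (rule DERIV_along_graph[OF t_X t_Y continuous_t_Y assms])

lemma x_along_graph: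
  assumes "DERIV \<kappa> X :> \<kappa>'"
  shows "DERIV (\<lambda>s. x s (\<kappa> s)) X :> (1 + cos (w X (\<kappa> X))) * p X (\<kappa> X) / 4
    + - ((1 + cos (z X (\<kappa> X))) * q X (\<kappa> X) / 4) * \<kappa>'"
  by (rule DERIV_along_graph[OF x_X x_Y continuous_x_Y assms])

text \<open>Along \<open>z = pi\<close> the vertical derivatives of \<open>x\<close> and \<open>t\<close> vanish, so only the horizontal ones count, and
they are positive where \<open>w \<noteq> pi\<close>.  That holds on the curve except at \<open>P\<close>: there \<open>w\<^sub>Y = 0\<close> by the equation,
so the derivative of \<open>w\<close> along the curve is \<open>w\<^sub>X \<noteq> 0\<close>.

Neighborhoods are cut out by a time slab besides a ball.  Thus the image of the level set is the graph over
a full time interval and not over an interval that depends on how the curve leaves the ball.\<close>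

lemma z_level_curve_at_crossing:
  assumes w: "angle_pi (w X0 Y0)" and z: "angle_pi (z X0 Y0)" and wX: "dX w X0 Y0 \<noteq> 0" and zY: "dY z X0 Y0 \<noteq> 0"
  obtains d r \<gamma> where "0 < d" "0 < r" "continuous_on {t X0 Y0 - d<..<t X0 Y0 + d} \<gamma>" "\<gamma> (t X0 Y0) = x X0 Y0"
    "\<forall>\<tau>\<in>{t X0 Y0 - d<..<t X0 Y0 + d}. \<forall>\<tau>'\<in>{t X0 Y0 - d<..<t X0 Y0 + d}. \<tau> < \<tau>' \<longrightarrow> \<gamma> \<tau> < \<gamma> \<tau>'"
    "\<forall>e\<in>{0<..r}. \<exists>\<delta>0\<in>{0<..d}. \<forall>\<delta>\<in>{0<..\<delta>0}.
      Lam x t ` (ball (X0, Y0) e \<inter> {P. \<bar>t @@ P - t X0 Y0\<bar> < \<delta>} \<inter> pi_level z)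
        = graph_over \<gamma> {t X0 Y0 - \<delta><..<t X0 Y0 + \<delta>}"
proof -
  have trig: "cos (w X0 Y0) = - 1" "cos (z X0 Y0) = - 1"
    using cos_rcong[OF w] cos_rcong[OF z] by auto
  have "\<forall>\<^sub>F P in nhds (X0, Y0). dist (w @@ P) (w X0 Y0) < 2 * pi \<and> dist (z @@ P) (z X0 Y0) < 2 * pi"
    by (intro eventually_conj tendstoD[OF smooth_plane_tendsto] smooth_w smooth_z) simp_all
  then obtain e \<delta>' \<psi> where e: "0 < e" "0 < \<delta>'" and \<psi>0: "\<psi> X0 = Y0"
    and box: "\<forall>X Y. \<bar>X - X0\<bar> < e \<longrightarrow> \<bar>Y - Y0\<bar> < \<delta>' \<longrightarrow>
      (dist (w (fst (X, Y)) (snd (X, Y))) (w X0 Y0) < 2 * pi \<and> dist (z (fst (X, Y)) (snd (X, Y))) (z X0 Y0) < 2 * pi) \<and>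
      (z X Y = z X0 Y0 \<longleftrightarrow> Y = \<psi> X)"
    and \<psi>: "\<forall>X. \<bar>X - X0\<bar> < e \<longrightarrow>
      \<bar>\<psi> X - Y0\<bar> < \<delta>' \<and> DERIV \<psi> X :> - (dX z X (\<psi> X) / dY z X (\<psi> X))"
    by (rule implicit_graph[OF smooth_z zY])
  have near: "\<bar>w X Y - w X0 Y0\<bar> < 2 * pi \<and> \<bar>z X Y - z X0 Y0\<bar> < 2 * pi"
    and graph: "z X Y = z X0 Y0 \<longleftrightarrow> Y = \<psi> X" if "\<bar>X - X0\<bar> < e" "\<bar>Y - Y0\<bar> < \<delta>'" for X Y
    using box[rule_format, OF that] by (auto simp: dist_real_def)
  have \<psi>_box: "\<bar>\<psi> X - Y0\<bar> < \<delta>'"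
    and \<psi>_der: "DERIV \<psi> X :> - (dX z X (\<psi> X) / dY z X (\<psi> X))" if "\<bar>X - X0\<bar> < e" for X
    using \<psi>[rule_format, OF that] by auto
  have z\<psi>: "cos (z X (\<psi> X)) = - 1" if "\<bar>X - X0\<bar> < e" for X
    using graph[OF that \<psi>_box[OF that]] trig by simp
  have "DERIV (\<lambda>s. w s (\<psi> s)) X0 :> dX w X0 (\<psi> X0) + dY w X0 (\<psi> X0) * - (dX z X0 (\<psi> X0) / dY z X0 (\<psi> X0))"
    by (rule DERIV_along_graph[OF smooth_planeD(4,5)[OF smooth_w] smooth_planeD(3)[OF smooth_planeD(2)[OF smooth_w]] \<psi>_der])
      (use e in simp)
  then have "DERIV (\<lambda>s. w s (\<psi> s)) X0 :> dX w X0 Y0" using trig by (simp add: \<psi>0 dY_w)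
  from DERIV_eventually_ne[OF this wX] obtain e2 where e2: "0 < e2"
    "\<And>X. \<bar>X - X0\<bar> < e2 \<Longrightarrow> X \<noteq> X0 \<Longrightarrow> w X (\<psi> X) \<noteq> w X0 Y0"
    by (auto simp: eventually_at_abs \<psi>0)
  define m where "m = min e e2 / 2"
  have m: "0 < m" "m < e" "m < e2" using e e2(1) by (auto simp: m_def min_def)
  have w\<psi>: "0 < 1 + cos (w X (\<psi> X))" if "\<bar>X - X0\<bar> \<le> m" "X \<noteq> X0" for X
  proof -
    have "\<not> angle_pi (w X (\<psi> X))"
      using angle_pi_near[OF w] near[OF _ \<psi>_box] e2(2)[of X] that m by fastforce
    then have "cos (w X (\<psi> X)) \<noteq> - 1" by (simp add: angle_pi_iff_cos)
    then show ?thesis using cos_ge_minus_one[of "w X (\<psi> X)"] by linarith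
  qed
  define \<theta> where "\<theta> X = t X (\<psi> X)" for X
  define \<phi> where "\<phi> X = x X (\<psi> X)" for X
  have in_e: "\<bar>X - X0\<bar> < e" if "X0 - m \<le> X" "X \<le> X0 + m" for X using that m by (auto simp: abs_less_iff)
  have \<theta>_der: "DERIV \<theta> X :> (1 + cos (w X (\<psi> X))) * p X (\<psi> X) / (4 * c (u X (\<psi> X)))"
    if "X0 - m \<le> X" "X \<le> X0 + m" for X
    using t_along_graph[OF \<psi>_der[OF in_e[OF that]]] z\<psi>[OF in_e[OF that]] by (simp add: \<theta>_def[abs_def])
  have \<phi>_der: "DERIV \<phi> X :> (1 + cos (w X (\<psi> X))) * p X (\<psi> X) / 4"
    if "X0 - m \<le> X" "X \<le> X0 + m" for X
    using x_along_graph[OF \<psi>_der[OF in_e[OF that]]] z\<psi>[OF in_e[OF that]] by (simp add: \<phi>_def[abs_def])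
  have \<theta>_mono: "\<theta> X < \<theta> X'" if "X0 - m \<le> X" "X < X'" "X' \<le> X0 + m" for X X'
    by (rule strictly_increasing_off_point[OF \<theta>_der _ that, of X0])
      (use w\<psi> p_pos c_pos in \<open>auto simp: abs_le_iff\<close>)
  have \<phi>_mono: "\<phi> X < \<phi> X'" if "X0 - m \<le> X" "X < X'" "X' \<le> X0 + m" for X X'
    by (rule strictly_increasing_off_point[OF \<phi>_der _ that, of X0])
      (use w\<psi> p_pos in \<open>auto simp: abs_le_iff\<close>)
  have cont: "continuous_on {X0 - m..X0 + m} \<theta>" "continuous_on {X0 - m..X0 + m} \<phi>"
    by (rule DERIV_continuous_on[OF has_field_derivative_at_within], rule \<theta>_der \<phi>_der; simp)+
  have \<theta>0: "\<theta> X0 = t X0 Y0" and \<phi>0: "\<phi> X0 = x X0 Y0" by (simp_all add: \<theta>_def \<phi>_def \<psi>0)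
  let ?I = "{X0 - m..X0 + m}"
  have "inj_on \<theta> ?I" by (rule linorder_inj_onI) (use \<theta>_mono in \<open>force+\<close>)
  then obtain \<gamma> where \<gamma>_cont: "continuous_on (\<theta> ` ?I) \<gamma>" and \<gamma>: "\<forall>X\<in>?I. \<gamma> (\<theta> X) = \<phi> X"
    by (rule curve_as_graph[OF cont])
  have reach: "\<exists>X. \<bar>X - X0\<bar> < h \<and> \<theta> X = \<tau>" if "0 < h" "h \<le> m" "\<theta> (X0 - h) < \<tau>" "\<tau> < \<theta> (X0 + h)" for h \<tau>
  proof -
    have "continuous_on {X0 - h..X0 + h} \<theta>" by (rule continuous_on_subset[OF cont(1)]) (use that in auto)
    with IVT'[of \<theta> "X0 - h" \<tau> "X0 + h"] that obtain X where "X0 - h \<le> X" "X \<le> X0 + h" "\<theta> X = \<tau>" by auto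
    with that show ?thesis by (intro exI[of _ X]) (auto simp: abs_less_iff le_less)
  qed
  define d where "d = min (\<theta> (X0 + m) - t X0 Y0) (t X0 Y0 - \<theta> (X0 - m))"
  have d: "0 < d" using \<theta>_mono[of X0 "X0 + m"] \<theta>_mono[of "X0 - m" X0] m by (simp add: d_def \<theta>0)
  have reach_d: "\<exists>X\<in>?I. \<theta> X = \<tau>" if "\<tau> \<in> {t X0 Y0 - d<..<t X0 Y0 + d}" for \<tau>
  proof -
    have "\<theta> (X0 - m) < \<tau>" "\<tau> < \<theta> (X0 + m)" using that by (auto simp: d_def)
    from reach[OF m(1) order_refl this] show ?thesis by (auto simp: abs_less_iff)
  qed
  show thesis
  proof (rule that[of d "min m \<delta>'" \<gamma>])
    show "0 < d" "0 < min m \<delta>'" using d m e by simp_all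
    show "continuous_on {t X0 Y0 - d<..<t X0 Y0 + d} \<gamma>"
      by (rule continuous_on_subset[OF \<gamma>_cont]) (use reach_d in blast)
    show "\<gamma> (t X0 Y0) = x X0 Y0" using bspec[OF \<gamma>, of X0] m by (simp add: \<theta>0 \<phi>0)
    show "\<forall>\<tau>\<in>{t X0 Y0 - d<..<t X0 Y0 + d}. \<forall>\<tau>'\<in>{t X0 Y0 - d<..<t X0 Y0 + d}. \<tau> < \<tau>' \<longrightarrow> \<gamma> \<tau> < \<gamma> \<tau>'"
    proof (intro ballI impI)
      fix \<tau> \<tau>' assume \<tau>: "\<tau> \<in> {t X0 Y0 - d<..<t X0 Y0 + d}" "\<tau>' \<in> {t X0 Y0 - d<..<t X0 Y0 + d}" "\<tau> < \<tau>'"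
      obtain X X' where X: "X \<in> ?I" "\<theta> X = \<tau>" "X' \<in> ?I" "\<theta> X' = \<tau>'" using reach_d[OF \<tau>(1)] reach_d[OF \<tau>(2)] by blast
      then have "X < X'" using \<theta>_mono[of X' X] \<tau>(3) by (cases X X' rule: linorder_cases) auto
      then show "\<gamma> \<tau> < \<gamma> \<tau>'" using \<phi>_mono[of X X'] bspec[OF \<gamma>, of X] bspec[OF \<gamma>, of X'] X by auto
    qed
    show "\<forall>e\<in>{0<..min m \<delta>'}. \<exists>\<delta>0\<in>{0<..d}. \<forall>\<delta>\<in>{0<..\<delta>0}.
      Lam x t ` (ball (X0, Y0) e \<inter> {P. \<bar>t @@ P - t X0 Y0\<bar> < \<delta>} \<inter> pi_level z)
        = graph_over \<gamma> {t X0 Y0 - \<delta><..<t X0 Y0 + \<delta>}"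
    proof
      fix r assume r: "r \<in> {0<..min m \<delta>'}"
      have "isCont \<psi> X0" using DERIV_isCont[OF \<psi>_der[of X0]] e by simp
      then obtain \<eta> where \<eta>: "0 < \<eta>" "\<And>X. \<bar>X - X0\<bar> < \<eta> \<Longrightarrow> dist (X, \<psi> X) (X0, Y0) < r"
        using curve_in_ball[of X0 \<psi> r] r \<psi>0 by auto
      define h where "h = min \<eta> m"
      have h: "0 < h" "h \<le> \<eta>" "h \<le> m" using \<eta>(1) m by (auto simp: h_def)
      define \<delta>0 where "\<delta>0 = min d (min (\<theta> (X0 + h) - t X0 Y0) (t X0 Y0 - \<theta> (X0 - h)))"
      have \<delta>0: "0 < \<delta>0" "\<delta>0 \<le> d" using d \<theta>_mono[of X0 "X0 + h"] \<theta>_mono[of "X0 - h" X0] h by (auto simp: \<delta>0_def \<theta>0)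
      have "Lam x t ` (ball (X0, Y0) r \<inter> {P. \<bar>t @@ P - t X0 Y0\<bar> < \<delta>} \<inter> pi_level z)
        = graph_over \<gamma> {t X0 Y0 - \<delta><..<t X0 Y0 + \<delta>}" (is "?L = ?R") if \<delta>: "\<delta> \<in> {0<..\<delta>0}" for \<delta>
      proof
        show "?L \<subseteq> ?R"
        proof (rule image_subsetI)
          fix P assume P: "P \<in> ball (X0, Y0) r \<inter> {P. \<bar>t @@ P - t X0 Y0\<bar> < \<delta>} \<inter> pi_level z"
          obtain X Y where P_eq: "P = (X, Y)" by (cases P)
          have box: "\<bar>X - X0\<bar> < m" "\<bar>Y - Y0\<bar> < \<delta>'"
            using dist_pair_le_abs[of X Y X0 Y0 r] P r by (auto simp: P_eq dist_commute)
          have "z X Y = z X0 Y0" using angle_pi_near[OF z] near[of X Y] box m P by (auto simp: P_eq pi_level_def)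
          then have Y: "Y = \<psi> X" using graph[of X Y] box m by auto
          then have "Lam x t P = (\<gamma> (\<theta> X), \<theta> X)"
            using bspec[OF \<gamma>, of X] box by (auto simp: P_eq Lam_def \<theta>_def \<phi>_def abs_less_iff)
          moreover have "\<bar>\<theta> X - t X0 Y0\<bar> < \<delta>" using P by (auto simp: P_eq \<theta>_def Y)
          ultimately show "Lam x t P \<in> ?R" by (auto simp: graph_over_def abs_less_iff)
        qed
        show "?R \<subseteq> ?L" unfolding graph_over_def
        proof (rule image_subsetI)
          fix \<tau> assume \<tau>: "\<tau> \<in> {t X0 Y0 - \<delta><..<t X0 Y0 + \<delta>}"
          have "\<theta> (X0 - h) < \<tau>" "\<tau> < \<theta> (X0 + h)" using \<tau> \<delta> by (auto simp: \<delta>0_def)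
          from reach[OF h(1,3) this] obtain X where X: "\<bar>X - X0\<bar> < h" "\<theta> X = \<tau>" by blast
          have "(\<gamma> \<tau>, \<tau>) = Lam x t (X, \<psi> X)"
            using bspec[OF \<gamma>, of X] X h by (auto simp: Lam_def \<theta>_def \<phi>_def abs_less_iff)
          moreover have "angle_pi (z X (\<psi> X))" using z\<psi>[of X] X h m by (simp add: angle_pi_iff_cos)
          moreover have "dist (X, \<psi> X) (X0, Y0) < r" using \<eta>(2) X h by auto
          moreover have "\<bar>t X (\<psi> X) - t X0 Y0\<bar> < \<delta>" using X(2) \<tau> by (auto simp: \<theta>_def abs_less_iff)
          ultimately show "(\<gamma> \<tau>, \<tau>) \<in> ?L" by (intro image_eqI[of _ _ "(X, \<psi> X)"]) (auto simp: pi_level_def dist_commute)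
        qed
      qed
      with \<delta>0 show "\<exists>\<delta>0\<in>{0<..d}. \<forall>\<delta>\<in>{0<..\<delta>0}.
        Lam x t ` (ball (X0, Y0) r \<inter> {P. \<bar>t @@ P - t X0 Y0\<bar> < \<delta>} \<inter> pi_level z)
          = graph_over \<gamma> {t X0 Y0 - \<delta><..<t X0 Y0 + \<delta>}" by (intro bexI[of _ \<delta>0]) auto
    qed
  qed
qed

end

context semilinear_flow
begin

interpretation sw: semilinear_flow c "\<lambda>X Y. u Y X" "\<lambda>X Y. z Y X" "\<lambda>X Y. w Y X" "\<lambda>X Y. q Y X" "\<lambda>X Y. p Y X"
    "\<lambda>X Y. - x Y X" "\<lambda>X Y. t Y X"
  by (rule swapped)

lemma crossing_curves:
  assumes w: "angle_pi (w X0 Y0)" and z: "angle_pi (z X0 Y0)" and wX: "dX w X0 Y0 \<noteq> 0" and zY: "dY z X0 Y0 \<noteq> 0"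
  shows "curves_cross w z x t X0 Y0"
proof -
  let ?t = "t X0 Y0"
  obtain d1 r1 \<gamma>z where
    1: "0 < d1" "0 < r1" "continuous_on {?t - d1<..<?t + d1} \<gamma>z" "\<gamma>z ?t = x X0 Y0"
    and mono1: "\<forall>\<tau>\<in>{?t - d1<..<?t + d1}. \<forall>\<tau>'\<in>{?t - d1<..<?t + d1}. \<tau> < \<tau>' \<longrightarrow> \<gamma>z \<tau> < \<gamma>z \<tau>'"
    and lev1: "\<forall>e\<in>{0<..r1}. \<exists>\<delta>0\<in>{0<..d1}. \<forall>\<delta>\<in>{0<..\<delta>0}.
      Lam x t ` (ball (X0, Y0) e \<inter> {P. \<bar>t @@ P - ?t\<bar> < \<delta>} \<inter> pi_level z) = graph_over \<gamma>z {?t - \<delta><..<?t + \<delta>}"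
    by (rule z_level_curve_at_crossing[OF assms])
  have "dX (\<lambda>X Y. z Y X) Y0 X0 \<noteq> 0" "dY (\<lambda>X Y. w Y X) Y0 X0 \<noteq> 0"
    using wX zY by (simp_all add: dX_swap[of z] dY_swap[of w])
  then obtain d2 r2 \<gamma>w where
    2: "0 < d2" "0 < r2" "continuous_on {?t - d2<..<?t + d2} \<gamma>w" "\<gamma>w ?t = - x X0 Y0"
    and mono2: "\<forall>\<tau>\<in>{?t - d2<..<?t + d2}. \<forall>\<tau>'\<in>{?t - d2<..<?t + d2}. \<tau> < \<tau>' \<longrightarrow> \<gamma>w \<tau> < \<gamma>w \<tau>'"
    and lev2: "\<forall>e\<in>{0<..r2}. \<exists>\<delta>0\<in>{0<..d2}. \<forall>\<delta>\<in>{0<..\<delta>0}.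
      Lam (\<lambda>X Y. - x Y X) (\<lambda>X Y. t Y X) ` (ball (Y0, X0) e \<inter> {P. \<bar>t (snd P) (fst P) - ?t\<bar> < \<delta>} \<inter> pi_level (\<lambda>X Y. w Y X))
        = graph_over \<gamma>w {?t - \<delta><..<?t + \<delta>}"
    by (rule sw.z_level_curve_at_crossing[OF z w])
  define d where "d = min d1 d2"
  have d: "0 < d" "d \<le> d1" "d \<le> d2" using 1 2 by (auto simp: d_def)
  show ?thesis
    unfolding curves_cross_def Let_def
  proof (rule exI[of _ d], rule conjI[OF d(1)], rule exI[of _ "\<lambda>\<tau>. - \<gamma>w \<tau>"], rule exI[of _ \<gamma>z], intro conjI)
    show "continuous_on {?t - d<..<?t + d} (\<lambda>\<tau>. - \<gamma>w \<tau>)"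
      by (intro continuous_on_minus continuous_on_subset[OF 2(3)]) (use d in auto)
    show "continuous_on {?t - d<..<?t + d} \<gamma>z"
      by (intro continuous_on_subset[OF 1(3)]) (use d in auto)
    show "- \<gamma>w ?t = x X0 Y0" "\<gamma>z ?t = x X0 Y0" using 1 2 by simp_all
    show "\<forall>\<tau>1\<in>{?t - d<..<?t}. \<forall>\<tau>2\<in>{?t<..<?t + d}. (- \<gamma>w \<tau>1 - \<gamma>z \<tau>1) * (- \<gamma>w \<tau>2 - \<gamma>z \<tau>2) < 0"
    proof (intro ballI)
      fix \<tau>1 \<tau>2 assume \<tau>: "\<tau>1 \<in> {?t - d<..<?t}" "\<tau>2 \<in> {?t<..<?t + d}"
      have "\<gamma>w \<tau>1 < - x X0 Y0" "- x X0 Y0 < \<gamma>w \<tau>2"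
        using mono2[rule_format, of \<tau>1 ?t] mono2[rule_format, of ?t \<tau>2] \<tau> d 2 by auto
      moreover have "\<gamma>z \<tau>1 < x X0 Y0" "x X0 Y0 < \<gamma>z \<tau>2"
        using mono1[rule_format, of \<tau>1 ?t] mono1[rule_format, of ?t \<tau>2] \<tau> d 1 by auto
      ultimately have "0 < - \<gamma>w \<tau>1 - \<gamma>z \<tau>1" "- \<gamma>w \<tau>2 - \<gamma>z \<tau>2 < 0" by simp_all
      then show "(- \<gamma>w \<tau>1 - \<gamma>z \<tau>1) * (- \<gamma>w \<tau>2 - \<gamma>z \<tau>2) < 0" by (rule mult_pos_neg)
    qed
    show "\<forall>e>0. \<exists>N. \<exists>\<delta>\<in>{0<..d}. open N \<and> (X0, Y0) \<in> N \<and> N \<subseteq> ball (X0, Y0) e \<and>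
        Lam x t ` (N \<inter> pi_level w) = graph_over (\<lambda>\<tau>. - \<gamma>w \<tau>) {?t - \<delta><..<?t + \<delta>} \<and>
        Lam x t ` (N \<inter> pi_level z) = graph_over \<gamma>z {?t - \<delta><..<?t + \<delta>}"
    proof (intro allI impI)
      fix e0 :: real assume "0 < e0"
      define e where "e = min e0 (min r1 r2)"
      have e: "e \<in> {0<..r1}" "e \<in> {0<..r2}" "e \<le> e0" using \<open>0 < e0\<close> 1 2 by (auto simp: e_def)
      from bspec[OF lev1 e(1)] obtain \<delta>1 where \<delta>1: "\<delta>1 \<in> {0<..d1}" and
        L1: "\<forall>\<delta>\<in>{0<..\<delta>1}. Lam x t ` (ball (X0, Y0) e \<inter> {P. \<bar>t @@ P - ?t\<bar> < \<delta>} \<inter> pi_level z)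
          = graph_over \<gamma>z {?t - \<delta><..<?t + \<delta>}" by (rule bexE)
      from bspec[OF lev2 e(2)] obtain \<delta>2 where \<delta>2: "\<delta>2 \<in> {0<..d2}" and
        L2: "\<forall>\<delta>\<in>{0<..\<delta>2}. Lam (\<lambda>X Y. - x Y X) (\<lambda>X Y. t Y X) `
            (ball (Y0, X0) e \<inter> {P. \<bar>t (snd P) (fst P) - ?t\<bar> < \<delta>} \<inter> pi_level (\<lambda>X Y. w Y X))
          = graph_over \<gamma>w {?t - \<delta><..<?t + \<delta>}" by (rule bexE)
      define \<delta> where "\<delta> = min d (min \<delta>1 \<delta>2)"
      have \<delta>: "\<delta> \<in> {0<..d}" "\<delta> \<in> {0<..\<delta>1}" "\<delta> \<in> {0<..\<delta>2}" using \<delta>1 \<delta>2 d by (auto simp: \<delta>_def)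
      define N where "N = ball (X0, Y0) e \<inter> {P. \<bar>t @@ P - ?t\<bar> < \<delta>}"
      have ct: "continuous_on UNIV (\<lambda>P. t @@ P)"
        using cont_t by (simp add: jointly_continuous_def case_prod_beta)
      have "open {P. \<bar>t @@ P - ?t\<bar> < \<delta>}"
        by (intro open_Collect_less continuous_intros ct)
      then have "open N" by (auto simp: N_def)
      moreover have "(X0, Y0) \<in> N" using e \<delta> by (auto simp: N_def)
      moreover have "N \<subseteq> ball (X0, Y0) e0" using e by (auto simp: N_def)
      moreover have "Lam x t ` (N \<inter> pi_level z) = graph_over \<gamma>z {?t - \<delta><..<?t + \<delta>}"
        using L1 \<delta> unfolding N_def by blast
      moreover have "Lam x t ` (N \<inter> pi_level w) = graph_over (\<lambda>\<tau>. - \<gamma>w \<tau>) {?t - \<delta><..<?t + \<delta>}"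
      proof -
        have sym: "dist (Y, X) (Y0, X0) = dist (X, Y) (X0, Y0)" for X Y :: real
          by (simp add: dist_prod_def add.commute)
        have "N \<inter> pi_level w = prod.swap ` (ball (Y0, X0) e \<inter> {P. \<bar>t (snd P) (fst P) - ?t\<bar> < \<delta>} \<inter> pi_level (\<lambda>X Y. w Y X))"
          by (force simp: N_def pi_level_def dist_commute sym)
        moreover have "Lam x t (prod.swap P) = (\<lambda>(\<xi>, \<tau>). (- \<xi>, \<tau>)) (Lam (\<lambda>X Y. - x Y X) (\<lambda>X Y. t Y X) P)" for P
          by (cases P) (simp add: Lam_def)
        ultimately have "Lam x t ` (N \<inter> pi_level w) = (\<lambda>(\<xi>, \<tau>). (- \<xi>, \<tau>)) ` graph_over \<gamma>w {?t - \<delta><..<?t + \<delta>}"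
          unfolding bspec[OF L2 \<delta>(3), symmetric] by (simp add: image_image)
        then show ?thesis by (simp add: graph_over_def image_image)
      qed
      ultimately show "\<exists>N. \<exists>\<delta>\<in>{0<..d}. open N \<and> (X0, Y0) \<in> N \<and> N \<subseteq> ball (X0, Y0) e0 \<and>
        Lam x t ` (N \<inter> pi_level w) = graph_over (\<lambda>\<tau>. - \<gamma>w \<tau>) {?t - \<delta><..<?t + \<delta>} \<and>
        Lam x t ` (N \<inter> pi_level z) = graph_over \<gamma>z {?t - \<delta><..<?t + \<delta>}" using \<delta>(1) by blast
    qed
  qed
qed

text \<open>The sign \<open>\<epsilon>\<close> reverses time.  With \<open>\<epsilon> = 1\<close> this is the origin of two curves for \<open>w\<^sub>Y < 0\<close>, with \<open>\<epsilon> = -1\<close>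
their end for \<open>w\<^sub>Y > 0\<close>.  Along the level curve the time \<open>\<theta> = \<epsilon> t\<close> has a strict minimum at \<open>P\<close>; each of the two
monotone halves gives one curve.  At no later time do the two curves meet, by injectivity of \<open>\<Lambda>\<close>; so
their minimum and maximum are the left and the right curve, whichever half they come from.\<close>

lemma branching_curves:
  assumes pi: "angle_pi (w X0 Y0)" and wX: "dX w X0 Y0 = 0" and wXX: "0 < dX (dX w) X0 Y0"
    and z: "cos (z X0 Y0) \<noteq> - 1" and wY: "\<epsilon> * dY w X0 Y0 < 0" and \<epsilon>: "\<epsilon> * \<epsilon> = (1::real)"
  shows "curves_originate w z x (\<lambda>X Y. \<epsilon> * t X Y) X0 Y0"
proof -
  let ?T = "\<lambda>X Y. \<epsilon> * t X Y"
  define T0 where "T0 = \<epsilon> * t X0 Y0"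
  have \<epsilon>_nz: "\<epsilon> \<noteq> 0" using \<epsilon> by auto
  have wY0: "dY w X0 Y0 \<noteq> 0" using wY by auto
  have nd: "nondegenerate X0 Y0" using wXX z by (simp add: nondegenerate_def)
  \<comment> \<open>All that has to hold in the box on which the level set is a graph.\<close>
  define Q where "Q P \<longleftrightarrow> dist (w @@ P) (w X0 Y0) < 2 * pi \<and> cos (z @@ P) \<noteq> - 1 \<and>
      \<epsilon> * dY w @@ P < 0 \<and> (\<forall>B. Lam x t B = Lam x t P \<longrightarrow> B = P)" for P
  have Q: "\<forall>\<^sub>F P in nhds (X0, Y0). Q P"
    unfolding Q_def
  proof (intro eventually_conj)
    show "\<forall>\<^sub>F P in nhds (X0, Y0). dist (w @@ P) (w X0 Y0) < 2 * pi"
      by (rule tendstoD[OF smooth_plane_tendsto[OF smooth_w]]) simp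
    show "\<forall>\<^sub>F P in nhds (X0, Y0). cos (z @@ P) \<noteq> - 1"
      by (rule tendsto_imp_eventually_ne[OF tendsto_cos[OF smooth_plane_tendsto[OF smooth_z]] z])
    show "\<forall>\<^sub>F P in nhds (X0, Y0). \<epsilon> * dY w @@ P < 0"
      by (rule order_tendstoD(2)[OF tendsto_mult[OF tendsto_const smooth_plane_tendsto[OF smooth_planeD(2)[OF smooth_w]]] wY])
    show "\<forall>\<^sub>F P in nhds (X0, Y0). \<forall>B. Lam x t B = Lam x t P \<longrightarrow> B = P" by (rule fibre_unique[OF nd])
  qed
  obtain e \<delta>' \<kappa> where e: "0 < e" "0 < \<delta>'" and \<kappa>0: "\<kappa> X0 = Y0"
    and box: "\<forall>X Y. \<bar>X - X0\<bar> < e \<longrightarrow> \<bar>Y - Y0\<bar> < \<delta>' \<longrightarrow> Q (X, Y) \<and> (w X Y = w X0 Y0 \<longleftrightarrow> Y = \<kappa> X)"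
    and \<kappa>: "\<forall>X. \<bar>X - X0\<bar> < e \<longrightarrow>
      \<bar>\<kappa> X - Y0\<bar> < \<delta>' \<and> DERIV \<kappa> X :> - (dX w X (\<kappa> X) / dY w X (\<kappa> X))"
    by (rule implicit_graph[OF smooth_w wY0 Q])
  have near: "Q (X, Y)" and graph: "w X Y = w X0 Y0 \<longleftrightarrow> Y = \<kappa> X" if "\<bar>X - X0\<bar> < e" "\<bar>Y - Y0\<bar> < \<delta>'" for X Y
    using box[rule_format, OF that] by auto
  have \<kappa>_box: "\<bar>\<kappa> X - Y0\<bar> < \<delta>'"
    and \<kappa>_der: "DERIV \<kappa> X :> - (dX w X (\<kappa> X) / dY w X (\<kappa> X))" if "\<bar>X - X0\<bar> < e" for X
    using \<kappa>[rule_format, OF that] by auto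
  have w\<kappa>: "cos (w X (\<kappa> X)) = - 1" "angle_pi (w X (\<kappa> X))" if "\<bar>X - X0\<bar> < e" for X
    using graph[OF that \<kappa>_box[OF that]] pi by (simp_all add: angle_pi_iff_cos)
  have "DERIV (\<lambda>s. dX w s (\<kappa> s)) X0 :> dX (dX w) X0 (\<kappa> X0)
      + dY (dX w) X0 (\<kappa> X0) * - (dX w X0 (\<kappa> X0) / dY w X0 (\<kappa> X0))"
    by (rule DERIV_along_graph[OF smooth_planeD(4,5)[OF smooth_planeD(1)[OF smooth_w]]
          smooth_planeD(3)[OF smooth_planeD(2)[OF smooth_planeD(1)[OF smooth_w]]] \<kappa>_der])
      (use e in simp)
  \<comment> \<open>As \<open>w\<^sub>X\<close> vanishes at \<open>P\<close> and \<open>w\<^sub>X\<^sub>X > 0\<close>, it changes sign along the curve, in spite of the slope of the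
    curve.\<close>
  then have wX_der: "DERIV (\<lambda>s. dX w s (\<kappa> s)) X0 :> dX (dX w) X0 Y0" by (simp add: \<kappa>0 wX)
  obtain e2 where e2: "0 < e2" "\<And>h. 0 < h \<Longrightarrow> h < e2 \<Longrightarrow> 0 < dX w (X0 + h) (\<kappa> (X0 + h))"
    using DERIV_pos_inc_right[OF wX_der wXX] by (auto simp: \<kappa>0 wX)
  obtain e3 where e3: "0 < e3" "\<And>h. 0 < h \<Longrightarrow> h < e3 \<Longrightarrow> dX w (X0 - h) (\<kappa> (X0 - h)) < 0"
    using DERIV_pos_inc_left[OF wX_der wXX] by (auto simp: \<kappa>0 wX)
  define m where "m = min e (min e2 e3) / 2"
  have m: "0 < m" "m < e" "m < e2" "m < e3" using e e2(1) e3(1) by (auto simp: m_def min_def)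
  define \<theta> where "\<theta> X = ?T X (\<kappa> X)" for X
  define \<phi> where "\<phi> X = x X (\<kappa> X)" for X
  \<comment> \<open>The derivative of \<open>\<theta>\<close> is \<open>\<epsilon> t\<^sub>Y \<kappa>'\<close>, since \<open>t\<^sub>X = 0\<close> where \<open>w = pi\<close>; with \<open>\<kappa>' = - w\<^sub>X / w\<^sub>Y\<close> it is \<open>w\<^sub>X\<close>
    times a positive factor.\<close>
  define F where "F X = - (\<epsilon> * dY w X (\<kappa> X)) / (dY w X (\<kappa> X))\<^sup>2 * ((1 + cos (z X (\<kappa> X))) * q X (\<kappa> X) / (4 * c (u X (\<kappa> X))))" for X
  have in_e: "\<bar>X - X0\<bar> < e" if "X0 - m \<le> X" "X \<le> X0 + m" for X using that m by (auto simp: abs_less_iff)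
  have \<theta>_der: "DERIV \<theta> X :> dX w X (\<kappa> X) * F X" if "X0 - m \<le> X" "X \<le> X0 + m" for X
  proof -
    have "\<epsilon> * ((1 + - 1) * P / C + R * - (r / b)) = r * (- (\<epsilon> * b) / b\<^sup>2 * R)" for P C R r b
      by (cases "b = 0") (simp_all add: power2_eq_square)
    with DERIV_cmult[OF t_along_graph[OF \<kappa>_der[OF in_e[OF that]]], of \<epsilon>] show ?thesis
      unfolding \<theta>_def[abs_def] F_def w\<kappa>(1)[OF in_e[OF that]] by (simp only:)
  qed
  have F_pos: "0 < F X" if "X0 - m \<le> X" "X \<le> X0 + m" for X
  proof -
    have "Q (X, \<kappa> X)" by (rule near[OF in_e[OF that] \<kappa>_box[OF in_e[OF that]]])
    then have "cos (z X (\<kappa> X)) \<noteq> - 1" "\<epsilon> * dY w X (\<kappa> X) < 0" "dY w X (\<kappa> X) \<noteq> 0" by (auto simp: Q_def)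
    moreover from this have "0 < 1 + cos (z X (\<kappa> X))" using cos_ge_minus_one[of "z X (\<kappa> X)"] by linarith
    ultimately show ?thesis unfolding F_def
      using q_pos[of X "\<kappa> X"] c_pos[of "u X (\<kappa> X)"] by (intro mult_pos_pos divide_pos_pos) simp_all
  qed
  have inc: "\<theta> X < \<theta> X'" if "X0 \<le> X" "X < X'" "X' \<le> X0 + m" for X X'
  proof (rule strictly_increasing_off_point[OF \<theta>_der _ that, of X0])
    show "0 < dX w X (\<kappa> X) * F X" if "X0 \<le> X" "X \<le> X0 + m" "X \<noteq> X0" for X
      using e2(2)[of "X - X0"] F_pos[of X] that m by auto
  qed (use m in auto)
  have dec: "\<theta> X' < \<theta> X" if "X0 - m \<le> X" "X < X'" "X' \<le> X0" for X X'
  proof -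
    have "- \<theta> X < - \<theta> X'"
    proof (rule strictly_increasing_off_point[OF DERIV_minus[OF \<theta>_der] _ that, of X0])
      show "0 < - (dX w X (\<kappa> X) * F X)" if "X0 - m \<le> X" "X \<le> X0" "X \<noteq> X0" for X
        using e3(2)[of "X0 - X"] F_pos[of X] that m by (auto simp: mult_less_0_iff)
    qed (use m in auto)
    then show ?thesis by simp
  qed
  have \<theta>0: "\<theta> X0 = T0" and \<phi>0: "\<phi> X0 = x X0 Y0" by (simp_all add: \<theta>_def \<phi>_def \<kappa>0 T0_def)
  have cont_\<theta>: "continuous_on {X0 - m..X0 + m} \<theta>"
    by (rule DERIV_continuous_on[OF has_field_derivative_at_within]) (rule \<theta>_der; simp)
  have cont_\<phi>: "continuous_on {X0 - m..X0 + m} \<phi>" unfolding \<phi>_def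
    by (rule DERIV_continuous_on[OF has_field_derivative_at_within]) (rule x_along_graph[OF \<kappa>_der[OF in_e]]; simp)
  have in_m: "{X0..X0 + m} \<subseteq> {X0 - m..X0 + m}" "{X0 - m..X0} \<subseteq> {X0 - m..X0 + m}" using m by auto
  note cont_p = continuous_on_subset[OF cont_\<theta> in_m(1)] and cont_m = continuous_on_subset[OF cont_\<theta> in_m(2)]
  have "inj_on \<theta> {X0..X0 + m}" by (rule linorder_inj_onI) (use inc in \<open>force+\<close>)
  then obtain \<gamma>2 where \<gamma>2_cont: "continuous_on (\<theta> ` {X0..X0 + m}) \<gamma>2" and \<gamma>2: "\<forall>X\<in>{X0..X0 + m}. \<gamma>2 (\<theta> X) = \<phi> X"
    by (rule curve_as_graph[OF cont_p continuous_on_subset[OF cont_\<phi> in_m(1)]])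
  have "inj_on \<theta> {X0 - m..X0}" by (rule linorder_inj_onI) (use dec in \<open>force+\<close>)
  then obtain \<gamma>1 where \<gamma>1_cont: "continuous_on (\<theta> ` {X0 - m..X0}) \<gamma>1" and \<gamma>1: "\<forall>X\<in>{X0 - m..X0}. \<gamma>1 (\<theta> X) = \<phi> X"
    by (rule curve_as_graph[OF cont_m continuous_on_subset[OF cont_\<phi> in_m(2)]])
  define d where "d = min (\<theta> (X0 + m) - T0) (\<theta> (X0 - m) - T0)"
  have d: "0 < d" using inc[of X0 "X0 + m"] dec[of "X0 - m" X0] m by (simp add: d_def \<theta>0)
  have reach: "\<exists>X\<in>{X0..X0 + m}. \<theta> X = \<tau>" "\<exists>X\<in>{X0 - m..X0}. \<theta> X = \<tau>" if "\<tau> \<in> {T0..T0 + d}" for \<tau>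
    using IVT'[OF _ _ _ cont_p, of \<tau>] IVT2'[OF _ _ _ cont_m, of \<tau>] that m by (force simp: d_def \<theta>0)+
  have cont1: "continuous_on {T0..T0 + d} \<gamma>1" by (rule continuous_on_subset[OF \<gamma>1_cont]) (use reach(2) in blast)
  have cont2: "continuous_on {T0..T0 + d} \<gamma>2" by (rule continuous_on_subset[OF \<gamma>2_cont]) (use reach(1) in blast)
  have init: "\<gamma>1 T0 = x X0 Y0" "\<gamma>2 T0 = x X0 Y0"
    using bspec[OF \<gamma>1, of X0] bspec[OF \<gamma>2, of X0] m by (simp_all add: \<theta>0 \<phi>0)
  have ne: "\<gamma>1 \<tau> \<noteq> \<gamma>2 \<tau>" if \<tau>: "\<tau> \<in> {T0<..<T0 + d}" for \<tau>
  proof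
    assume eq: "\<gamma>1 \<tau> = \<gamma>2 \<tau>"
    obtain X X' where X: "X \<in> {X0 - m..X0}" "\<theta> X = \<tau>" "X' \<in> {X0..X0 + m}" "\<theta> X' = \<tau>"
      using reach[of \<tau>] \<tau> by auto
    have "\<phi> X = \<phi> X'" using eq bspec[OF \<gamma>1 X(1)] bspec[OF \<gamma>2 X(3)] X by simp
    moreover have "\<epsilon> * t X (\<kappa> X) = \<epsilon> * t X' (\<kappa> X')" using X by (simp add: \<theta>_def)
    then have "t X (\<kappa> X) = t X' (\<kappa> X')" using \<epsilon>_nz by simp
    ultimately have "Lam x t (X, \<kappa> X) = Lam x t (X', \<kappa> X')" by (simp add: Lam_def \<phi>_def)
    moreover have "Q (X', \<kappa> X')" using X m by (intro near \<kappa>_box in_e) auto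
    ultimately have "X = X'" by (auto simp: Q_def)
    then have "X = X0" using X by auto
    then show False using X(2) \<theta>0 \<tau> by simp
  qed
  define \<gamma>l where "\<gamma>l \<tau> = min (\<gamma>1 \<tau>) (\<gamma>2 \<tau>)" for \<tau>
  define \<gamma>r where "\<gamma>r \<tau> = max (\<gamma>1 \<tau>) (\<gamma>2 \<tau>)" for \<tau>
  have contlr: "continuous_on {T0..T0 + d} \<gamma>l" "continuous_on {T0..T0 + d} \<gamma>r"
    unfolding \<gamma>l_def \<gamma>r_def using cont1 cont2 by (simp_all add: continuous_on_min continuous_on_max)
  have lim: "(f \<longlongrightarrow> f T0) (at_right T0)" if "continuous_on {T0..T0 + d} f" for f :: "real \<Rightarrow> real"
    using that d unfolding continuous_on_def by (auto simp: at_within_Icc_at_right dest!: bspec[where x = T0])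
  have union: "graph_over \<gamma>l I \<union> graph_over \<gamma>r I = graph_over \<gamma>1 I \<union> graph_over \<gamma>2 I" for I
  proof -
    have "graph_over f I = {P. snd P \<in> I \<and> fst P = f (snd P)}" for f by (auto simp: graph_over_def)
    then show ?thesis by (auto simp: \<gamma>l_def \<gamma>r_def min_def max_def)
  qed
  have on_curve: "Y = \<kappa> X" if "\<bar>X - X0\<bar> < m" "\<bar>Y - Y0\<bar> < \<delta>'" "angle_pi (w X Y)" for X Y
  proof -
    have "\<bar>X - X0\<bar> < e" using that m by simp
    then have "\<bar>w X Y - w X0 Y0\<bar> < 2 * pi" using near[of X Y] that(2) by (auto simp: Q_def dist_real_def)
    then have "w X Y = w X0 Y0" using angle_pi_near[OF pi] that(3) by blast
    then show ?thesis using graph[OF \<open>\<bar>X - X0\<bar> < e\<close> that(2)] by simp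
  qed
  have \<theta>_ge: "T0 \<le> \<theta> X" if "\<bar>X - X0\<bar> < m" for X
    using inc[of X0 X] dec[of X X0] that \<theta>0 by (cases X X0 rule: linorder_cases) (auto simp: abs_less_iff)
  have level: "\<exists>N. \<exists>\<delta>\<in>{0<..d}. open N \<and> (X0, Y0) \<in> N \<and> N \<subseteq> ball (X0, Y0) r0 \<and>
      Lam x ?T ` (N \<inter> pi_level w) =
        insert (x X0 Y0, T0) (graph_over \<gamma>l {T0<..<T0 + \<delta>} \<union> graph_over \<gamma>r {T0<..<T0 + \<delta>})" if "0 < r0" for r0
  proof -
    define r where "r = min r0 (min m \<delta>')"
    have r: "0 < r" "r \<le> r0" "r \<le> m" "r \<le> \<delta>'" using that m e by (auto simp: r_def)
    have "isCont \<kappa> X0" using DERIV_isCont[OF \<kappa>_der[of X0]] e by simp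
    then obtain \<eta> where \<eta>: "0 < \<eta>" "\<And>X. \<bar>X - X0\<bar> < \<eta> \<Longrightarrow> dist (X, \<kappa> X) (X0, Y0) < r"
      using curve_in_ball[of X0 \<kappa> r] r \<kappa>0 by auto
    \<comment> \<open>A time below \<open>T0 + \<delta>\<close> forces \<open>\<bar>X - X0\<bar> < h\<close>, so the time slab cuts the curve inside the ball.\<close>
    define h where "h = min (\<eta> / 2) m"
    have h: "0 < h" "h < \<eta>" "h \<le> m" using \<eta>(1) m by (auto simp: h_def min_def)
    define \<delta> where "\<delta> = min d (min (\<theta> (X0 + h) - T0) (\<theta> (X0 - h) - T0))"
    have \<delta>: "0 < \<delta>" "\<delta> \<le> d" using d inc[of X0 "X0 + h"] dec[of "X0 - h" X0] h by (auto simp: \<delta>_def \<theta>0)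
    define N where "N = ball (X0, Y0) r \<inter> {P. ?T @@ P < T0 + \<delta>}"
    have N: "(X, Y) \<in> N \<longleftrightarrow> dist (X, Y) (X0, Y0) < r \<and> ?T X Y < T0 + \<delta>" for X Y
      by (auto simp: N_def dist_commute)
    have ct: "continuous_on UNIV (\<lambda>P. t @@ P)"
      using cont_t by (simp add: jointly_continuous_def case_prod_beta)
    have "open {P. ?T @@ P < T0 + \<delta>}" by (intro open_Collect_less continuous_intros ct)
    then have "open N" by (auto simp: N_def)
    moreover have "(X0, Y0) \<in> N" using r \<delta> by (simp add: N_def T0_def)
    moreover have "N \<subseteq> ball (X0, Y0) r0" using r by (auto simp: N_def)
    moreover have "Lam x ?T ` (N \<inter> pi_level w) =
        insert (x X0 Y0, T0) (graph_over \<gamma>1 {T0<..<T0 + \<delta>} \<union> graph_over \<gamma>2 {T0<..<T0 + \<delta>})" (is "?L = ?R")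
    proof
      show "?L \<subseteq> ?R"
      proof (rule image_subsetI)
        fix P assume P: "P \<in> N \<inter> pi_level w"
        obtain X Y where P_eq: "P = (X, Y)" by (cases P)
        have XY: "(X, Y) \<in> N" "(X, Y) \<in> pi_level w" using P P_eq by auto
        have box: "\<bar>X - X0\<bar> < m" "\<bar>Y - Y0\<bar> < \<delta>'" using dist_pair_le_abs[of X Y X0 Y0 r] XY(1) r by (auto simp: N)
        have Y: "Y = \<kappa> X" using on_curve[OF box] XY(2) by (simp add: pi_level_def)
        have L: "Lam x ?T (X, Y) = (\<phi> X, \<theta> X)" by (simp add: Lam_def \<phi>_def \<theta>_def Y)
        have lt: "\<theta> X < T0 + \<delta>" using XY(1) by (simp add: N \<theta>_def Y)
        have "Lam x ?T (X, Y) \<in> ?R"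
        proof (cases X X0 rule: linorder_cases)
          case equal
          then show ?thesis using L \<theta>0 \<phi>0 by simp
        next
          case less
          have "T0 < \<theta> X" using dec[of X X0] less box \<theta>0 by auto
          moreover have "\<gamma>1 (\<theta> X) = \<phi> X" using bspec[OF \<gamma>1, of X] less box by auto
          ultimately show ?thesis unfolding L graph_over_def using lt by force
        next
          case greater
          have "T0 < \<theta> X" using inc[of X0 X] greater box \<theta>0 by auto
          moreover have "\<gamma>2 (\<theta> X) = \<phi> X" using bspec[OF \<gamma>2, of X] greater box by auto
          ultimately show ?thesis unfolding L graph_over_def using lt by force
        qed
        then show "Lam x ?T P \<in> ?R" by (simp add: P_eq)
      qed
      have in_L: "(\<phi> X, \<theta> X) \<in> ?L" if X: "\<bar>X - X0\<bar> \<le> m" "\<theta> X < T0 + \<delta>" for X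
      proof -
        have "\<theta> X < \<theta> (X0 + h)" "\<theta> X < \<theta> (X0 - h)" using X(2) by (auto simp: \<delta>_def)
        then have "\<not> X \<le> X0 - h" "\<not> X0 + h \<le> X"
          using inc[of "X0 + h" X] dec[of X "X0 - h"] X(1) h by (cases "X = X0 + h"; cases "X = X0 - h"; auto simp: abs_le_iff)+
        then have "\<bar>X - X0\<bar> < \<eta>" using h by (simp add: abs_less_iff)
        then have "(X, \<kappa> X) \<in> N" using \<eta>(2) X(2) by (simp add: N \<theta>_def)
        moreover have "(X, \<kappa> X) \<in> pi_level w" using w\<kappa>(2)[of X] X(1) m by (simp add: pi_level_def)
        moreover have "Lam x ?T (X, \<kappa> X) = (\<phi> X, \<theta> X)" by (simp add: Lam_def \<phi>_def \<theta>_def)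
        ultimately show ?thesis by (metis IntI image_eqI)
      qed
      have "(x X0 Y0, T0) \<in> ?L" using in_L[of X0] m \<delta> by (simp add: \<theta>0 \<phi>0)
      moreover have "(\<gamma>1 \<tau>, \<tau>) \<in> ?L" "(\<gamma>2 \<tau>, \<tau>) \<in> ?L" if \<tau>: "\<tau> \<in> {T0<..<T0 + \<delta>}" for \<tau>
      proof -
        obtain X X' where X: "X \<in> {X0 - m..X0}" "\<theta> X = \<tau>" "X' \<in> {X0..X0 + m}" "\<theta> X' = \<tau>"
          using reach[of \<tau>] \<tau> \<delta> by auto
        show "(\<gamma>1 \<tau>, \<tau>) \<in> ?L" using in_L[of X] bspec[OF \<gamma>1 X(1)] X \<tau> by auto
        show "(\<gamma>2 \<tau>, \<tau>) \<in> ?L" using in_L[of X'] bspec[OF \<gamma>2 X(3)] X \<tau> by auto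
      qed
      ultimately show "?R \<subseteq> ?L" by (auto simp: graph_over_def)
    qed
    ultimately show ?thesis using \<delta> unfolding union by (intro exI[of _ N] bexI[of _ \<delta>]) auto
  qed
  \<comment> \<open>A singular point near \<open>P\<close> lies on the level curve of \<open>w\<close>, as \<open>z \<noteq> pi\<close> there, and on this curve the time
    is at least \<open>T0\<close>.  Preimages need only be sought near \<open>P\<close>.\<close>
  have past: "\<forall>\<^sub>F (\<xi>, \<tau>) in nhds (x X0 Y0, T0). \<tau> < T0 \<longrightarrow> (\<xi>, \<tau>) \<notin> singular_points w z x ?T"
  proof -
    have "\<forall>\<^sub>F P in nhds (X0, Y0). dist P (X0, Y0) < min m \<delta>'" unfolding eventually_nhds_metric using m e
      by (intro exI[of _ "min m \<delta>'"]) auto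
    from Lam_nhds[OF nd eventually_conj[OF Q this]]
    have ev: "\<forall>\<^sub>F B in nhds (x X0 Y0, t X0 Y0). \<exists>A. B = Lam x t A \<and> Q A \<and> dist A (X0, Y0) < min m \<delta>'" .
    have "((\<lambda>B. (fst B, \<epsilon> * snd B)) \<longlongrightarrow> (x X0 Y0, \<epsilon> * T0)) (nhds (x X0 Y0, T0))"
      by (intro tendsto_Pair tendsto_fst_nhds tendsto_mult[OF tendsto_const tendsto_snd_nhds])
    then have "filterlim (\<lambda>B. (fst B, \<epsilon> * snd B)) (nhds (x X0 Y0, t X0 Y0)) (nhds (x X0 Y0, T0))"
      using \<epsilon> by (simp add: T0_def mult.assoc[symmetric])
    from eventually_compose_filterlim[OF ev this] show ?thesis
    proof eventually_elim
      case (elim B)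
      obtain \<xi> \<tau> where B: "B = (\<xi>, \<tau>)" by (cases B)
      obtain A where A: "(\<xi>, \<epsilon> * \<tau>) = Lam x t A" "Q A" "dist A (X0, Y0) < min m \<delta>'" using elim B by auto
      have "(\<xi>, \<tau>) \<notin> singular_points w z x ?T" if "\<tau> < T0"
      proof
        assume "(\<xi>, \<tau>) \<in> singular_points w z x ?T"
        then obtain X Y where XY: "(X, Y) \<in> pi_level w \<union> pi_level z" "x X Y = \<xi>" "\<epsilon> * t X Y = \<tau>"
          by (auto simp: singular_points_def Lam_def)
        have "\<epsilon> * \<tau> = t X Y" unfolding XY(3)[symmetric] using \<epsilon> by (simp add: mult.assoc[symmetric])
        then have "Lam x t (X, Y) = Lam x t A" using A(1) XY(2) by (simp add: Lam_def)
        then have A_eq: "A = (X, Y)" using A(2) unfolding Q_def by blast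
        have "\<not> angle_pi (z X Y)" using A(2) by (simp add: A_eq Q_def angle_pi_iff_cos)
        then have "angle_pi (w X Y)" using XY(1) by (auto simp: pi_level_def)
        moreover have box: "\<bar>X - X0\<bar> < m" "\<bar>Y - Y0\<bar> < \<delta>'"
          using dist_pair_le_abs[of X Y X0 Y0 "min m \<delta>'"] A(3) by (auto simp: A_eq)
        ultimately have "Y = \<kappa> X" by (intro on_curve)
        then have "\<theta> X = \<tau>" using XY(3) by (simp add: \<theta>_def)
        then show False using \<theta>_ge[OF box(1)] that by simp
      qed
      then show ?case by (simp add: B)
    qed
  qed
  show ?thesis
    unfolding curves_originate_def Let_def T0_def[symmetric]
  proof (rule conjI, rule exI[of _ d], rule conjI[OF d], rule exI[of _ \<gamma>l], rule exI[of _ \<gamma>r], intro conjI)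
    show "continuous_on {T0<..<T0 + d} \<gamma>l" "continuous_on {T0<..<T0 + d} \<gamma>r"
      by (rule continuous_on_subset[OF contlr(1)], force, rule continuous_on_subset[OF contlr(2)], force)
    show "\<forall>\<tau>\<in>{T0<..<T0 + d}. \<gamma>l \<tau> < \<gamma>r \<tau>" using ne by (force simp: \<gamma>l_def \<gamma>r_def min_def max_def)
    show "(\<gamma>l \<longlongrightarrow> x X0 Y0) (at_right T0)" "(\<gamma>r \<longlongrightarrow> x X0 Y0) (at_right T0)"
      using lim[OF contlr(1)] lim[OF contlr(2)] init by (simp_all add: \<gamma>l_def \<gamma>r_def)
    show "\<forall>r0>0. \<exists>N. \<exists>\<delta>\<in>{0<..d}. open N \<and> (X0, Y0) \<in> N \<and> N \<subseteq> ball (X0, Y0) r0 \<and>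
      Lam x ?T ` (N \<inter> pi_level w) =
        insert (x X0 Y0, T0) (graph_over \<gamma>l {T0<..<T0 + \<delta>} \<union> graph_over \<gamma>r {T0<..<T0 + \<delta>})"
      using level by blast
    show "\<forall>\<^sub>F (\<xi>, \<tau>) in nhds (x X0 Y0, T0). \<tau> < T0 \<longrightarrow> (\<xi>, \<tau>) \<notin> singular_points w z x ?T" by (rule past)
  qed
qed

end

section \<open>The conservative solution\<close>

lemma linear_ode_pos:
  fixes y K :: "real \<Rightarrow> real"
  assumes y: "\<And>s. DERIV y s :> K s * y s" and K: "continuous_on UNIV K" and pos: "0 < y s0"
  shows "0 < y s"
proof -
  define a where "a = min s s0" define b where "b = max s s0"
  obtain g where g: "\<And>r. r \<in> {a..b} \<Longrightarrow> (g has_vector_derivative K r) (at r within {a..b})"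
    using antiderivative_continuous[of a b K] K continuous_on_subset by blast
  have D: "((\<lambda>r. y r * exp (- g r)) has_real_derivative 0) (at r within {a..b})" if "r \<in> {a..b}" for r
  proof -
    have "(g has_real_derivative K r) (at r within {a..b})"
      using g[OF that] by (simp add: has_real_derivative_iff_has_vector_derivative)
    then show ?thesis
      by (auto intro!: derivative_eq_intros has_field_derivative_at_within[OF y])
  qed
  have "\<exists>c. \<forall>r\<in>{a..b}. y r * exp (- g r) = c"
    by (rule has_field_derivative_zero_constant) (use D in auto)
  then obtain C where C: "\<And>r. r \<in> {a..b} \<Longrightarrow> y r * exp (- g r) = C" by blast
  have "y s * exp (- g s) = y s0 * exp (- g s0)" using C[of s] C[of s0] by (simp add: a_def b_def)
  then have "0 < y s * exp (- g s)" using pos by simp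
  then show ?thesis by (simp add: zero_less_mult_iff)
qed

text \<open>The equations for \<open>p\<close> in \<open>Y\<close> and for \<open>q\<close> in \<open>X\<close> are linear, and both are positive on the line where the
data are prescribed.\<close>

lemma semilinear_flow_of_solution:
  assumes A: "assumption_A c" and sol: "semilinear_solution c u0 u1 u w z p q x t"
    and smooth: "\<forall>f \<in> {u, w, z, p, q, x, t}. smooth_plane f"
  shows "semilinear_flow c u w z p q x t"
proof
  show eqs: "semilinear_eqs c u w z p q x t" using sol by (simp add: semilinear_solution_def)
  show su: "smooth_plane u" and sw: "smooth_plane w" and sz: "smooth_plane z" and sp: "smooth_plane p"
    and sq: "smooth_plane q" using smooth by auto
  show "jointly_continuous x" "jointly_continuous t" using smooth by (auto intro: smooth_planeD(3))
  have Ck: "Ck 1 c" using A by (auto simp: assumption_A_def smooth_def)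
  then have "c differentiable_on UNIV" and c'_cont: "continuous_on UNIV (deriv c)" by (auto simp: Ck_def)
  then show cD: "DERIV c v :> deriv c v" for v
    by (simp add: DERIV_deriv_iff_real_differentiable differentiable_on_def)
  show c_pos: "0 < c v" for v
  proof -
    obtain \<kappa> where "0 < \<kappa>" "\<forall>u. \<kappa> \<le> c u" using A by (auto simp: assumption_A_def)
    then show ?thesis using less_le_trans by blast
  qed
  have contX: "continuous_on UNIV (\<lambda>s. f s Y)" and contY: "continuous_on UNIV (\<lambda>s. f X s)"
    if "smooth_plane f" for f and X Y :: real
    using smooth_planeD(4,5)[OF that] by (auto intro!: continuous_at_imp_continuous_on DERIV_isCont)
  have c_cont: "continuous_on UNIV c" using cD by (auto intro!: continuous_at_imp_continuous_on DERIV_isCont)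
  show "0 < p X Y" for X Y
  proof (rule linear_ode_pos[where ?s0.0 = "- X" and y = "p X"])
    show "(p X has_real_derivative
        (deriv c (u X s) / (8 * (c (u X s))\<^sup>2) * (sin (z X s) - sin (w X s)) * q X s) * p X s) (at s)" for s
      using semilinear_eqsD(5)[OF eqs, of X s] by (simp add: mult_ac)
    show "continuous_on UNIV (\<lambda>s. deriv c (u X s) / (8 * (c (u X s))\<^sup>2) * (sin (z X s) - sin (w X s)) * q X s)"
      using c_pos less_imp_neq[OF c_pos, symmetric]
      by (intro continuous_intros continuous_on_compose2[OF c'_cont contY[OF su]] continuous_on_compose2[OF c_cont contY[OF su]]
          contY sq sz sw) auto
    have "p X (- X) = 1 + (R_init c u0 u1 X)\<^sup>2" using sol by (simp add: semilinear_solution_def)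
    then show "0 < p X (- X)" by (simp add: add_pos_nonneg)
  qed
  show "0 < q X Y" for X Y
  proof (rule linear_ode_pos[where ?s0.0 = "- Y" and y = "\<lambda>s. q s Y"])
    show "((\<lambda>s. q s Y) has_real_derivative
        (deriv c (u s Y) / (8 * (c (u s Y))\<^sup>2) * (sin (w s Y) - sin (z s Y)) * p s Y) * q s Y) (at s)" for s
      using semilinear_eqsD(6)[OF eqs, of Y s] by (simp add: mult_ac)
    show "continuous_on UNIV (\<lambda>s. deriv c (u s Y) / (8 * (c (u s Y))\<^sup>2) * (sin (w s Y) - sin (z s Y)) * p s Y)"
      using c_pos less_imp_neq[OF c_pos, symmetric]
      by (intro continuous_intros continuous_on_compose2[OF c'_cont contX[OF su]] continuous_on_compose2[OF c_cont contX[OF su]]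
          contX sp sz sw) auto
    have "q (- Y) (- (- Y)) = 1 + (S_init c u0 u1 (- Y))\<^sup>2" using sol unfolding semilinear_solution_def by blast
    then show "0 < q (- Y) Y" by (simp add: add_pos_nonneg)
  qed
qed

theorem theorem3:
  fixes c u0 u1 :: "real \<Rightarrow> real"
    and u w z p q x t v :: "real \<Rightarrow> real \<Rightarrow> real"
    and D :: "((real \<Rightarrow> real) \<times> (real \<Rightarrow> real)) set"
    and T X0 Y0 x0 t0 uP :: real
  assumes "assumption_A c"
    and "T > 0"
    and "generic_data c T D"
    and "(u0, u1) \<in> D"
    and "smooth u0" and "smooth u1"
    and "semilinear_solution c u0 u1 u w z p q x t"
    and "\<forall>f \<in> {u, w, z, p, q, x, t}. smooth_plane f"
    and "conservative_graph x t u v"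
    and "angle_pi (w X0 Y0)"
    and "x0 = x X0 Y0" and "t0 = t X0 Y0" and "uP = u X0 Y0"
    and "t0 \<in> {0..T}"
  shows
    "(dX w X0 Y0 \<noteq> 0 \<and> \<not> angle_pi (z X0 Y0) \<longrightarrow>
       (\<exists>a b1 b2. a \<noteq> 0 \<and>
          (\<lambda>(\<xi>, \<tau>). v \<xi> \<tau> -
              (v x0 t0 - a * (root 3 (c uP * (\<tau> - t0) + (\<xi> - x0)))\<^sup>2
                + b1 * (\<xi> - x0) + b2 * (\<tau> - t0)))
            \<in> O[nhds (x0, t0)](\<lambda>(\<xi>, \<tau>). (\<bar>\<tau> - t0\<bar> + \<bar>\<xi> - x0\<bar>) powr (4 / 3))))
     \<and>
     (dX w X0 Y0 = 0 \<and> dX (dX w) X0 Y0 > 0 \<longrightarrow>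
       (dY w X0 Y0 < 0 \<and> curves_originate w z x t X0 Y0 \<or>
        dY w X0 Y0 > 0 \<and> curves_terminate w z x t X0 Y0) \<and>
       (\<exists>a. a \<noteq> 0 \<and>
          (\<lambda>(\<xi>, \<tau>). v \<xi> \<tau> -
              (v x0 t0 + a * (root 5 (c uP * (\<tau> - t0) + (\<xi> - x0))) ^ 3))
            \<in> O[nhds (x0, t0)](\<lambda>(\<xi>, \<tau>). (\<bar>\<tau> - t0\<bar> + \<bar>\<xi> - x0\<bar>) powr (4 / 5))))
     \<and>
     (angle_pi (z X0 Y0) \<longrightarrow>
       curves_cross w z x t X0 Y0 \<and>
       (\<exists>a1 a2. a1 \<noteq> 0 \<and> a2 \<noteq> 0 \<and>
          (\<lambda>(\<xi>, \<tau>). v \<xi> \<tau> -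
              (v x0 t0 + a1 * (root 3 (c uP * (\<tau> - t0) + (\<xi> - x0)))\<^sup>2
                + a2 * (root 3 (c uP * (\<tau> - t0) - (\<xi> - x0)))\<^sup>2))
            \<in> O[nhds (x0, t0)](\<lambda>(\<xi>, \<tau>). \<bar>\<tau> - t0\<bar> + \<bar>\<xi> - x0\<bar>)))"
proof -
  interpret semilinear_flow c u w z p q x t
    by (rule semilinear_flow_of_solution[OF assms(1,7,8)])
  note w_pi = assms(10)
  have eqs: "x X0 Y0 = x0" "t X0 Y0 = t0" "u X0 Y0 = uP" by (simp_all add: assms(11-13))
  have gen: "generic_at c u w z X0 Y0"
    using assms(3,4,7,14) unfolding generic_data_def eqs(2)[symmetric] by fast
  have cos_w: "cos (w X0 Y0) = - 1" using w_pi by (simp add: angle_pi_iff_cos)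
  have nd: "nondegenerate X0 Y0"
    using gen unfolding generic_at_def nondegenerate_def angle_pi_iff_cos by blast
  note graph = graph_value[OF assms(9)]
  have v0: "v x0 t0 = uP" using graph[of X0 Y0] by (simp add: eqs)
  note transfer = bigo_transfer[OF nd, unfolded eqs]
  \<comment> \<open>The cases are the conjuncts of the claim: the expansion for Type 1, the curves and the expansion for Type 2,
    and the curves and the expansion for Type 3.\<close>
  show ?thesis
  proof (intro conjI impI, goal_cases)
    case 1
    then have "dX w X0 Y0 \<noteq> 0" "cos (z X0 Y0) \<noteq> - 1" by (auto simp: angle_pi_iff_cos)
    from type1_expansion[OF w_pi this] show ?case
      by (elim ex_forward conj_forward) (assumption, rule transfer, simp add: graph v0 eqs back_char_def)
  next
    case 2
    then have z: "cos (z X0 Y0) \<noteq> - 1" and c': "deriv c (u X0 Y0) \<noteq> 0"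
      using gen w_pi by (auto simp: generic_at_def angle_pi_iff_cos)
    \<comment> \<open>Genericity gives \<open>c'(u) \<noteq> 0\<close> at a point of Type 2.\<close>
    have "dY w X0 Y0 \<noteq> 0" using c' z q_pos[of X0 Y0] cos_w by (simp add: dY_w add_eq_0_iff)
    then consider "dY w X0 Y0 < 0" | "dY w X0 Y0 > 0" by linarith
    then show ?case
    proof cases
      case 1
      then show ?thesis using branching_curves[OF w_pi _ _ z, of 1] 2 by simp
    next
      case 2
      then show ?thesis using branching_curves[OF w_pi _ _ z, of "- 1"] \<open>dX w X0 Y0 = 0 \<and> dX (dX w) X0 Y0 > 0\<close>
        by (simp add: curves_terminate_def)
    qed
  next
    case 3
    then have "dX w X0 Y0 = 0" "dX (dX w) X0 Y0 \<noteq> 0" "cos (z X0 Y0) \<noteq> - 1"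
      using gen w_pi by (auto simp: generic_at_def angle_pi_iff_cos)
    from type2_expansion[OF w_pi this] show ?case
      by (elim ex_forward conj_forward) (assumption, rule transfer, simp add: graph v0 eqs back_char_def)
  next
    case 4
    then have "dX w X0 Y0 \<noteq> 0" "dY z X0 Y0 \<noteq> 0" using gen w_pi by (auto simp: generic_at_def)
    then show ?case by (rule crossing_curves[OF w_pi 4])
  next
    case 5
    then have "dX w X0 Y0 \<noteq> 0" "dY z X0 Y0 \<noteq> 0" using gen w_pi by (auto simp: generic_at_def)
    from type3_expansion[OF w_pi 5 this] show ?case
      by (elim ex_forward conj_forward)
        (assumption, assumption, rule transfer, simp add: graph v0 eqs back_char_def fwd_char_def)
  qed
qed

end
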